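(* Let $\mathbb K\in\{\mathbb R,\mathbb C\}$, put $\eta_{\mathbb R}=1$, $\eta_{\mathbb C}=2$, let $p,q,d,k_\Sigma,k_\Omega,k$ be positive integers and $\varepsilon,\delta\in(0,1)$. Let $\Sigma\in\mathbb R^{k_\Sigma\times p}$ be drawn from the rescaled Gaussian distribution, and let $\Omega\in\mathbb R^{k_\Omega\times q}$ and $\Gamma\in\mathbb R^{k\times k_\Sigma k_\Omega}$ be drawn from the P-SRHT distribution, with $\Sigma,\Omega,\Gamma$ independent and $$k_\Sigma\ge 168\,\varepsilon^{-2}\big(6.9\,\eta_{\mathbb K}\,d+\log(6/\delta)\big),$$ $$k_\Omega\ge 32\,\frac{\big(\sqrt d+\sqrt{8\log(18\,q\,k_\Sigma/\delta)}\big)^2}{\varepsilon^2-\varepsilon^3/12}\,\log(9\,d\,k_\Sigma/\delta),$$ $$k\ge 32\,\frac{\big(\sqrt d+\sqrt{8\log(18\,k_\Omega k_\Sigma/\delta)}\big)^2}{\varepsilon^2-\varepsilon^3/12}\,\log(9d/\delta).$$ Then $\Upsilon:\mathbb K^{q\times p}\to\mathbb K^k$, $\Upsilon(X):=\Gamma\,\mathrm{vec}(\Omega X\Sigma^* )$, is a $(\varepsilon,\delta,d)$ oblivious $\mathbb K^{q\times p}\to\mathbb K^k$ subspace embedding.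
   Context: A $k\times n$ rescaled Gaussian matrix has i.i.d. real Gaussian entries with mean $0$ and variance $1/k$. A $k\times n$ P-SRHT (partial subsampled randomized Hadamard transform) matrix consists of the first $n$ columns of $k^{-1/2}RH_sD$, where $s$ is the power of $2$ with $n\le s<2n$, $R\in\mathbb R^{k\times s}$ (so $k\le s$) consists of the first $k$ rows of a uniformly random permutation of the rows of the $s\times s$ identity matrix, $H_s\in\mathbb R^{s\times s}$ is the Walsh--Hadamard matrix (with entries $\pm1$), and $D\in\mathbb R^{s\times s}$ is diagonal with i.i.d. uniformly random signs $\pm1$ on the diagonal, independent of $R$. $M^*$ is the conjugate transpose and $\mathrm{vec}$ stacks the columns of a matrix into a vector. $\mathbb K^n$ carries its canonical inner product and $\mathbb K^{q\times p}$ the Frobenius inner product $\langle X,Y\rangle_F=\mathrm{Tr}(X^*Y)$. For a finite-dimensional inner product space $Z$ over $\mathbb K$, a random linear map $\Theta:Z\to\mathbb K^k$ is called a $(\varepsilon,\delta,d)$ oblivious $Z\to\mathbb K^k$ subspace embedding if for every (deterministic) subspace $Z_d\subset Z$ with $\dim Z_d=d$, $$\mathbb P\big(\forall x,y\in Z_d:\ |\langle x,y\rangle_Z-\langle\Theta(x),\Theta(y)\rangle_2|\le\varepsilon\|x\|_Z\|y\|_Z\big)\ge 1-\delta .$$ *)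

theory Defs
  imports
    "HOL-Probability.Probability"
    "HOL-Probability.Product_PMF"
    "Jordan_Normal_Form.Schur_Decomposition"
begin

no_notation Finite_Cartesian_Product.vec_nth (infixl "$" 90)

text \<open>The Borel \<open>\<sigma>\<close>-algebra on the real \<open>nr \<times> nc\<close> matrices, pulled back from the product
  \<open>\<sigma>\<close>-algebra on the entries.\<close>

definition borel_mat :: "nat \<Rightarrow> nat \<Rightarrow> real mat measure" where
  "borel_mat nr nc = vimage_algebra (carrier_mat nr nc)
     (\<lambda>A. \<lambda>ij\<in>{..<nr} \<times> {..<nc}. A $$ ij) (PiM ({..<nr} \<times> {..<nc}) (\<lambda>_. borel))"

text \<open>The second parameter of \<^const>\<open>normal_density\<close> is the standard deviation, so the entries
  have variance \<open>1 / k\<close>.\<close>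

definition rescaled_gaussian :: "'w measure \<Rightarrow> nat \<Rightarrow> nat \<Rightarrow> ('w \<Rightarrow> real mat) \<Rightarrow> bool" where
  "rescaled_gaussian M k n S \<longleftrightarrow>
     S \<in> M \<rightarrow>\<^sub>M borel_mat k n \<and>
     prob_space.indep_vars M (\<lambda>_. borel) (\<lambda>ij \<omega>. S \<omega> $$ ij) ({..<k} \<times> {..<n}) \<and>
     (\<forall>ij \<in> {..<k} \<times> {..<n}.
        distributed M lborel (\<lambda>\<omega>. S \<omega> $$ ij) (normal_density 0 (1 / sqrt (real k))))"

text \<open>\<open>walsh_hadamard m\<close> is the matrix $H_s$ of size \<open>s = 2 ^ m\<close>, in Sylvester's ordering.\<close>

primrec walsh_hadamard :: "nat \<Rightarrow> real mat" where
  "walsh_hadamard 0 = 1\<^sub>m 1"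
| "walsh_hadamard (Suc m) =
     (let H = walsh_hadamard m in four_block_mat H H H (- H))"

text \<open>The first \<open>k\<close> rows of the identity matrix of size \<open>s\<close> after its rows have been permuted
  by \<open>\<pi>\<close>.\<close>

definition row_sampling_mat :: "nat \<Rightarrow> nat \<Rightarrow> (nat \<Rightarrow> nat) \<Rightarrow> real mat" where
  "row_sampling_mat k s \<pi> = mat k s (\<lambda>(i, j). (1\<^sub>m s) $$ (\<pi> i, j))"

definition sign_mat :: "nat \<Rightarrow> (nat \<Rightarrow> real) \<Rightarrow> real mat" where
  "sign_mat s \<sigma> = mat s s (\<lambda>(i, j). if i = j then \<sigma> i else 0)"

text \<open>The first \<open>n\<close> columns of $k^{-1/2} R H_s D$ with \<open>s = 2 ^ m\<close>.\<close>

definition psrht_mat :: "nat \<Rightarrow> nat \<Rightarrow> nat \<Rightarrow> (nat \<Rightarrow> nat) \<Rightarrow> (nat \<Rightarrow> real) \<Rightarrow> real mat" where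
  "psrht_mat k n m \<pi> \<sigma> = mat k n (\<lambda>(i, j).
     ((1 / sqrt (real k)) \<cdot>\<^sub>m
       (row_sampling_mat k (2 ^ m) \<pi> * walsh_hadamard m * sign_mat (2 ^ m) \<sigma>)) $$ (i, j))"

text \<open>The distribution is given as the law of $k^{-1/2} R H_s D$ for a uniform permutation and
  independent uniform signs, and only makes sense for \<open>k \<le> s\<close>. The exponent \<open>m\<close> below is
  uniquely determined by \<open>n\<close>. The value \<open>1\<close> passed to \<^const>\<open>Pi_pmf\<close> is only the default
  outside the index set.\<close>

definition psrht :: "'w measure \<Rightarrow> nat \<Rightarrow> nat \<Rightarrow> ('w \<Rightarrow> real mat) \<Rightarrow> bool" where
  "psrht M k n S \<longleftrightarrow>
     S \<in> M \<rightarrow>\<^sub>M borel_mat k n \<and>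
     (\<exists>m. n \<le> 2 ^ m \<and> 2 ^ m < 2 * n \<and> k \<le> 2 ^ m \<and>
        distr M (borel_mat k n) S =
        distr
          (measure_pmf (pair_pmf
             (pmf_of_set {\<pi>. \<pi> permutes {..<2 ^ m}})
             (Pi_pmf {..<2 ^ m} 1 (\<lambda>_. pmf_of_set {-1, 1}))))
          (borel_mat k n)
          (\<lambda>(\<pi>, \<sigma>). psrht_mat k n m \<pi> \<sigma>))"

text \<open>Here \<open>Z\<close> is the underlying vector space over \<open>'a\<close> and \<open>ip\<close> its inner product, antilinear
  in the first argument. The inner product $\langle x, y\rangle_2$ on \<open>carrier_vec k\<close> with the same
  convention is \<open>y \<bullet>c x\<close>. Since \<open>ip x x\<close> is real and nonnegative, \<open>sqrt (norm (ip x x))\<close> is the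
  induced norm. As \<^const>\<open>measure\<close> is \<open>0\<close> on non-measurable sets and \<open>\<delta> < 1\<close> in all uses, the
  last conjunct also asserts that the event is measurable. The first two conjuncts express that
  \<open>\<Theta>\<close> is a random linear map from \<open>Z\<close> to \<open>carrier_vec k\<close>.\<close>

definition ip_norm :: "('z \<Rightarrow> 'z \<Rightarrow> 'a::real_normed_field) \<Rightarrow> 'z \<Rightarrow> real" where
  "ip_norm ip x = sqrt (norm (ip x x))"

definition oblivious_subspace_embedding ::
  "'w measure \<Rightarrow> ('a::{conjugatable_field, real_normed_field}, 'z) module \<Rightarrow> ('z \<Rightarrow> 'z \<Rightarrow> 'a) \<Rightarrow>
   nat \<Rightarrow> real \<Rightarrow> real \<Rightarrow> nat \<Rightarrow> ('w \<Rightarrow> 'z \<Rightarrow> 'a Matrix.vec) \<Rightarrow> bool" where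
  "oblivious_subspace_embedding M Z ip k \<epsilon> \<delta> d \<Theta> \<longleftrightarrow>
     (\<forall>\<omega>\<in>space M. VectorSpace.linear_map class_ring Z (module_vec TYPE('a) k) (\<Theta> \<omega>)) \<and>
     (\<forall>z\<in>carrier Z. \<forall>i<k. (\<lambda>\<omega>. \<Theta> \<omega> z $ i) \<in> borel_measurable M) \<and>
     (\<forall>W. VectorSpace.subspace class_ring W Z \<longrightarrow>
        vectorspace.dim class_ring (Z\<lparr>carrier := W\<rparr>) = d \<longrightarrow>
        measure M {\<omega> \<in> space M. \<forall>x\<in>W. \<forall>y\<in>W.
          norm (ip x y - \<Theta> \<omega> y \<bullet>c \<Theta> \<omega> x) \<le> \<epsilon> * ip_norm ip x * ip_norm ip y} \<ge> 1 - \<delta>)"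

definition mat_trace :: "'a::comm_monoid_add mat \<Rightarrow> 'a" where
  "mat_trace A = (\<Sum>i<dim_row A. A $$ (i, i))"

definition frobenius_inner :: "'a::conjugatable_field mat \<Rightarrow> 'a mat \<Rightarrow> 'a" where
  "frobenius_inner X Y = mat_trace (mat_adjoint X * Y)"

text \<open>Column-stacking vectorization: entry \<open>(i, j)\<close> goes to position \<open>j * dim_row A + i\<close>.\<close>

definition vectorize :: "'a mat \<Rightarrow> 'a Matrix.vec" where
  "vectorize A = Matrix.vec (dim_row A * dim_col A)
     (\<lambda>l. A $$ (l mod dim_row A, l div dim_row A))"

definition Upsilon_map ::
  "real mat \<Rightarrow> real mat \<Rightarrow> real mat \<Rightarrow> 'a::{conjugatable_field, real_normed_field} mat \<Rightarrow> 'a Matrix.vec"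
where
  "Upsilon_map G Om S X =
     map_mat of_real G *\<^sub>v
       vectorize (map_mat of_real Om * X * mat_adjoint (map_mat of_real S))"

end

theory Submission imports Defs begin

text \<open>
The map \<open>\<Upsilon>\<close> is applied in three stages: \<open>X \<mapsto> X \<Sigma>\<^sup>*\<close>, then \<open>\<Omega>\<close> on each of the \<open>k\<^sub>\<Sigma>\<close> columns of
the result, then \<open>\<Gamma>\<close> on the stacked columns. If every stage changes the squared norms of the vectors that
come from a fixed \<open>d\<close>-dimensional subspace by a relative error of at most \<open>\<epsilon>/4\<close>, the total relative error
is at most \<open>\<epsilon>\<close> (\<open>three_stage_error\<close>), and a polarization argument turns the statement about squared norms
into the statement about inner products with the same \<open>\<epsilon>\<close> (\<open>polarization\<close>). A budget of \<open>\<delta>/3\<close> is given to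
\<open>\<Sigma>\<close>, \<open>\<delta>/(3 k\<^sub>\<Sigma>)\<close> to each column treated by \<open>\<Omega>\<close>, and \<open>\<delta>/3\<close> to \<open>\<Gamma>\<close>. Independence allows each
SRHT stage to treat the subspace produced by the previous stages as fixed: Fubini's theorem is applied to
the pair formed by the previous matrices and the current one (\<open>psrht_stage\<close>).

For the Gaussian stage, a matrix of unit norm is sent by \<open>\<Sigma>\<close> to a vector whose squared norm is a convex
combination of normalized chi-square variables with \<open>k\<^sub>\<Sigma>\<close> degrees of freedom, so that Jensen's inequality
reduces its exponential moments to those of one such variable (\<open>gaussian_mgf\<close>). A union bound
over a net of at most \<open>384 ^ N \<le> exp (6.9 * N)\<close> points in the \<open>N = \<eta> d\<close> real dimensions finishes the stage
(\<open>gaussian_embedding\<close>). The net consists of points with coordinates in \<open>1 / (7 \<surd>N)\<close> times the integers.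

For an SRHT, the subspace is given by an isometry \<open>v\<close> and the matrix \<open>H D v\<close> has \<open>s\<close> rows in dimension
\<open>d\<close>. The signs make all of these rows short with high probability: each of them has norm at most
\<open>\<surd>d + \<surd>(8 ln (6 n / \<delta>))\<close> outside of an event of small probability
(\<open>rademacher_tail\<close>). With the signs fixed, the rows form an isotropic family, and the sample of \<open>k\<close> rows
without replacement satisfies a matrix Chernoff bound (\<open>sampling_embedding\<close>). This bound is proved by
exchangeable pairs: exchanging a sampled row with an unsampled one preserves the uniform law of the permutation, which
bounds the derivative of the trace of the matrix exponential by the trace itself (\<open>stein_bound\<close>), and the
resulting differential inequality is integrated. Both SRHT hypotheses and the Gaussian hypothesis are these
bounds for the relative error \<open>\<epsilon>/4\<close>.

The argument is carried out over the complex numbers with vectors as functions on finite index sets. Real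
matrices are covered through an embedding of the scalars (\<open>scalar_embedding\<close>), and a subspace of dimension
\<open>d\<close> through a spanning family of \<open>d\<close> matrices.
\<close>

section \<open>Inner products on finite index sets and Gram--Schmidt\<close>

definition cip :: "'i set \<Rightarrow> ('i \<Rightarrow> complex) \<Rightarrow> ('i \<Rightarrow> complex) \<Rightarrow> complex" where
  "cip I x y = (\<Sum>i\<in>I. cnj (x i) * y i)"

definition sqn :: "'i set \<Rightarrow> ('i \<Rightarrow> complex) \<Rightarrow> real" where
  "sqn I x = (\<Sum>i\<in>I. (cmod (x i))\<^sup>2)"

definition orthonormal :: "'i set \<Rightarrow> nat \<Rightarrow> (nat \<Rightarrow> 'i \<Rightarrow> complex) \<Rightarrow> bool" where
  "orthonormal I m u \<longleftrightarrow> (\<forall>a<m. \<forall>b<m. cip I (u a) (u b) = of_bool (a = b))"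

lemma sqn_nonneg [simp]: "0 \<le> sqn I x"
  by (simp add: sqn_def sum_nonneg)

lemma sqn_cip: "of_real (sqn I x) = cip I x x"
  unfolding sqn_def cip_def
  by (simp add: complex_norm_square mult.commute del: of_real_power)

lemma sqn_eq_Re_cip: "sqn I x = Re (cip I x x)"
  by (metis sqn_cip Re_complex_of_real)

lemma cip_cnj: "cnj (cip I x y) = cip I y x"
  by (simp add: cip_def mult.commute)

lemma Re_cip_commute: "Re (cip I x y) = Re (cip I y x)"
  using arg_cong[OF cip_cnj[of I x y], of Re] by simp

lemma cip_sum_right: "cip I x (\<lambda>i. \<Sum>a\<in>A. f a i) = (\<Sum>a\<in>A. cip I x (f a))"
  by (simp add: cip_def sum_distrib_left sum.swap[of _ A])

lemma cip_scale_right: "cip I x (\<lambda>i. c * y i) = c * cip I x y"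
  by (simp add: cip_def sum_distrib_left mult_ac)

lemma cip_scale_left: "cip I (\<lambda>i. c * x i) y = cnj c * cip I x y"
  by (simp add: cip_def sum_distrib_left mult_ac)

lemma cip_diff_right: "cip I x (\<lambda>i. y i - z i) = cip I x y - cip I x z"
  by (simp add: cip_def sum_subtractf algebra_simps)

lemma cip_diff_left: "cip I (\<lambda>i. y i - z i) x = cip I y x - cip I z x"
  by (simp add: cip_def sum_subtractf algebra_simps)

lemma cip_add_right: "cip I x (\<lambda>i. y i + z i) = cip I x y + cip I x z"
  by (simp add: cip_def sum.distrib algebra_simps)

lemma cip_add_left: "cip I (\<lambda>i. y i + z i) x = cip I y x + cip I z x"
  by (simp add: cip_def sum.distrib algebra_simps)

lemma cip_sum_left: "cip I (\<lambda>i. \<Sum>a\<in>A. f a i) x = (\<Sum>a\<in>A. cip I (f a) x)"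
  by (simp add: cip_def sum_distrib_left sum_distrib_right sum.swap[of _ A])

lemma sqn_eq_0_iff: "finite I \<Longrightarrow> sqn I x = 0 \<longleftrightarrow> (\<forall>i\<in>I. x i = 0)"
  by (simp add: sqn_def sum_nonneg_eq_0_iff)

lemma sqn_scale: "sqn I (\<lambda>i. c * x i) = (cmod c)\<^sup>2 * sqn I x"
  by (simp add: sqn_def sum_distrib_left norm_mult power_mult_distrib)

lemma of_real_cmod_sq: "complex_of_real ((cmod z)\<^sup>2) = cnj z * z"
  by (metis complex_norm_square mult.commute of_real_power)

lemma sqn_diff: "sqn J (\<lambda>a. y a - z a) = sqn J y + sqn J z - 2 * Re (cip J y z)"
proof -
  have "Re (cip J z y) = Re (cip J y z)" by (rule Re_cip_commute)
  thus ?thesis unfolding sqn_eq_Re_cip by (simp add: cip_diff_left cip_diff_right)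
qed

lemma cip_residual:
  assumes "orthonormal I m u" "n < m"
  shows "cip I (u n) (\<lambda>i. x i - (\<Sum>a<m. cip I (u a) x * u a i)) = 0"
proof -
  have "(\<Sum>a<m. cip I (u a) x * cip I (u n) (u a)) = (\<Sum>a<m. if a = n then cip I (u a) x else 0)"
    using assms by (intro sum.cong) (auto simp: orthonormal_def)
  also have "\<dots> = cip I (u n) x" using assms by simp
  finally show ?thesis
    by (simp add: cip_diff_right cip_sum_right cip_scale_right)
qed

lemma sqn_residual:
  assumes "orthonormal I m u"
  shows "sqn I (\<lambda>i. x i - (\<Sum>a<m. cip I (u a) x * u a i)) = sqn I x - (\<Sum>a<m. (cmod (cip I (u a) x))\<^sup>2)"
proof -
  let ?r = "\<lambda>i. x i - (\<Sum>a<m. cip I (u a) x * u a i)"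
  have "cip I ?r ?r = cip I x ?r - (\<Sum>a<m. cnj (cip I (u a) x) * cip I (u a) ?r)"
    by (subst cip_diff_left) (simp add: cip_sum_left cip_scale_left)
  also have "(\<Sum>a<m. cnj (cip I (u a) x) * cip I (u a) ?r) = 0"
    by (intro sum.neutral ballI) (use cip_residual[OF assms] in simp)
  also have "cip I x ?r = cip I x x - (\<Sum>a<m. cip I (u a) x * cip I x (u a))"
    by (simp add: cip_diff_right cip_sum_right cip_scale_right)
  also have "(\<Sum>a<m. cip I (u a) x * cip I x (u a)) = of_real (\<Sum>a<m. (cmod (cip I (u a) x))\<^sup>2)"
    unfolding of_real_sum of_real_cmod_sq
    by (intro sum.cong) (simp_all add: cip_cnj)
  finally have "complex_of_real (sqn I ?r) = of_real (sqn I x - (\<Sum>a<m. (cmod (cip I (u a) x))\<^sup>2))"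
    by (simp add: sqn_cip)
  thus ?thesis using of_real_eq_iff by blast
qed

lemma orthonormal_extend:
  assumes u: "orthonormal I m u" and r: "\<And>a. a < m \<Longrightarrow> cip I (u a) r = 0" and s: "sqn I r = 1"
  shows "orthonormal I (Suc m) (u(m := r))"
proof -
  have r': "a < m \<Longrightarrow> cip I r (u a) = 0" for a
    using r[of a] cip_cnj[of I "u a" r] by simp
  have rr: "cip I r r = 1" using s sqn_cip[of I r] by simp
  show ?thesis unfolding orthonormal_def
  proof (intro allI impI)
    fix a b assume ab: "a < Suc m" "b < Suc m"
    show "cip I ((u(m := r)) a) ((u(m := r)) b) = of_bool (a = b)"
      using u r r' rr ab unfolding orthonormal_def
      by (cases "a = m"; cases "b = m") (auto simp: less_Suc_eq)
  qed
qed

text \<open>The orthonormal family is obtained by subtracting projections and dividing by a real norm, which does not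
leave the reals. Keeping track of the subfield matters because the number of real parameters of the subspace
enters the size of the net in the Gaussian stage.\<close>

lemma gram_schmidt_subfield:
  fixes x :: "nat \<Rightarrow> 'i \<Rightarrow> complex"
  assumes I: "finite I" and F: "F = UNIV \<or> F = \<real>" and x: "\<And>j i. j < d \<Longrightarrow> i \<in> I \<Longrightarrow> x j i \<in> F"
  shows "\<exists>m v. m \<le> d \<and> orthonormal I m v \<and> (\<forall>a<m. \<forall>i\<in>I. v a i \<in> F) \<and>
     (\<forall>j<d. \<forall>i\<in>I. x j i = (\<Sum>a<m. cip I (v a) (x j) * v a i))"
  using x
proof (induction d)
  case 0
  show ?case by (rule exI[of _ 0]) (simp add: orthonormal_def)
next
  case (Suc d)
  have "\<exists>m v. m \<le> d \<and> orthonormal I m v \<and> (\<forall>a<m. \<forall>i\<in>I. v a i \<in> F) \<and>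
     (\<forall>j<d. \<forall>i\<in>I. x j i = (\<Sum>a<m. cip I (v a) (x j) * v a i))"
    by (rule Suc.IH) (rule Suc.prems, simp_all)
  then obtain m v where mv: "m \<le> d" "orthonormal I m v" "\<And>a i. a < m \<Longrightarrow> i \<in> I \<Longrightarrow> v a i \<in> F"
     "\<And>j i. j < d \<Longrightarrow> i \<in> I \<Longrightarrow> x j i = (\<Sum>a<m. cip I (v a) (x j) * v a i)"
    by blast
  define r where "r = (\<lambda>i. x d i - (\<Sum>a<m. cip I (v a) (x d) * v a i))"
  have rF: "r i \<in> F" if "i \<in> I" for i
  proof (cases "F = UNIV")
    case False
    hence "F = \<real>" using F by simp
    have cnjR: "z \<in> \<real> \<Longrightarrow> cnj z \<in> \<real>" for z by (metis Reals_cnj_iff)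
    have "cip I (v a) (x d) \<in> \<real>" if "a < m" for a
      unfolding cip_def using mv(3)[OF that] Suc.prems[of d] \<open>F = \<real>\<close>
      by (intro sum_in_Reals Reals_mult cnjR) auto
    thus ?thesis unfolding r_def \<open>F = \<real>\<close> using mv(3) Suc.prems[of d] \<open>F = \<real>\<close> that
      by (intro Reals_diff sum_in_Reals Reals_mult) auto
  qed simp
  show ?case
  proof (cases "sqn I r = 0")
    case True
    hence "r i = 0" if "i \<in> I" for i
      using that sqn_eq_0_iff[OF I, of r] by blast
    hence xd: "x d i = (\<Sum>a<m. cip I (v a) (x d) * v a i)" if "i \<in> I" for i
      using that unfolding r_def right_minus_eq by blast
    show ?thesis
    proof (intro exI[of _ m] exI[of _ v] conjI allI impI ballI)
      fix j i assume "j < Suc d" "i \<in> I"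
      thus "x j i = (\<Sum>a<m. cip I (v a) (x j) * v a i)"
        using xd mv(4) less_Suc_eq[of j d] by blast
    qed (use mv(1-3) in auto)
  next
    case False
    define c where "c = sqrt (sqn I r)"
    have c: "c > 0" "c\<^sup>2 = sqn I r" using False sqn_nonneg[of I r] by (auto simp: c_def less_le)
    define w where "w = (\<lambda>i. of_real (1 / c) * r i)"
    have w1: "sqn I w = 1" unfolding w_def sqn_scale using c False by (simp add: power_divide norm_divide)
    have w0: "a < m \<Longrightarrow> cip I (v a) w = 0" for a
      unfolding w_def cip_scale_right r_def using cip_residual[OF mv(2)] by simp
    have w0': "a < m \<Longrightarrow> cip I w (v a) = 0" for a
      using w0[of a] cip_cnj[of I "v a" w] by simp
    have orth: "orthonormal I (Suc m) (v(m := w))" by (rule orthonormal_extend[OF mv(2) w0 w1])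
    have wF: "w i \<in> F" if "i \<in> I" for i
      using rF[OF that] F by (auto simp: w_def)
    have wx: "cip I w (x j) * w i = 0" if "j < d" for i j
    proof -
      have "cip I w (x j) = cip I w (\<lambda>i. \<Sum>a<m. cip I (v a) (x j) * v a i)"
        unfolding cip_def[of I w] by (intro sum.cong refl arg_cong[of _ _ "(*) _"] mv(4)[OF that])
      also have "\<dots> = 0" unfolding cip_sum_right cip_scale_right
        by (intro sum.neutral) (simp add: w0')
      finally show ?thesis by simp
    qed
    have wr: "r i = cip I w (x d) * w i" for i
    proof -
      have "cip I w r = of_real (1 / c) * of_real (c\<^sup>2)"
        unfolding w_def cip_scale_left c(2) sqn_cip by simp
      hence "cip I w r = of_real c"
        using c(1) by (simp add: power2_eq_square)
      moreover have "(\<Sum>a<m. cip I (v a) (x d) * cip I w (v a)) = 0"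
        by (intro sum.neutral) (simp add: w0')
      hence "cip I w r = cip I w (x d)"
        unfolding r_def cip_diff_right cip_sum_right cip_scale_right by simp
      ultimately show ?thesis using c by (simp add: w_def)
    qed
    show ?thesis
    proof (intro exI[of _ "Suc m"] exI[of _ "v(m := w)"] conjI allI impI ballI)
      show "Suc m \<le> Suc d" using mv by simp
      show "orthonormal I (Suc m) (v(m := w))" by fact
      show "(v(m := w)) a i \<in> F" if "a < Suc m" "i \<in> I" for a i
        using that mv(3) wF by (auto simp: less_Suc_eq)
      show "x j i = (\<Sum>a<Suc m. cip I ((v(m := w)) a) (x j) * (v(m := w)) a i)"
        if j: "j < Suc d" and i: "i \<in> I" for j i
      proof -
        have e: "(\<Sum>a<Suc m. cip I ((v(m := w)) a) (x j) * (v(m := w)) a i)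
           = (\<Sum>a<m. cip I (v a) (x j) * v a i) + cip I w (x j) * w i"
          by simp
        show ?thesis
        proof (cases "j = d")
          case True thus ?thesis unfolding e by (simp only: wr[of i, symmetric]) (simp only: r_def, simp)
        next
          case False
          hence "j < d" using j by simp
          from mv(4)[OF this i] wx[OF this, of i] show ?thesis unfolding e by (simp only: add_0_right)
        qed
      qed
    qed
  qed
qed

text \<open>Bessel's inequality for a unit coordinate vector. In the case of equality the residual vanishes, which
is the completeness relation at that coordinate.\<close>

lemma bessel_basis:
  assumes I: "finite I" and u: "orthonormal I m u" and a: "a \<in> I"
  shows "(\<Sum>n<m. (cmod (u n a))\<^sup>2) \<le> 1"
    and "(\<Sum>n<m. (cmod (u n a))\<^sup>2) = 1 \<Longrightarrow> b \<in> I \<Longrightarrow> (\<Sum>n<m. u n b * cnj (u n a)) = of_bool (a = b)"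
proof -
  define e where "e = (\<lambda>i. of_bool (i = a) :: complex)"
  have ce: "cip I (u n) e = cnj (u n a)" for n
  proof -
    have "cip I (u n) e = (\<Sum>i\<in>I. if i = a then cnj (u n i) else 0)"
      unfolding cip_def e_def by (intro sum.cong) auto
    thus ?thesis using a I by simp
  qed
  have se: "sqn I e = 1"
  proof -
    have "sqn I e = (\<Sum>i\<in>I. if i = a then 1 else 0)"
      unfolding sqn_def e_def by (intro sum.cong) auto
    thus ?thesis using a I by simp
  qed
  note r = sqn_residual[OF u, of e, unfolded ce se complex_mod_cnj]
  show "(\<Sum>n<m. (cmod (u n a))\<^sup>2) \<le> 1"
    using r sqn_nonneg[of I "\<lambda>i. e i - (\<Sum>n<m. cnj (u n a) * u n i)"] by linarith
  assume eq: "(\<Sum>n<m. (cmod (u n a))\<^sup>2) = 1" and b: "b \<in> I"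
  from r eq have "e b - (\<Sum>n<m. cnj (u n a) * u n b) = 0"
    using b I by (simp add: sqn_eq_0_iff)
  thus "(\<Sum>n<m. u n b * cnj (u n a)) = of_bool (a = b)"
    by (cases "a = b") (simp_all add: e_def mult.commute)
qed

lemma sum_cmod_orthonormal:
  assumes u: "orthonormal I m u"
  shows "(\<Sum>a\<in>I. \<Sum>n<m. (cmod (u n a))\<^sup>2) = real m"
proof -
  have "(\<Sum>a\<in>I. \<Sum>n<m. (cmod (u n a))\<^sup>2) = (\<Sum>n<m. sqn I (u n))"
    unfolding sqn_def by (rule sum.swap)
  also have "\<dots> = (\<Sum>n<m. 1)"
    using u by (intro sum.cong refl) (simp add: orthonormal_def sqn_eq_Re_cip)
  finally show ?thesis by simp
qed

text \<open>Summing Bessel's inequality over all \<open>d\<close> coordinates gives \<open>d\<close> on both sides, so equality holds for each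
coordinate.\<close>

lemma orthonormal_complete:
  assumes u: "orthonormal {..<d} d u" and a: "a < d" and b: "b < d"
  shows "(\<Sum>n<d. u n b * cnj (u n a)) = of_bool (a = b)"
proof (rule bessel_basis(2)[OF _ u])
  have "(\<Sum>a<d. 1 - (\<Sum>n<d. (cmod (u n a))\<^sup>2)) = 0"
    using sum_cmod_orthonormal[OF u] by (simp add: sum_subtractf)
  hence "\<forall>a\<in>{..<d}. 1 - (\<Sum>n<d. (cmod (u n a))\<^sup>2) = 0"
    by (subst (asm) sum_nonneg_eq_0_iff) (use bessel_basis(1)[OF _ u] in auto)
  thus "(\<Sum>n<d. (cmod (u n a))\<^sup>2) = 1" using a by simp
qed (use a b in auto)

text \<open>By the same count, fewer than \<open>d\<close> orthonormal vectors fail to have equality at some coordinate vector,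
whose residual then spans a new direction. Setting the coordinates from \<open>d\<close> on to zero gives the vector a
canonical representative, which makes the set of all such vectors compact in the function space.\<close>

lemma orthonormal_exists_orthogonal:
  assumes u: "orthonormal {..<d} m u" and m: "m < d"
  shows "\<exists>r. sqn {..<d} r = 1 \<and> (\<forall>n<m. cip {..<d} (u n) r = 0) \<and> (\<forall>i\<ge>d. r i = 0)"
proof -
  have "\<exists>a<d. (\<Sum>n<m. (cmod (u n a))\<^sup>2) < 1"
  proof (rule ccontr)
    assume "\<not> ?thesis"
    hence ge: "1 \<le> (\<Sum>n<m. (cmod (u n a))\<^sup>2)" if "a < d" for a
      using that by (meson not_less)
    have "(\<Sum>a<d. 1) \<le> (\<Sum>a<d. \<Sum>n<m. (cmod (u n a))\<^sup>2)"
      by (intro sum_mono) (use ge in simp)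
    thus False using sum_cmod_orthonormal[OF u] m by simp
  qed
  then obtain a where a: "a < d" "(\<Sum>n<m. (cmod (u n a))\<^sup>2) < 1" by blast
  define e where "e = (\<lambda>i. of_bool (i = a) :: complex)"
  have ce: "cip {..<d} (u n) e = cnj (u n a)" for n
  proof -
    have "cip {..<d} (u n) e = (\<Sum>i<d. if i = a then cnj (u n i) else 0)"
      unfolding cip_def e_def by (intro sum.cong) auto
    thus ?thesis using a by simp
  qed
  have se: "sqn {..<d} e = 1"
  proof -
    have "sqn {..<d} e = (\<Sum>i<d. if i = a then 1 else 0)"
      unfolding sqn_def e_def by (intro sum.cong) auto
    thus ?thesis using a by simp
  qed
  define r where "r = (\<lambda>i. e i - (\<Sum>n<m. cip {..<d} (u n) e * u n i))"
  have rpos: "sqn {..<d} r > 0"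
    using sqn_residual[OF u, of e] a ce se by (simp add: r_def)
  define c where "c = sqrt (sqn {..<d} r)"
  have c: "c > 0" "c\<^sup>2 = sqn {..<d} r" using rpos by (auto simp: c_def)
  define w where "w = (\<lambda>i. if i < d then of_real (1 / c) * r i else 0)"
  have sw: "sqn {..<d} w = sqn {..<d} (\<lambda>i. of_real (1 / c) * r i)"
    unfolding sqn_def w_def by (intro sum.cong) auto
  have cw: "cip {..<d} v w = cip {..<d} v (\<lambda>i. of_real (1 / c) * r i)" for v
    unfolding cip_def w_def by (intro sum.cong) auto
  have "sqn {..<d} w = 1" unfolding sw sqn_scale using c rpos by (simp add: power_divide norm_divide)
  moreover have "cip {..<d} (u n) w = 0" if "n < m" for n
    unfolding cw cip_scale_right using cip_residual[OF u that] by (simp add: r_def)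
  ultimately show ?thesis by (intro exI[of _ w]) (auto simp: w_def)
qed

text \<open>The matrix \<open>Y\<close> restricted to its leading \<open>d \<times> d\<close> block, so that its values stay in the subspace of
functions that vanish from \<open>d\<close> on.\<close>

definition matapp :: "nat \<Rightarrow> (nat \<Rightarrow> nat \<Rightarrow> complex) \<Rightarrow> (nat \<Rightarrow> complex) \<Rightarrow> nat \<Rightarrow> complex" where
  "matapp d Y x a = (if a < d then \<Sum>b<d. Y a b * x b else 0)"

lemma cip_matapp:
  assumes "\<And>a b. a < d \<Longrightarrow> b < d \<Longrightarrow> Y a b = cnj (Y b a)"
  shows "cip {..<d} x (matapp d Y y) = cip {..<d} (matapp d Y x) y"
proof -
  have "cip {..<d} x (matapp d Y y) = (\<Sum>a<d. \<Sum>b<d. cnj (x a) * Y a b * y b)"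
    unfolding cip_def matapp_def by (intro sum.cong refl) (auto simp: sum_distrib_left mult_ac)
  also have "\<dots> = (\<Sum>b<d. \<Sum>a<d. cnj (Y b a * x a) * y b)"
    by (subst sum.swap, intro sum.cong refl) (subst assms, auto simp: mult_ac)
  also have "\<dots> = cip {..<d} (matapp d Y x) y"
    unfolding cip_def matapp_def by (intro sum.cong refl) (simp add: sum_distrib_right)
  finally show ?thesis .
qed

text \<open>The quadratic form of \<open>Y\<close> attains its maximum \<open>\<mu>\<close> on the compact unit sphere of the orthogonal complement
of the eigenvectors \<open>u\<close>. A maximizer \<open>c\<close> is an eigenvector: the residual \<open>w = Y c - \<mu> c\<close> lies in the
same complement, and a small step from \<open>c\<close> in the direction of \<open>w\<close> would increase the Rayleigh quotient
unless \<open>w = 0\<close>.\<close>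

lemma eigenvector_in_complement:
  assumes herm: "\<And>a b. a < d \<Longrightarrow> b < d \<Longrightarrow> Y a b = cnj (Y b a)"
    and u: "orthonormal {..<d} m u" and m: "m < d"
    and ev: "\<And>n a. n < m \<Longrightarrow> a < d \<Longrightarrow> matapp d Y (u n) a = of_real (l n) * u n a"
  shows "\<exists>c \<mu>. sqn {..<d} c = 1 \<and> (\<forall>n<m. cip {..<d} (u n) c = 0) \<and>
     (\<forall>a<d. matapp d Y c a = of_real \<mu> * c a)"
proof -
  let ?I = "{..<d}"
  define K where "K = {c :: nat \<Rightarrow> complex. sqn ?I c = 1 \<and> (\<forall>n<m. cip ?I (u n) c = 0) \<and> (\<forall>i\<ge>d. c i = 0)}"
  define f where "f c = Re (cip ?I c (matapp d Y c))" for c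
  have cc: "continuous_on A (\<lambda>c :: nat \<Rightarrow> complex. c i)" for A i
    by (rule continuous_on_subset[OF continuous_on_product_coordinates]) auto
  have Ksub: "K \<subseteq> (\<Pi>\<^sub>E i\<in>UNIV. if i < d then cball 0 1 else {0})"
  proof
    fix c assume c: "c \<in> K"
    have "cmod (c i) \<le> 1" if "i < d" for i
    proof -
      have "(cmod (c i))\<^sup>2 \<le> sqn ?I c" unfolding sqn_def
        using that by (intro member_le_sum) auto
      thus ?thesis using c unfolding K_def by (simp add: abs_square_le_1 flip: power2_le_iff_abs_le)
    qed
    thus "c \<in> (\<Pi>\<^sub>E i\<in>UNIV. if i < d then cball 0 1 else {0})"
      using c by (auto simp: K_def)
  qed
  have "compact (\<Pi>\<^sub>E i\<in>(UNIV::nat set). if i < d then cball (0::complex) 1 else {0})"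
  proof -
    have "compactin (product_topology (\<lambda>_. euclidean) UNIV)
       (\<Pi>\<^sub>E i\<in>(UNIV::nat set). if i < d then cball (0::complex) 1 else {0})"
      by (subst compactin_PiE) auto
    thus ?thesis by (simp add: euclidean_product_topology)
  qed
  moreover have "closed K"
  proof -
    have "K = {c. sqn ?I c = 1} \<inter> (\<Inter>n\<in>{..<m}. {c. cip ?I (u n) c = 0}) \<inter> (\<Inter>i\<in>{d..}. {c. c i = 0})"
      unfolding K_def by auto
    moreover have "closed \<dots>"
      unfolding sqn_def cip_def
      by (intro closed_Int closed_INT ballI closed_Collect_eq continuous_intros cc)
    ultimately show ?thesis by simp
  qed
  ultimately have "compact K" using Ksub by (metis compact_Int_closed inf.absorb_iff2 inf_commute)
  moreover have "K \<noteq> {}" using orthonormal_exists_orthogonal[OF u m] by (auto simp: K_def)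
  moreover have "continuous_on K f"
  proof -
    have cm: "continuous_on K (\<lambda>c. matapp d Y c a)" for a
      unfolding matapp_def by (cases "a < d") (auto intro!: continuous_intros cc)
    show ?thesis unfolding f_def cip_def by (intro continuous_intros cc cm)
  qed
  ultimately obtain c where c: "c \<in> K" and max: "\<And>z. z \<in> K \<Longrightarrow> f z \<le> f c"
    using continuous_attains_sup by metis
  define \<mu> where "\<mu> = f c"
  have c1: "sqn ?I c = 1" and cu: "\<And>n. n < m \<Longrightarrow> cip ?I (u n) c = 0"
    using c by (auto simp: K_def)
  have maxU: "f z \<le> \<mu> * sqn ?I z" if z: "\<And>n. n < m \<Longrightarrow> cip ?I (u n) z = 0" for z
  proof (cases "sqn ?I z = 0")
    case True
    hence "z i = 0" if "i < d" for i using that by (simp add: sqn_eq_0_iff)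
    hence "f z = 0" by (simp add: f_def cip_def)
    thus ?thesis using True by simp
  next
    case False
    define s where "s = sqrt (sqn ?I z)"
    have s: "s > 0" "s\<^sup>2 = sqn ?I z" using False sqn_nonneg[of ?I z] by (auto simp: s_def less_le)
    define w where "w = (\<lambda>i. if i < d then of_real (1 / s) * z i else 0)"
    have sw: "sqn ?I w = sqn ?I (\<lambda>i. of_real (1 / s) * z i)"
      unfolding sqn_def w_def by (intro sum.cong) auto
    have cw: "cip ?I v w = cip ?I v (\<lambda>i. of_real (1 / s) * z i)" for v
      unfolding cip_def w_def by (intro sum.cong) auto
    have "sqn ?I w = 1" unfolding sw sqn_scale using s False by (simp add: power_divide norm_divide)
    moreover have "cip ?I (u n) w = 0" if "n < m" for n
      unfolding cw cip_scale_right using z[OF that] by simp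
    ultimately have "w \<in> K" unfolding K_def by (auto simp: w_def)
    hence le: "f w \<le> \<mu>" using max by (simp add: \<mu>_def)
    have "matapp d Y w a = of_real (1/s) * matapp d Y z a" for a
      unfolding matapp_def w_def by (auto simp: sum_distrib_left sum_divide_distrib mult_ac intro!: sum.cong)
    hence "f w = Re (cip ?I (\<lambda>i. of_real (1 / s) * z i) (\<lambda>a. of_real (1/s) * matapp d Y z a))"
      unfolding f_def cip_def w_def by (intro arg_cong[of _ _ Re] sum.cong) auto
    also have "\<dots> = f z / s\<^sup>2"
      unfolding cip_scale_left cip_scale_right f_def
      by (simp add: power2_eq_square field_simps flip: of_real_mult)
    finally have "f z \<le> \<mu> * s\<^sup>2" using le s(1) by (simp add: pos_divide_le_eq)
    thus ?thesis by (simp only: s(2))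
  qed
  define w where "w = (\<lambda>a. matapp d Y c a - of_real \<mu> * c a)"
  have wu: "cip ?I (u n) w = 0" if "n < m" for n
  proof -
    have "cip ?I (matapp d Y (u n)) c = cip ?I (\<lambda>a. of_real (l n) * u n a) c"
      unfolding cip_def using ev[OF that] by (intro sum.cong) auto
    hence "cip ?I (u n) (matapp d Y c) = 0"
      using cu[OF that] by (simp add: cip_matapp[OF herm] cip_scale_left)
    thus ?thesis using cu[OF that] by (simp add: w_def cip_diff_right cip_scale_right)
  qed
  have cYc: "cip ?I c (matapp d Y c) = of_real \<mu>"
  proof -
    have "cnj (cip ?I c (matapp d Y c)) = cip ?I c (matapp d Y c)"
      unfolding cip_cnj using cip_matapp[OF herm] by simp
    thus ?thesis by (simp add: \<mu>_def f_def complex_eq_iff)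
  qed
  have ww: "cip ?I w (matapp d Y c) - of_real \<mu> * cip ?I w c = of_real (sqn ?I w)"
  proof -
    have "cip ?I w w = cip ?I w (\<lambda>a. matapp d Y c a - of_real \<mu> * c a)"
      by (rule arg_cong[OF w_def])
    thus ?thesis unfolding sqn_cip by (simp add: cip_diff_right cip_scale_right)
  qed
  \<comment> \<open>Compare the form at \<open>c + t w\<close> with its bound \<open>\<mu>\<close>; the first-order term decides.\<close>
  have key: "0 \<le> t * (- 2 * sqn ?I w) + t\<^sup>2 * (\<mu> * sqn ?I w - f w)" for t :: real
  proof -
    define z where "z = (\<lambda>a. c a + of_real t * w a)"
    have "f z \<le> \<mu> * sqn ?I z"
      by (rule maxU) (simp add: z_def cip_add_right cip_scale_right cu wu)
    moreover have "sqn ?I z = 1 + 2 * t * Re (cip ?I w c) + t\<^sup>2 * sqn ?I w"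
    proof -
      have "Re (cip ?I c w) = Re (cip ?I w c)" by (rule Re_cip_commute)
      thus ?thesis
        unfolding sqn_eq_Re_cip z_def using c1[unfolded sqn_eq_Re_cip]
        by (simp add: cip_add_left cip_add_right cip_scale_left cip_scale_right power2_eq_square algebra_simps)
    qed
    moreover have "f z = \<mu> + 2 * t * Re (cip ?I w (matapp d Y c)) + t\<^sup>2 * f w"
    proof -
      have "matapp d Y z = (\<lambda>a. matapp d Y c a + of_real t * matapp d Y w a)"
        unfolding matapp_def z_def by (auto simp: fun_eq_iff sum_distrib_left sum.distrib algebra_simps)
      moreover have "Re (cip ?I c (matapp d Y w)) = Re (cip ?I w (matapp d Y c))"
        by (subst cip_matapp[OF herm, where x=c and y=w]) (assumption, assumption, rule Re_cip_commute)
      ultimately show ?thesis using cYc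
        unfolding f_def z_def
        by (simp add: cip_add_left cip_add_right cip_scale_left cip_scale_right power2_eq_square algebra_simps)
    qed
    moreover have "Re (cip ?I w (matapp d Y c)) = \<mu> * Re (cip ?I w c) + sqn ?I w"
      using arg_cong[OF ww, of Re] by simp
    ultimately show ?thesis by (simp add: algebra_simps)
  qed
  have "sqn ?I w = 0"
  proof (rule ccontr)
    assume "sqn ?I w \<noteq> 0"
    hence p: "sqn ?I w > 0" using sqn_nonneg[of ?I w] by linarith
    \<comment> \<open>A bound on the second-order coefficient, made positive so that the step \<open>t\<close> is defined.\<close>
    define B where "B = \<bar>\<mu> * sqn ?I w - f w\<bar> + 1"
    have B: "B > 0" "\<mu> * sqn ?I w - f w \<le> B" by (auto simp: B_def)
    define t where "t = sqn ?I w / B"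
    have t: "t > 0" using p B by (simp add: t_def)
    have "0 \<le> t * (- 2 * sqn ?I w) + t\<^sup>2 * B"
      using key[of t] mult_left_mono[OF B(2), of "t\<^sup>2"] by simp
    also have "\<dots> = - t * sqn ?I w" using B by (simp add: t_def power2_eq_square field_simps)
    also have "\<dots> < 0" using t p by simp
    finally show False by simp
  qed
  hence "\<forall>a<d. matapp d Y c a = of_real \<mu> * c a"
    by (simp add: sqn_eq_0_iff w_def)
  thus ?thesis using c1 cu by blast
qed

theorem hermitian_diagonalization:
  assumes herm: "\<And>a b. a < d \<Longrightarrow> b < d \<Longrightarrow> Y a b = cnj (Y b a)"
  shows "\<exists>u l. orthonormal {..<d} d u \<and>
     (\<forall>n<d. \<forall>a<d. (\<Sum>b<d. Y a b * u n b) = of_real (l n) * u n a)"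
proof -
  have "m \<le> d \<Longrightarrow> \<exists>u l. orthonormal {..<d} m u \<and>
     (\<forall>n<m. \<forall>a<d. matapp d Y (u n) a = of_real (l n) * u n a)" for m
  proof (induction m)
    case 0 show ?case by (simp add: orthonormal_def)
  next
    case (Suc m)
    then obtain u l where u: "orthonormal {..<d} m u" 
     and ev: "\<And>n a. n < m \<Longrightarrow> a < d \<Longrightarrow> matapp d Y (u n) a = of_real (l n) * u n a" by auto
    have m: "m < d" using Suc.prems by simp
    obtain c \<mu> where c: "sqn {..<d} c = 1" "\<And>n. n<m \<Longrightarrow> cip {..<d} (u n) c = 0"
     "\<And>a. a<d \<Longrightarrow> matapp d Y c a = of_real \<mu> * c a"
      using eigenvector_in_complement[OF herm u m ev] by blast
    show ?case
    proof (intro exI conjI)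
      show "orthonormal {..<d} (Suc m) (u(m := c))"
        by (rule orthonormal_extend[OF u c(2,1)])
      show "\<forall>n<Suc m. \<forall>a<d. matapp d Y ((u(m := c)) n) a = of_real ((l(m := \<mu>)) n) * (u(m := c)) n a"
        using ev c(3) by (auto simp: less_Suc_eq)
    qed
  qed
  from this[of d] show ?thesis by (auto simp: matapp_def)
qed

section \<open>Sampling isotropic rows without replacement\<close>

lemma sinh_le_mult_cosh:
  fixes x :: real
  assumes "0 \<le> x"
  shows "exp x - exp (- x) \<le> x * (exp x + exp (- x))"
proof -
  let ?f = "\<lambda>x :: real. x * (exp x + exp (- x)) - (exp x - exp (- x))"
  have "?f 0 \<le> ?f x"
  proof (rule DERIV_nonneg_imp_nondecreasing[OF assms])
    fix y :: real assume y: "0 \<le> y" "y \<le> x"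
    have "(?f has_real_derivative y * (exp y - exp (- y))) (at y)"
      by (auto intro!: derivative_eq_intros simp: algebra_simps)
    moreover have "0 \<le> y * (exp y - exp (- y))" using y by simp
    ultimately show "\<exists>D. (?f has_real_derivative D) (at y) \<and> 0 \<le> D" by blast
  qed
  thus ?thesis by simp
qed

text \<open>Writing \<open>p = m + h\<close> and \<open>q = m - h\<close>, the inequality for \<open>exp p - exp q\<close> is \<open>sinh h \<le> h cosh h\<close>. The
bound by the mean of the two end values, rather than by their maximum, is what makes the later differential
inequalities linear.\<close>

lemma exp_mean_value_bound:
  fixes a b :: real
  shows "\<bar>(a - b) * (exp (\<theta> * a) - exp (\<theta> * b))\<bar>
     \<le> \<bar>\<theta>\<bar> / 2 * (a - b)\<^sup>2 * (exp (\<theta> * a) + exp (\<theta> * b))"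
proof -
  have aux: "\<bar>exp p - exp q\<bar> \<le> \<bar>p - q\<bar> / 2 * (exp p + exp q)" if "q \<le> p" for p q :: real
  proof -
    define h m where "h = (p - q) / 2" and "m = (p + q) / 2"
    have pq: "p = m + h" "q = m - h" by (simp_all add: h_def m_def field_simps)
    have h: "0 \<le> h" using that by (simp add: h_def)
    have "exp m * (exp h - exp (- h)) \<le> exp m * (h * (exp h + exp (- h)))"
      by (intro mult_left_mono sinh_le_mult_cosh h) simp
    moreover have "exp p - exp q = exp m * (exp h - exp (- h))" "exp p + exp q = exp m * (exp h + exp (- h))"
      unfolding pq by (simp_all add: exp_add exp_diff exp_minus field_simps)
    moreover have "exp q \<le> exp p" using that by simp
    ultimately show ?thesis using h by (simp add: h_def[symmetric] abs_of_nonneg mult_ac)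
  qed
  have aux': "\<bar>exp p - exp q\<bar> \<le> \<bar>p - q\<bar> / 2 * (exp p + exp q)" for p q :: real
    using aux[of q p] aux[of p q] by (cases "q \<le> p") (auto simp: abs_minus_commute add.commute)
  have "\<bar>(a - b) * (exp (\<theta> * a) - exp (\<theta> * b))\<bar> = \<bar>a - b\<bar> * \<bar>exp (\<theta> * a) - exp (\<theta> * b)\<bar>"
    by (simp add: abs_mult)
  also have "\<dots> \<le> \<bar>a - b\<bar> * (\<bar>\<theta> * a - \<theta> * b\<bar> / 2 * (exp (\<theta> * a) + exp (\<theta> * b)))"
    by (intro mult_left_mono aux') simp
  also have "\<bar>\<theta> * a - \<theta> * b\<bar> = \<bar>\<theta>\<bar> * \<bar>a - b\<bar>"
    by (simp add: abs_mult flip: right_diff_distrib)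
  also have "\<bar>a - b\<bar> * (\<bar>\<theta>\<bar> * \<bar>a - b\<bar> / 2 * (exp (\<theta> * a) + exp (\<theta> * b)))
      = \<bar>\<theta>\<bar> / 2 * \<bar>a - b\<bar>\<^sup>2 * (exp (\<theta> * a) + exp (\<theta> * b))"
    by (simp add: power2_eq_square)
  finally show ?thesis by (simp only: power2_abs)
qed

lemma cip_expand:
  assumes u: "orthonormal {..<d} d u"
  shows "cip {..<d} x y = (\<Sum>n<d. cip {..<d} x (u n) * cip {..<d} (u n) y)"
proof -
  have "(\<Sum>n<d. cip {..<d} x (u n) * cip {..<d} (u n) y)
      = (\<Sum>n<d. \<Sum>b<d. \<Sum>a<d. cnj (x b) * u n b * (cnj (u n a) * y a))"
    unfolding cip_def by (simp add: sum_product)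
  also have "\<dots> = (\<Sum>b<d. \<Sum>a<d. \<Sum>n<d. cnj (x b) * u n b * (cnj (u n a) * y a))"
    by (subst sum.swap) (intro sum.cong refl sum.swap)
  also have "\<dots> = (\<Sum>b<d. \<Sum>a<d. cnj (x b) * y a * (\<Sum>n<d. u n b * cnj (u n a)))"
    by (simp add: sum_distrib_left mult_ac)
  also have "\<dots> = (\<Sum>b<d. \<Sum>a<d. if a = b then cnj (x b) * y a else 0)"
    by (intro sum.cong refl) (simp add: orthonormal_complete[OF u])
  also have "\<dots> = cip {..<d} x y" unfolding cip_def by simp
  finally show ?thesis ..
qed

lemma sqn_expand:
  assumes u: "orthonormal {..<d} d u"
  shows "sqn {..<d} x = (\<Sum>n<d. (cmod (cip {..<d} (u n) x))\<^sup>2)"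
proof -
  have "complex_of_real (sqn {..<d} x) = (\<Sum>n<d. cip {..<d} x (u n) * cip {..<d} (u n) x)"
    unfolding sqn_cip by (rule cip_expand[OF u])
  also have "\<dots> = of_real (\<Sum>n<d. (cmod (cip {..<d} (u n) x))\<^sup>2)"
    unfolding of_real_sum of_real_cmod_sq by (intro sum.cong) (simp_all add: cip_cnj)
  finally show ?thesis using of_real_eq_iff by blast
qed

text \<open>A matrix version of \<open>exp_mean_value_bound\<close>. If \<open>A\<close> and \<open>B\<close> are hermitian with eigenpairs \<open>(a, u)\<close> and
\<open>(b, w)\<close> and \<open>D = A - B\<close>, it says
\<open>\<bar>tr D (exp (\<theta> A) - exp (\<theta> B))\<bar> \<le> \<bar>\<theta>\<bar>/2 tr D\<^sup>2 (exp (\<theta> A) + exp (\<theta> B))\<close>. Expanding both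
traces in the two eigenbases turns all terms into sums over pairs of eigenvalues with the common nonnegative
weights \<open>\<bar>\<langle>u\<^sub>m, w\<^sub>n\<rangle>\<bar>\<^sup>2\<close>, and the scalar bound applies to each pair. Only the matrix entries of \<open>D\<close>
between the two bases enter, hence the form of the hypotheses.\<close>

lemma trace_exp_mean_value:
  assumes u: "orthonormal {..<d} d u" and w: "orthonormal {..<d} d w"
    and D: "\<And>m n. m < d \<Longrightarrow> n < d \<Longrightarrow>
       cip {..<d} (w n) (D (u m)) = of_real (a m - b n) * cip {..<d} (w n) (u m)"
    and D': "\<And>m n. m < d \<Longrightarrow> n < d \<Longrightarrow>
       cip {..<d} (u m) (D (w n)) = of_real (a m - b n) * cip {..<d} (u m) (w n)"
  shows "\<bar>(\<Sum>m<d. exp (\<theta> * a m) * Re (cip {..<d} (u m) (D (u m))))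
         - (\<Sum>n<d. exp (\<theta> * b n) * Re (cip {..<d} (w n) (D (w n))))\<bar>
     \<le> \<bar>\<theta>\<bar> / 2 * ((\<Sum>m<d. exp (\<theta> * a m) * sqn {..<d} (D (u m)))
                + (\<Sum>n<d. exp (\<theta> * b n) * sqn {..<d} (D (w n))))"
proof -
  let ?I = "{..<d}"
  define p where "p m n = (cmod (cip ?I (u m) (w n)))\<^sup>2" for m n
  have pc: "(cmod (cip ?I (w n) (u m)))\<^sup>2 = p m n" for m n
    unfolding p_def cip_cnj[of _ "u m", symmetric] by (simp only: complex_mod_cnj)
  have pp: "cip ?I (u m) (w n) * cip ?I (w n) (u m) = of_real (p m n)" for m n
    unfolding p_def of_real_cmod_sq by (simp add: cip_cnj mult.commute)
  have du: "Re (cip ?I (u m) (D (u m))) = (\<Sum>n<d. p m n * (a m - b n))" if "m < d" for m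
  proof -
    have "cip ?I (u m) (D (u m)) = (\<Sum>n<d. cip ?I (u m) (w n) * cip ?I (w n) (D (u m)))"
      by (rule cip_expand[OF w])
    also have "\<dots> = of_real (\<Sum>n<d. p m n * (a m - b n))"
      unfolding of_real_sum using D[OF that]
      by (intro sum.cong refl) (simp add: pp[symmetric] mult_ac)
    finally show ?thesis by simp
  qed
  have dw: "Re (cip ?I (w n) (D (w n))) = (\<Sum>m<d. p m n * (a m - b n))" if "n < d" for n
  proof -
    have "cip ?I (w n) (D (w n)) = (\<Sum>m<d. cip ?I (w n) (u m) * cip ?I (u m) (D (w n)))"
      by (rule cip_expand[OF u])
    also have "\<dots> = of_real (\<Sum>m<d. p m n * (a m - b n))"
      unfolding of_real_sum using D'[OF _ that]
      by (intro sum.cong refl) (simp add: pp[symmetric] mult_ac)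
    finally show ?thesis by simp
  qed
  have su: "sqn ?I (D (u m)) = (\<Sum>n<d. p m n * (a m - b n)\<^sup>2)" if "m < d" for m
    unfolding sqn_expand[OF w] using D[OF that]
    by (intro sum.cong refl) (simp add: norm_mult power_mult_distrib pc mult.commute del: of_real_diff)
  have sw: "sqn ?I (D (w n)) = (\<Sum>m<d. p m n * (a m - b n)\<^sup>2)" if "n < d" for n
    unfolding sqn_expand[OF u] using D'[OF _ that]
    by (intro sum.cong refl) (simp add: norm_mult power_mult_distrib p_def mult.commute del: of_real_diff)
  have "(\<Sum>m<d. exp (\<theta> * a m) * Re (cip ?I (u m) (D (u m)))) =
      (\<Sum>m<d. \<Sum>n<d. exp (\<theta> * a m) * (p m n * (a m - b n)))"
    by (intro sum.cong refl) (simp add: du sum_distrib_left)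
  moreover have "(\<Sum>n<d. exp (\<theta> * b n) * Re (cip ?I (w n) (D (w n)))) =
      (\<Sum>m<d. \<Sum>n<d. exp (\<theta> * b n) * (p m n * (a m - b n)))"
    by (subst sum.swap, intro sum.cong refl) (simp add: dw sum_distrib_left)
  ultimately have "(\<Sum>m<d. exp (\<theta> * a m) * Re (cip ?I (u m) (D (u m))))
         - (\<Sum>n<d. exp (\<theta> * b n) * Re (cip ?I (w n) (D (w n))))
     = (\<Sum>m<d. \<Sum>n<d. p m n * ((a m - b n) * (exp (\<theta> * a m) - exp (\<theta> * b n))))"
    by (simp add: sum_subtractf[symmetric] algebra_simps)
  also have "\<bar>\<dots>\<bar> \<le> (\<Sum>m<d. \<Sum>n<d. \<bar>p m n * ((a m - b n) * (exp (\<theta> * a m) - exp (\<theta> * b n)))\<bar>)"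
    by (rule order.trans[OF sum_abs]) (intro sum_mono sum_abs)
  also have "\<dots> \<le> (\<Sum>m<d. \<Sum>n<d. p m n * (\<bar>\<theta>\<bar> / 2 * (a m - b n)\<^sup>2 * (exp (\<theta> * a m) + exp (\<theta> * b n))))"
  proof (intro sum_mono)
    fix m n
    have "p m n \<ge> 0" by (simp add: p_def)
    thus "\<bar>p m n * ((a m - b n) * (exp (\<theta> * a m) - exp (\<theta> * b n)))\<bar>
      \<le> p m n * (\<bar>\<theta>\<bar> / 2 * (a m - b n)\<^sup>2 * (exp (\<theta> * a m) + exp (\<theta> * b n)))"
      using mult_left_mono[OF exp_mean_value_bound[of "a m" "b n" \<theta>], of "p m n"] 
      by (simp add: abs_mult)
  qed
  also have "\<dots> = \<bar>\<theta>\<bar> / 2 * ((\<Sum>m<d. \<Sum>n<d. exp (\<theta> * a m) * (p m n * (a m - b n)\<^sup>2))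
                + (\<Sum>m<d. \<Sum>n<d. exp (\<theta> * b n) * (p m n * (a m - b n)\<^sup>2)))"
    unfolding sum.distrib[symmetric] unfolding sum_distrib_left
    by (intro sum.cong refl) (simp add: algebra_simps)
  also have "(\<Sum>m<d. \<Sum>n<d. exp (\<theta> * a m) * (p m n * (a m - b n)\<^sup>2)) = (\<Sum>m<d. exp (\<theta> * a m) * sqn ?I (D (u m)))"
    by (intro sum.cong refl) (simp add: su sum_distrib_left)
  also have "(\<Sum>m<d. \<Sum>n<d. exp (\<theta> * b n) * (p m n * (a m - b n)\<^sup>2)) = (\<Sum>n<d. exp (\<theta> * b n) * sqn ?I (D (w n)))"
    by (subst sum.swap, intro sum.cong refl) (simp add: sw sum_distrib_left)
  finally show ?thesis .
qed

text \<open>The rows \<open>x r\<close> are the vectors from which \<open>k\<close> are sampled without replacement, as the values of a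
uniform permutation at \<open>0, \<dots>, k - 1\<close>.\<close>

locale isotropic_rows =
  fixes s k d :: nat and x :: "nat \<Rightarrow> nat \<Rightarrow> complex" and M :: real
  assumes k: "0 < k" "k \<le> s"
    and isotropic: "\<And>a b. a < d \<Longrightarrow> b < d \<Longrightarrow>
       (\<Sum>r<s. x r a * cnj (x r b)) = of_nat s * of_bool (a = b)"
    and row_bound: "\<And>r. r < s \<Longrightarrow> sqn {..<d} (x r) \<le> M"
    and M: "0 < M"
begin

abbreviation I where "I \<equiv> {..<d}"

text \<open>The rank-one operator \<open>x\<^sub>r x\<^sub>r\<^sup>* / k\<close>, applied to \<open>c\<close>.\<close>

definition X where "X r c a = x r a * cip I (x r) c / of_nat k"

definition P where "P = {\<pi>. \<pi> permutes {..<s}}"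

text \<open>The deviation of the sample covariance from its mean, the identity.\<close>

definition Y where "Y \<pi> a b = (\<Sum>i<k. x (\<pi> i) a * cnj (x (\<pi> i) b)) / of_nat k - of_bool (a = b)"

lemma Y_hermitian: "Y \<pi> a b = cnj (Y \<pi> b a)"
  by (cases "a = b") (simp_all add: Y_def mult.commute)

text \<open>An orthonormal eigenbasis \<open>u \<pi>\<close> of \<open>Y \<pi>\<close> with eigenvalues \<open>l \<pi>\<close>. The matrix exponential enters only
through these.\<close>

definition u where "u \<pi> = (SOME u. \<exists>l. orthonormal I d u \<and>
     (\<forall>n<d. \<forall>a<d. (\<Sum>b<d. Y \<pi> a b * u n b) = of_real (l n) * u n a))"

definition l where "l \<pi> = (SOME l. orthonormal I d (u \<pi>) \<and>
     (\<forall>n<d. \<forall>a<d. (\<Sum>b<d. Y \<pi> a b * u \<pi> n b) = of_real (l n) * u \<pi> n a))"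

lemma eigen_spec: "orthonormal I d (u \<pi>) \<and>
     (\<forall>n<d. \<forall>a<d. (\<Sum>b<d. Y \<pi> a b * u \<pi> n b) = of_real (l \<pi> n) * u \<pi> n a)"
proof -
  have "\<exists>u l. orthonormal I d u \<and>
     (\<forall>n<d. \<forall>a<d. (\<Sum>b<d. Y \<pi> a b * u n b) = of_real (l n) * u n a)"
    by (rule hermitian_diagonalization) (rule Y_hermitian)
  from someI_ex[OF this] have "\<exists>l. orthonormal I d (u \<pi>) \<and>
     (\<forall>n<d. \<forall>a<d. (\<Sum>b<d. Y \<pi> a b * u \<pi> n b) = of_real (l n) * u \<pi> n a)"
    unfolding u_def .
  from someI_ex[OF this] show ?thesis unfolding l_def .
qed

lemmas u_orth = eigen_spec[THEN conjunct1]

lemma Y_apply: "a < d \<Longrightarrow> (\<Sum>b<d. Y \<pi> a b * c b) = (\<Sum>i<k. X (\<pi> i) c a) - c a"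
proof -
  assume a: "a < d"
  have "(\<Sum>b<d. Y \<pi> a b * c b) = (\<Sum>b<d. \<Sum>i<k. x (\<pi> i) a * cnj (x (\<pi> i) b) * c b / of_nat k) - (\<Sum>b<d. if a = b then c b else 0)"
    unfolding Y_def by (simp add: left_diff_distrib sum_subtractf sum_divide_distrib sum_distrib_right of_bool_def if_distrib[of "\<lambda>x. x * _"] cong: if_cong)
  also have "(\<Sum>b<d. \<Sum>i<k. x (\<pi> i) a * cnj (x (\<pi> i) b) * c b / of_nat k) = (\<Sum>i<k. X (\<pi> i) c a)"
    unfolding X_def cip_def
    by (subst sum.swap) (simp add: sum_distrib_left sum_divide_distrib mult_ac)
  finally show ?thesis using a by simp
qed

lemma sample_sum_eigenvector: "n < d \<Longrightarrow> a < d \<Longrightarrow> (\<Sum>i<k. X (\<pi> i) (u \<pi> n) a) = of_real (1 + l \<pi> n) * u \<pi> n a"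
  using eigen_spec[of \<pi>] Y_apply[of a \<pi> "u \<pi> n"] by (simp add: algebra_simps)

lemma cip_X: "cip I y (X r c) = cip I y (x r) * cip I (x r) c / of_nat k"
  unfolding cip_def[of _ y] X_def by (simp add: sum_distrib_left sum_divide_distrib mult_ac)

lemma cip_X_adj: "cip I y (X r c) = cip I (X r y) c"
proof -
  have "cip I (X r y) c = cnj (cip I c (X r y))" by (simp add: cip_cnj)
  thus ?thesis unfolding cip_X by (simp add: cip_cnj mult.commute)
qed

lemma cip_sum_X: "n < d \<Longrightarrow> (\<Sum>i<k. cip I y (X (\<pi> i) (u \<pi> n))) = of_real (1 + l \<pi> n) * cip I y (u \<pi> n)"
proof -
  assume n: "n < d"
  have "(\<Sum>i<k. cip I y (X (\<pi> i) (u \<pi> n))) = cip I y (\<lambda>a. \<Sum>i<k. X (\<pi> i) (u \<pi> n) a)"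
    by (simp add: cip_sum_right)
  also have "\<dots> = cip I y (\<lambda>a. of_real (1 + l \<pi> n) * u \<pi> n a)"
    unfolding cip_def using sample_sum_eigenvector[OF n] by (intro sum.cong) auto
  finally show ?thesis by (simp add: cip_scale_right)
qed

lemma sum_all_X: 
  assumes "a < d" 
  shows "(\<Sum>r<s. X r c a) = of_real (s / k) * c a"
proof -
  have "(\<Sum>r<s. X r c a) = (\<Sum>b<d. (\<Sum>r<s. x r a * cnj (x r b)) * c b) / of_nat k"
    unfolding X_def cip_def sum_distrib_left sum_divide_distrib[symmetric] sum_distrib_right
    by (subst sum.swap) (simp add: mult_ac)
  also have "\<dots> = (\<Sum>b<d. if a = b then of_nat s * c b else 0) / of_nat k"
    by (intro arg_cong2[of _ _ _ _ "(/)"] sum.cong refl) (simp add: isotropic assms)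
  finally show ?thesis using assms by simp
qed

lemma sum_perm: "\<pi> \<in> P \<Longrightarrow> (\<Sum>i<s. f (\<pi> i)) = (\<Sum>r<s. f r)"
  using sum.permute[of \<pi> "{..<s}" f] by (simp add: P_def o_def)

lemma sum_split: "(\<Sum>i<k. f i) + (\<Sum>j\<in>{k..<s}. f j) = (\<Sum>i<s. f (i::nat) :: 'z :: comm_monoid_add)"
  using sum.atLeastLessThan_concat[of 0 k s f] k by (simp add: atLeast0LessThan)

lemma rest_X: "\<pi> \<in> P \<Longrightarrow> n < d \<Longrightarrow> a < d \<Longrightarrow> 
  (\<Sum>j\<in>{k..<s}. X (\<pi> j) (u \<pi> n) a) = of_real (s / k - 1 - l \<pi> n) * u \<pi> n a"
  using sum_split[of "\<lambda>i. X (\<pi> i) (u \<pi> n) a"] sum_perm[of \<pi> "\<lambda>i. X i (u \<pi> n) a"] sample_sum_eigenvector[of n a \<pi>]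
    sum_all_X[of a "u \<pi> n"]
  by (simp add: algebra_simps)

lemma sqn_eigenvector: "n < d \<Longrightarrow> sqn I (u \<pi> n) = 1"
  using u_orth[of \<pi>] by (simp add: orthonormal_def sqn_eq_Re_cip)

lemma weight_head: "n < d \<Longrightarrow> (\<Sum>i<k. (cmod (cip I (x (\<pi> i)) (u \<pi> n)))\<^sup>2 / k) = 1 + l \<pi> n"
proof -
  assume n: "n < d"
  have "complex_of_real (\<Sum>i<k. (cmod (cip I (x (\<pi> i)) (u \<pi> n)))\<^sup>2 / k) = (\<Sum>i<k. cip I (u \<pi> n) (X (\<pi> i) (u \<pi> n)))"
    unfolding of_real_sum of_real_divide of_real_cmod_sq
    by (simp add: cip_X cip_cnj)
  also have "\<dots> = of_real (1 + l \<pi> n)" unfolding cip_sum_X[OF n] using sqn_eigenvector[OF n, of \<pi>] 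
    by (simp flip: sqn_cip)
  finally show ?thesis using of_real_eq_iff by blast
qed

lemma weight_all: "\<pi> \<in> P \<Longrightarrow> n < d \<Longrightarrow> (\<Sum>i<s. (cmod (cip I (x (\<pi> i)) (u \<pi> n)))\<^sup>2 / k) = s / k"
proof -
  assume pi: "\<pi> \<in> P" and n: "n < d"
  have "complex_of_real (\<Sum>i<s. (cmod (cip I (x (\<pi> i)) (u \<pi> n)))\<^sup>2 / k) = (\<Sum>i<s. cip I (u \<pi> n) (X (\<pi> i) (u \<pi> n)))"
    unfolding of_real_sum of_real_divide of_real_cmod_sq
    by (simp add: cip_X cip_cnj)
  also have "\<dots> = (\<Sum>r<s. cip I (u \<pi> n) (X r (u \<pi> n)))"
    using sum_perm[OF pi, of "\<lambda>r. cip I (u \<pi> n) (X r (u \<pi> n))"] .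
  also have "\<dots> = cip I (u \<pi> n) (\<lambda>a. \<Sum>r<s. X r (u \<pi> n) a)" by (simp add: cip_sum_right)
  also have "\<dots> = cip I (u \<pi> n) (\<lambda>a. of_real (s / k) * u \<pi> n a)"
    unfolding cip_def using sum_all_X by (intro sum.cong) auto
  also have "\<dots> = of_real (s / k)" using sqn_eigenvector[OF n, of \<pi>]
    unfolding cip_scale_right sqn_cip[symmetric] by simp
  finally show ?thesis using of_real_eq_iff by blast
qed

text \<open>The unsampled rows carry the complementary weight, by isotropy of the whole family. Together with
\<open>weight_head\<close> it confines the eigenvalues to the interval from \<open>-1\<close> to \<open>s / k - 1\<close>.\<close>

lemma weight_tail: "\<pi> \<in> P \<Longrightarrow> n < d \<Longrightarrow>
   (\<Sum>j\<in>{k..<s}. (cmod (cip I (x (\<pi> j)) (u \<pi> n)))\<^sup>2 / k) = s / k - 1 - l \<pi> n"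
  using weight_all[of \<pi> n] weight_head[of n \<pi>] sum_split[of "\<lambda>i. (cmod (cip I (x (\<pi> i)) (u \<pi> n)))\<^sup>2 / k"]
  by simp

lemma l_ge: "n < d \<Longrightarrow> 0 \<le> 1 + l \<pi> n"
  unfolding weight_head[symmetric] by (intro sum_nonneg) simp

lemma l_le: "\<pi> \<in> P \<Longrightarrow> n < d \<Longrightarrow> 0 \<le> s / k - 1 - l \<pi> n"
  unfolding weight_tail[symmetric] by (intro sum_nonneg) simp

lemma sqn_X_le: "r < s \<Longrightarrow> sqn I (X r c) \<le> (M / k) * ((cmod (cip I (x r) c))\<^sup>2 / k)"
proof -
  assume r: "r < s"
  have "sqn I (X r c) = sqn I (\<lambda>a. (cip I (x r) c / of_nat k) * x r a)"
    unfolding X_def by (simp add: mult_ac)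
  also have "\<dots> = ((cmod (cip I (x r) c))\<^sup>2 / k\<^sup>2) * sqn I (x r)"
    unfolding sqn_scale by (simp add: norm_divide power_divide)
  also have "\<dots> \<le> ((cmod (cip I (x r) c))\<^sup>2 / k\<^sup>2) * M"
    by (intro mult_left_mono row_bound r) simp
  finally show ?thesis by (simp add: power2_eq_square mult_ac)
qed

text \<open>For \<open>i < k \<le> j\<close>, the change of \<open>Y\<close> when the sampled row \<open>\<pi> i\<close> is exchanged with the unsampled row
\<open>\<pi> j\<close>.\<close>

definition D where "D \<pi> i j c a = X (\<pi> i) c a - X (\<pi> j) c a"

lemma perm_less: "\<pi> \<in> P \<Longrightarrow> i < s \<Longrightarrow> \<pi> i < s"
  unfolding P_def using permutes_in_image[of \<pi> "{..<s}" i] by simp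

text \<open>Summed over all exchanges, \<open>D\<^sup>2\<close> is bounded by an affine function of the eigenvalue. The two squares are
controlled by the row bound and the weights of the sampled and the unsampled rows, and the cross terms add
up to \<open>- 2 (1 + \<mu>) (s / k - 1 - \<mu>)\<close>, which has the favourable sign.\<close>

lemma sum_sqn_D:
  assumes pi: "\<pi> \<in> P" and n: "n < d"
  shows "(\<Sum>i<k. \<Sum>j\<in>{k..<s}. sqn I (D \<pi> i j (u \<pi> n))) \<le> M / k * s * (2 + l \<pi> n)"
proof -
  define U where "U = u \<pi> n"
  define \<mu> where "\<mu> = l \<pi> n"
  define W where "W i = (cmod (cip I (x (\<pi> i)) U))\<^sup>2 / k" for i
  have W: "(\<Sum>i<k. W i) = 1 + \<mu>" "(\<Sum>j\<in>{k..<s}. W j) = s / k - 1 - \<mu>"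
    using weight_head[OF n, of \<pi>] weight_tail[OF pi n] by (simp_all add: W_def U_def \<mu>_def)
  have S: "sqn I (X (\<pi> i) U) \<le> M / k * W i" if "i < s" for i
    unfolding W_def by (rule sqn_X_le) (rule perm_less[OF pi that])
  have cross: "(\<Sum>i<k. \<Sum>j\<in>{k..<s}. Re (cip I (X (\<pi> i) U) (X (\<pi> j) U))) = (1 + \<mu>) * (s / k - 1 - \<mu>)"
  proof -
    have "(\<Sum>i<k. \<Sum>j\<in>{k..<s}. cip I (X (\<pi> i) U) (X (\<pi> j) U))
       = cip I (\<lambda>a. \<Sum>i<k. X (\<pi> i) U a) (\<lambda>a. \<Sum>j\<in>{k..<s}. X (\<pi> j) U a)"
      by (simp add: cip_sum_left cip_sum_right)
    also have "\<dots> = cip I (\<lambda>a. of_real (1 + \<mu>) * U a) (\<lambda>a. of_real (s / k - 1 - \<mu>) * U a)"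
      unfolding cip_def using sample_sum_eigenvector[OF n] rest_X[OF pi n]
      by (intro sum.cong) (auto simp: U_def \<mu>_def)
    also have "\<dots> = of_real ((1 + \<mu>) * (s / k - 1 - \<mu>))"
      using sqn_eigenvector[OF n, of \<pi>] unfolding cip_scale_left cip_scale_right
      by (simp add: U_def flip: sqn_cip)
    finally have "Re (\<Sum>i<k. \<Sum>j\<in>{k..<s}. cip I (X (\<pi> i) U) (X (\<pi> j) U)) = (1 + \<mu>) * (s / k - 1 - \<mu>)"
      by (simp only: Re_complex_of_real)
    thus ?thesis by simp
  qed
  have "(\<Sum>i<k. \<Sum>j\<in>{k..<s}. sqn I (D \<pi> i j U)) 
    = (\<Sum>i<k. \<Sum>j\<in>{k..<s}. sqn I (X (\<pi> i) U) + sqn I (X (\<pi> j) U)) - 2 * ((1 + \<mu>) * (s / k - 1 - \<mu>))"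
    unfolding cross[symmetric] D_def sqn_diff sum_subtractf by (simp add: sum_distrib_left)
  also have "\<dots> \<le> (\<Sum>i<k. \<Sum>j\<in>{k..<s}. sqn I (X (\<pi> i) U) + sqn I (X (\<pi> j) U))"
    using l_ge[OF n, of \<pi>] l_le[OF pi n] by (simp add: \<mu>_def)
  also have "\<dots> \<le> (\<Sum>i<k. \<Sum>j\<in>{k..<s}. M / k * W i + M / k * W j)"
    using k by (intro sum_mono add_mono S) auto
  also have "\<dots> = M / k * ((s - k) * (1 + \<mu>) + k * (s / k - 1 - \<mu>))"
  proof -
    have "(\<Sum>i<k. \<Sum>j\<in>{k..<s}. C * W i + C * W j) = C * ((s - k) * (\<Sum>i<k. W i) + k * (\<Sum>j\<in>{k..<s}. W j))" for C
    proof -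
      have "(\<Sum>i<k. \<Sum>j\<in>{k..<s}. C * W i + C * W j)
          = (\<Sum>i<k. real (s - k) * (C * W i) + C * (\<Sum>j\<in>{k..<s}. W j))"
        by (simp add: sum.distrib sum_distrib_left)
      also have "\<dots> = real (s - k) * (C * (\<Sum>i<k. W i)) + k * (C * (\<Sum>j\<in>{k..<s}. W j))"
        by (simp add: sum.distrib flip: sum_distrib_left)
      finally show ?thesis using k by (simp add: of_nat_diff algebra_simps)
    qed
    thus ?thesis unfolding W .
  qed
  also have "\<dots> = M / k * (s * (2 + \<mu>) - 2 * k * (1 + \<mu>))"
    using k by (simp add: field_simps)
  also have "\<dots> \<le> M / k * (s * (2 + \<mu>))"
    using l_ge[OF n, of \<pi>] M by (intro mult_left_mono) (auto simp: \<mu>_def)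
  finally show ?thesis by (simp add: U_def \<mu>_def mult_ac)
qed

lemma cip_sum_X': "n < d \<Longrightarrow> (\<Sum>i<k. cip I (X (\<pi> i) (u \<pi> n)) y) = of_real (1 + l \<pi> n) * cip I (u \<pi> n) y"
  using arg_cong[OF cip_sum_X[of n y \<pi>], of cnj] by (simp add: cip_cnj)

lemma sum_swap:
  fixes f :: "nat \<Rightarrow> 'z::ab_group_add"
  assumes "i < k" "k \<le> j"
  shows "(\<Sum>r<k. f ((\<pi> \<circ> Transposition.transpose i j) r)) = (\<Sum>r<k. f (\<pi> r)) - f (\<pi> i) + f (\<pi> j)"
proof -
  have "(\<Sum>r<k. f ((\<pi> \<circ> Transposition.transpose i j) r)) = f (\<pi> j) + (\<Sum>r\<in>{..<k}-{i}. f ((\<pi> \<circ> Transposition.transpose i j) r))"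
    using assms by (subst sum.remove[of _ i]) auto
  also have "(\<Sum>r\<in>{..<k}-{i}. f ((\<pi> \<circ> Transposition.transpose i j) r)) = (\<Sum>r\<in>{..<k}-{i}. f (\<pi> r))"
    using assms by (intro sum.cong refl) (auto simp: Transposition.transpose_def)
  also have "\<dots> = (\<Sum>r<k. f (\<pi> r)) - f (\<pi> i)"
    using assms by (subst sum.remove[of "{..<k}" i]) auto
  finally show ?thesis by simp
qed

text \<open>Between the eigenbases for \<open>\<pi>\<close> and for the exchanged permutation, \<open>D = Y \<pi> - Y \<pi>'\<close> acts as multiplication
by the difference of the eigenvalues.\<close>

lemma D_between:
  assumes ij: "i < k" "k \<le> j" and m: "m < d" and n: "n < d"
  shows "cip I (u (\<pi> \<circ> Transposition.transpose i j) n) (D \<pi> i j (u \<pi> m)) =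
      of_real (l \<pi> m - l (\<pi> \<circ> Transposition.transpose i j) n) * cip I (u (\<pi> \<circ> Transposition.transpose i j) n) (u \<pi> m)"
    and "cip I (u \<pi> m) (D \<pi> i j (u (\<pi> \<circ> Transposition.transpose i j) n)) =
      of_real (l \<pi> m - l (\<pi> \<circ> Transposition.transpose i j) n) * cip I (u \<pi> m) (u (\<pi> \<circ> Transposition.transpose i j) n)"
proof -
  define \<pi>' where "\<pi>' = \<pi> \<circ> Transposition.transpose i j"
  let ?U = "u \<pi> m" and ?W = "u \<pi>' n"
  have 1: "(\<Sum>r<k. cip I ?W (X (\<pi>' r) ?U)) = of_real (1 + l \<pi>' n) * cip I ?W ?U"
    using cip_sum_X'[OF n, of \<pi>' ?U] by (simp only: cip_X_adj)
  have 2: "(\<Sum>r<k. cip I ?U (X (\<pi> r) ?W)) = of_real (1 + l \<pi> m) * cip I ?U ?W"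
    using cip_sum_X'[OF m, of \<pi> ?W] by (simp only: cip_X_adj)
  show "cip I (u (\<pi> \<circ> Transposition.transpose i j) n) (D \<pi> i j (u \<pi> m)) =
      of_real (l \<pi> m - l (\<pi> \<circ> Transposition.transpose i j) n) * cip I (u (\<pi> \<circ> Transposition.transpose i j) n) (u \<pi> m)"
    unfolding \<pi>'_def[symmetric] D_def cip_diff_right
    using sum_swap[OF ij, of "\<lambda>r. cip I ?W (X r ?U)" \<pi>] 1 cip_sum_X[OF m, of ?W \<pi>]
    unfolding \<pi>'_def[symmetric] by (simp add: algebra_simps)
  show "cip I (u \<pi> m) (D \<pi> i j (u (\<pi> \<circ> Transposition.transpose i j) n)) =
      of_real (l \<pi> m - l (\<pi> \<circ> Transposition.transpose i j) n) * cip I (u \<pi> m) (u (\<pi> \<circ> Transposition.transpose i j) n)"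
    unfolding \<pi>'_def[symmetric] D_def cip_diff_right
    using sum_swap[OF ij, of "\<lambda>r. cip I ?U (X r ?W)" \<pi>] 2 cip_sum_X[OF n, of ?U \<pi>']
    unfolding \<pi>'_def[symmetric] by (simp add: algebra_simps)
qed

text \<open>In operator notation, \<open>F = tr D exp (\<theta> Y)\<close> and \<open>G = tr D\<^sup>2 exp (\<theta> Y)\<close>.\<close>

definition F where "F \<theta> \<pi> i j = (\<Sum>m<d. exp (\<theta> * l \<pi> m) * Re (cip I (u \<pi> m) (D \<pi> i j (u \<pi> m))))"
definition G where "G \<theta> \<pi> i j = (\<Sum>m<d. exp (\<theta> * l \<pi> m) * sqn I (D \<pi> i j (u \<pi> m)))"

lemma D_swap: "D (\<pi> \<circ> Transposition.transpose i j) i j c = (\<lambda>a. (-1) * D \<pi> i j c a)"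
  by (auto simp: D_def fun_eq_iff)

lemma F_swap_bound:
  assumes ij: "i < k" "k \<le> j"
  shows "\<bar>F \<theta> \<pi> i j + F \<theta> (\<pi> \<circ> Transposition.transpose i j) i j\<bar>
     \<le> \<bar>\<theta>\<bar> / 2 * (G \<theta> \<pi> i j + G \<theta> (\<pi> \<circ> Transposition.transpose i j) i j)"
proof -
  define \<pi>' where "\<pi>' = \<pi> \<circ> Transposition.transpose i j"
  have F': "F \<theta> \<pi>' i j = - (\<Sum>n<d. exp (\<theta> * l \<pi>' n) * Re (cip I (u \<pi>' n) (D \<pi> i j (u \<pi>' n))))"
    unfolding F_def \<pi>'_def D_swap cip_scale_right by (simp add: sum_negf)
  have G': "G \<theta> \<pi>' i j = (\<Sum>n<d. exp (\<theta> * l \<pi>' n) * sqn I (D \<pi> i j (u \<pi>' n)))"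
    unfolding G_def \<pi>'_def D_swap sqn_scale by simp
  show ?thesis
    using trace_exp_mean_value[OF u_orth u_orth D_between[OF ij], of \<theta> \<pi>]
    unfolding \<pi>'_def[symmetric] F' G' F_def[of \<theta> \<pi>] G_def[of \<theta> \<pi>] by simp
qed

lemma swap_in_P: "\<pi> \<in> P \<Longrightarrow> i < s \<Longrightarrow> j < s \<Longrightarrow> \<pi> \<circ> Transposition.transpose i j \<in> P"
  unfolding P_def using permutes_compose[OF permutes_swap_id[of i "{..<s}" j], of \<pi>] by simp

lemma sum_P_swap: "i < s \<Longrightarrow> j < s \<Longrightarrow> (\<Sum>\<pi>\<in>P. f (\<pi> \<circ> Transposition.transpose i j)) = (\<Sum>\<pi>\<in>P. f \<pi>)"
  by (rule sum.reindex_bij_witness[of _ "\<lambda>\<pi>. \<pi> \<circ> Transposition.transpose i j" "\<lambda>\<pi>. \<pi> \<circ> Transposition.transpose i j"])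
    (auto simp: swap_in_P comp_assoc)

text \<open>The exchange is an involution on the permutations that negates \<open>D\<close>. Averaging over a pair of exchanged
permutations therefore replaces \<open>F\<close> by half of the difference of two traces, to which the mean value bound
applies.\<close>

lemma sum_F_bound:
  assumes ij: "i < k" "k \<le> j" "j < s"
  shows "\<bar>\<Sum>\<pi>\<in>P. F \<theta> \<pi> i j\<bar> \<le> \<bar>\<theta>\<bar> / 2 * (\<Sum>\<pi>\<in>P. G \<theta> \<pi> i j)"
proof -
  have i: "i < s" using ij by simp
  have "2 * \<bar>\<Sum>\<pi>\<in>P. F \<theta> \<pi> i j\<bar> = \<bar>\<Sum>\<pi>\<in>P. F \<theta> \<pi> i j + F \<theta> (\<pi> \<circ> Transposition.transpose i j) i j\<bar>"
    using sum_P_swap[OF i ij(3), of "\<lambda>\<pi>. F \<theta> \<pi> i j"] by (simp add: sum.distrib)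
  also have "\<dots> \<le> (\<Sum>\<pi>\<in>P. \<bar>\<theta>\<bar> / 2 * (G \<theta> \<pi> i j + G \<theta> (\<pi> \<circ> Transposition.transpose i j) i j))"
    by (rule order.trans[OF sum_abs]) (intro sum_mono F_swap_bound ij)
  also have "\<dots> = 2 * (\<bar>\<theta>\<bar> / 2 * (\<Sum>\<pi>\<in>P. G \<theta> \<pi> i j))"
    using sum_P_swap[OF i ij(3), of "\<lambda>\<pi>. G \<theta> \<pi> i j"] by (simp only: sum.distrib sum_distrib_left[symmetric]) simp
  finally show ?thesis by simp
qed

text \<open>The trace moment generating function \<open>\<Sum>\<^sub>\<pi> tr exp (\<theta> Y \<pi>)\<close> and its derivative, without normalization by the
number of permutations.\<close>

definition \<phi> where "\<phi> \<theta> = (\<Sum>\<pi>\<in>P. \<Sum>m<d. exp (\<theta> * l \<pi> m))"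
definition \<phi>' where "\<phi>' \<theta> = (\<Sum>\<pi>\<in>P. \<Sum>m<d. l \<pi> m * exp (\<theta> * l \<pi> m))"

text \<open>The sum of \<open>D\<close> over all exchanges is \<open>s\<close> times \<open>Y\<close>: an exchange pulls the sample towards its mean. This is the
linear regression property of the exchangeable pair.\<close>

lemma sum_F_eq:
  assumes pi: "\<pi> \<in> P"
  shows "(\<Sum>i<k. \<Sum>j\<in>{k..<s}. F \<theta> \<pi> i j) = s * (\<Sum>m<d. l \<pi> m * exp (\<theta> * l \<pi> m))"
proof -
  have c: "(\<Sum>i<k. \<Sum>j\<in>{k..<s}. Re (cip I (u \<pi> m) (D \<pi> i j (u \<pi> m)))) = s * l \<pi> m" if m: "m < d" for m
  proof -
    define W where "W i = (cmod (cip I (x (\<pi> i)) (u \<pi> m)))\<^sup>2 / k" for i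
    have W: "(\<Sum>i<k. W i) = 1 + l \<pi> m" "(\<Sum>j\<in>{k..<s}. W j) = s / k - 1 - l \<pi> m"
      using weight_head[OF m, of \<pi>] weight_tail[OF pi m] by (simp_all add: W_def)
    have "cip I (u \<pi> m) (X (\<pi> i) (u \<pi> m)) = of_real (W i)" for i
      unfolding W_def of_real_divide of_real_cmod_sq by (simp add: cip_X cip_cnj)
    hence "(\<Sum>i<k. \<Sum>j\<in>{k..<s}. Re (cip I (u \<pi> m) (D \<pi> i j (u \<pi> m)))) = (\<Sum>i<k. \<Sum>j\<in>{k..<s}. W i - W j)"
      unfolding D_def cip_diff_right by simp
    also have "\<dots> = (s - k) * (\<Sum>i<k. W i) - k * (\<Sum>j\<in>{k..<s}. W j)"
      using k by (simp add: sum_subtractf sum_distrib_left of_nat_diff)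
    also have "\<dots> = s * l \<pi> m" unfolding W using k by (simp add: field_simps)
    finally show ?thesis .
  qed
  have "(\<Sum>i<k. \<Sum>j\<in>{k..<s}. F \<theta> \<pi> i j)
    = (\<Sum>i<k. \<Sum>m<d. \<Sum>j\<in>{k..<s}. exp (\<theta> * l \<pi> m) * Re (cip I (u \<pi> m) (D \<pi> i j (u \<pi> m))))"
    unfolding F_def by (intro sum.cong refl sum.swap)
  also have "\<dots> = (\<Sum>m<d. \<Sum>i<k. \<Sum>j\<in>{k..<s}. exp (\<theta> * l \<pi> m) * Re (cip I (u \<pi> m) (D \<pi> i j (u \<pi> m))))"
    by (rule sum.swap)
  also have "\<dots> = (\<Sum>m<d. exp (\<theta> * l \<pi> m) * (s * l \<pi> m))"
    by (intro sum.cong refl) (simp add: c flip: sum_distrib_left)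
  finally show ?thesis by (simp add: sum_distrib_left mult_ac)
qed

lemma sum_G_le:
  assumes pi: "\<pi> \<in> P"
  shows "(\<Sum>i<k. \<Sum>j\<in>{k..<s}. G \<theta> \<pi> i j) \<le> M / k * s * (\<Sum>m<d. (2 + l \<pi> m) * exp (\<theta> * l \<pi> m))"
proof -
  have "(\<Sum>i<k. \<Sum>j\<in>{k..<s}. G \<theta> \<pi> i j)
    = (\<Sum>i<k. \<Sum>m<d. \<Sum>j\<in>{k..<s}. exp (\<theta> * l \<pi> m) * sqn I (D \<pi> i j (u \<pi> m)))"
    unfolding G_def by (intro sum.cong refl sum.swap)
  also have "\<dots> = (\<Sum>m<d. \<Sum>i<k. \<Sum>j\<in>{k..<s}. exp (\<theta> * l \<pi> m) * sqn I (D \<pi> i j (u \<pi> m)))"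
    by (rule sum.swap)
  also have "\<dots> = (\<Sum>m<d. exp (\<theta> * l \<pi> m) * (\<Sum>i<k. \<Sum>j\<in>{k..<s}. sqn I (D \<pi> i j (u \<pi> m))))"
    by (simp add: sum_distrib_left)
  also have "\<dots> \<le> (\<Sum>m<d. exp (\<theta> * l \<pi> m) * (M / k * s * (2 + l \<pi> m)))"
    by (intro sum_mono mult_left_mono sum_sqn_D pi) auto
  finally show ?thesis by (simp add: sum_distrib_left mult_ac)
qed

text \<open>The derivative \<open>\<phi>' = \<Sum>\<^sub>\<pi> tr Y exp (\<theta> Y)\<close> is \<open>1 / s\<close> times the sum of all \<open>F\<close> by
\<open>sum_F_eq\<close>. The bound by the \<open>G\<close> and \<open>sum_G_le\<close> gives a differential inequality for \<open>\<phi>\<close> alone.\<close>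

lemma stein_bound: "\<bar>\<phi>' \<theta>\<bar> \<le> \<bar>\<theta>\<bar> / 2 * (M / k) * (2 * \<phi> \<theta> + \<phi>' \<theta>)"
proof -
  have s: "real s > 0" using k by simp
  have swp: "(\<Sum>\<pi>\<in>P. \<Sum>i<k. \<Sum>j\<in>{k..<s}. f \<pi> i j) = (\<Sum>i<k. \<Sum>j\<in>{k..<s}. \<Sum>\<pi>\<in>P. f \<pi> i j)" for f :: "(nat \<Rightarrow> nat) \<Rightarrow> nat \<Rightarrow> nat \<Rightarrow> real"
    by (subst sum.swap) (intro sum.cong refl sum.swap)
  have "s * \<phi>' \<theta> = (\<Sum>\<pi>\<in>P. \<Sum>i<k. \<Sum>j\<in>{k..<s}. F \<theta> \<pi> i j)"
    by (simp add: \<phi>'_def sum_F_eq flip: sum_distrib_left)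
  also have "\<dots> = (\<Sum>i<k. \<Sum>j\<in>{k..<s}. \<Sum>\<pi>\<in>P. F \<theta> \<pi> i j)" by (rule swp)
  finally have "s * \<bar>\<phi>' \<theta>\<bar> = \<bar>\<Sum>i<k. \<Sum>j\<in>{k..<s}. \<Sum>\<pi>\<in>P. F \<theta> \<pi> i j\<bar>"
    using s by (metis abs_mult abs_of_nat)
  also have "\<dots> \<le> (\<Sum>i<k. \<Sum>j\<in>{k..<s}. \<bar>\<Sum>\<pi>\<in>P. F \<theta> \<pi> i j\<bar>)"
    by (rule order.trans[OF sum_abs]) (intro sum_mono sum_abs)
  also have "\<dots> \<le> (\<Sum>i<k. \<Sum>j\<in>{k..<s}. \<bar>\<theta>\<bar> / 2 * (\<Sum>\<pi>\<in>P. G \<theta> \<pi> i j))"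
    by (intro sum_mono sum_F_bound) auto
  also have "\<dots> = \<bar>\<theta>\<bar> / 2 * (\<Sum>\<pi>\<in>P. \<Sum>i<k. \<Sum>j\<in>{k..<s}. G \<theta> \<pi> i j)"
    by (simp add: swp sum_distrib_left)
  also have "\<dots> \<le> \<bar>\<theta>\<bar> / 2 * (\<Sum>\<pi>\<in>P. M / k * s * (\<Sum>m<d. (2 + l \<pi> m) * exp (\<theta> * l \<pi> m)))"
    by (intro mult_left_mono sum_mono sum_G_le) auto
  also have "\<dots> = s * (\<bar>\<theta>\<bar> / 2 * (M / k) * (2 * \<phi> \<theta> + \<phi>' \<theta>))"
  proof -
    have "(\<Sum>m<d. (2 + l \<pi> m) * exp (\<theta> * l \<pi> m)) = 2 * (\<Sum>m<d. exp (\<theta> * l \<pi> m)) + (\<Sum>m<d. l \<pi> m * exp (\<theta> * l \<pi> m))" for \<pi>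
      by (simp add: distrib_right sum.distrib sum_distrib_left)
    hence "(\<Sum>\<pi>\<in>P. M / k * s * (\<Sum>m<d. (2 + l \<pi> m) * exp (\<theta> * l \<pi> m))) = M / k * s * (2 * \<phi> \<theta> + \<phi>' \<theta>)"
      unfolding \<phi>_def \<phi>'_def by (simp only: sum_distrib_left[symmetric] sum.distrib)
    thus ?thesis by (simp only: mult_ac)
  qed
  finally show ?thesis using s by (simp only: mult_le_cancel_left_pos)
qed

lemma phi_deriv: "(\<phi> has_real_derivative \<phi>' \<theta>) (at \<theta>)"
  unfolding \<phi>_def[abs_def] \<phi>'_def
  by (auto intro!: derivative_eq_intros sum.cong simp: mult_ac)

lemma phi_nonneg: "0 \<le> \<phi> \<theta>" by (simp add: \<phi>_def sum_nonneg)

lemma phi_0: "\<phi> 0 = card P * d" by (simp add: \<phi>_def)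

text \<open>For \<open>\<theta> \<ge> 0\<close> the differential inequality reads \<open>\<phi>' (1 - \<theta> R / 2) \<le> \<theta> R \<phi>\<close>, and the exponential is the solution of the
corresponding equation. Dividing by it gives a nonincreasing function.\<close>

lemma phi_upper:
  fixes R defines "R \<equiv> M / k"
  assumes \<theta>: "0 \<le> \<theta>" "\<theta> * R < 2"
  shows "\<phi> \<theta> \<le> card P * d * exp (- 2 * \<theta> - 4 / R * ln (1 - \<theta> * R / 2))"
proof -
  have R: "R > 0" using M k by (simp add: R_def)
  define h where "h t = \<phi> t * exp (2 * t + 4 / R * ln (1 - t * R / 2))" for t
  have "h \<theta> \<le> h 0"
  proof (rule DERIV_nonpos_imp_nonincreasing[OF \<theta>(1)])
    fix t assume t: "0 \<le> t" "t \<le> \<theta>"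
    define v where "v = 1 - t * R / 2"
    have "t * R \<le> \<theta> * R" using t R by simp
    hence "t * R < 2" using \<theta>(2) by linarith
    moreover have "0 \<le> t * R" using t R by simp
    ultimately have v: "v > 0" "v \<le> 1" by (auto simp: v_def)
    let ?E = "exp (2 * t + 4 / R * ln (1 - t * R / 2))"
    have d: "(h has_real_derivative ?E * (\<phi>' t + \<phi> t * (2 - 2 / v))) (at t)"
    proof -
      have l: "((\<lambda>t. ln (1 - t * R / 2)) has_real_derivative - (R / 2) / v) (at t)"
        using v by (auto intro!: derivative_eq_intros simp: v_def)
      note ex = DERIV_fun_exp[OF DERIV_add[OF DERIV_cmult[OF DERIV_ident, of 2] DERIV_cmult[OF l, of "4 / R"]]]
      have r: "4 / R * (- (R / 2) / v) = - (2 / v)" using R by simp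
      show ?thesis unfolding h_def[abs_def]
        by (rule DERIV_cong[OF DERIV_mult[OF phi_deriv ex]]) (simp only: r, simp add: algebra_simps)
    qed
    have "\<phi>' t \<le> t / 2 * R * (2 * \<phi> t + \<phi>' t)"
      using stein_bound[of t] t unfolding R_def by (simp add: abs_le_iff)
    hence "\<phi>' t * v \<le> t * R * \<phi> t" by (simp add: v_def algebra_simps)
    hence "\<phi>' t * v + \<phi> t * (2 * v - 2) \<le> 0" by (simp add: v_def algebra_simps)
    hence "\<phi>' t + \<phi> t * (2 - 2 / v) \<le> 0"
      using v by (simp add: field_simps)
    thus "\<exists>y. (h has_real_derivative y) (at t) \<and> y \<le> 0"
      using d by (intro exI[of _ "?E * (\<phi>' t + \<phi> t * (2 - 2 / v))"] conjI mult_nonneg_nonpos) auto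
  qed
  also have "h 0 = card P * d" by (simp add: h_def phi_0)
  finally have "\<phi> \<theta> * exp (2 * \<theta> + 4 / R * ln (1 - \<theta> * R / 2)) \<le> card P * d" by (simp add: h_def)
  thus ?thesis by (simp add: exp_diff exp_minus exp_add field_simps)
qed

text \<open>At a negative argument, the term \<open>\<phi>'\<close> on the right-hand side of \<open>stein_bound\<close> is dropped if it is nonpositive, and the
desired bound on \<open>- \<phi>'\<close> is trivial otherwise. What remains integrates to a Gaussian bound.\<close>

lemma phi_lower:
  assumes \<theta>: "0 \<le> \<theta>"
  shows "\<phi> (- \<theta>) \<le> card P * d * exp (\<theta>\<^sup>2 * (M / k) / 2)"
proof -
  define R where "R = M / k"
  have R: "R > 0" using M k by (simp add: R_def)
  define h where "h t = \<phi> (- t) * exp (- t\<^sup>2 * R / 2)" for t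
  have "h \<theta> \<le> h 0"
  proof (rule DERIV_nonpos_imp_nonincreasing[OF \<theta>(1)])
    fix t assume t: "0 \<le> t" "t \<le> \<theta>"
    let ?E = "exp (- t\<^sup>2 * R / 2)"
    have pd: "((\<lambda>t. \<phi> (- t)) has_real_derivative \<phi>' (- t) * (- 1)) (at t)"
      by (rule DERIV_chain2[OF phi_deriv]) (auto intro!: derivative_eq_intros)
    have d: "(h has_real_derivative ?E * (- \<phi>' (- t) - t * R * \<phi> (- t))) (at t)"
    proof -
      have q: "((\<lambda>t. - t\<^sup>2 * R / 2) has_real_derivative - (t * R)) (at t)"
        by (auto intro!: derivative_eq_intros)
      show ?thesis unfolding h_def[abs_def]
        by (rule DERIV_cong[OF DERIV_mult[OF pd DERIV_fun_exp[OF q]]]) (simp add: algebra_simps)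
    qed
    have b: "- \<phi>' (- t) \<le> t / 2 * R * (2 * \<phi> (- t) + \<phi>' (- t))"
      using stein_bound[of "- t"] t unfolding R_def by (simp add: abs_le_iff)
    have "- \<phi>' (- t) \<le> t * R * \<phi> (- t)"
    proof (cases "\<phi>' (- t) \<le> 0")
      case True
      hence "t / 2 * R * \<phi>' (- t) \<le> 0" using t R by (simp add: mult_nonneg_nonpos)
      thus ?thesis using b by (simp add: algebra_simps)
    next
      case False
      have "0 \<le> t * R * \<phi> (- t)" using t R phi_nonneg[of "- t"] by simp
      thus ?thesis using False by simp
    qed
    thus "\<exists>y. (h has_real_derivative y) (at t) \<and> y \<le> 0"
      using d by (intro exI[of _ "?E * (- \<phi>' (- t) - t * R * \<phi> (- t))"] conjI mult_nonneg_nonpos) auto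
  qed
  also have "h 0 = card P * d" by (simp add: h_def phi_0)
  finally have "\<phi> (- \<theta>) * exp (- \<theta>\<^sup>2 * R / 2) \<le> card P * d" by (simp add: h_def)
  thus ?thesis by (simp add: exp_minus field_simps R_def)
qed

lemma finite_P: "finite P" unfolding P_def by (rule finite_permutations) simp

lemma markov_P:
  shows "card {\<pi>\<in>P. \<exists>m<d. e < \<theta> * l \<pi> m} * exp e \<le> \<phi> \<theta>"
proof -
  let ?B = "{\<pi>\<in>P. \<exists>m<d. e < \<theta> * l \<pi> m}"
  have "card ?B * exp e = (\<Sum>\<pi>\<in>?B. exp e)" by simp
  also have "\<dots> \<le> (\<Sum>\<pi>\<in>?B. \<Sum>m<d. exp (\<theta> * l \<pi> m))"
  proof (intro sum_mono)
    fix \<pi> assume "\<pi> \<in> ?B"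
    then obtain m where m: "m < d" "e < \<theta> * l \<pi> m" by auto
    have "exp e \<le> exp (\<theta> * l \<pi> m)" using m by simp
    also have "\<dots> \<le> (\<Sum>m<d. exp (\<theta> * l \<pi> m))" using m by (intro member_le_sum) auto
    finally show "exp e \<le> (\<Sum>m<d. exp (\<theta> * l \<pi> m))" .
  qed
  also have "\<dots> \<le> \<phi> \<theta>" unfolding \<phi>_def using finite_P by (intro sum_mono2) (auto intro: sum_nonneg)
  finally show ?thesis .
qed

text \<open>Diagonalization of the deviation: it remains to confine the eigenvalues to \<open>[- e, e]\<close>.\<close>

lemma quadratic_form: "(\<Sum>i<k. (cmod (cip I (x (\<pi> i)) c))\<^sup>2) / k - sqn I c
     = (\<Sum>m<d. l \<pi> m * (cmod (cip I (u \<pi> m) c))\<^sup>2)"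
proof -
  have "complex_of_real ((\<Sum>i<k. (cmod (cip I (x (\<pi> i)) c))\<^sup>2) / k) = (\<Sum>i<k. cip I c (X (\<pi> i) c))"
    unfolding of_real_divide of_real_sum of_real_cmod_sq by (simp add: cip_X cip_cnj sum_divide_distrib)
  also have "\<dots> = (\<Sum>i<k. \<Sum>m<d. cip I c (u \<pi> m) * cip I (u \<pi> m) (X (\<pi> i) c))"
    by (intro sum.cong refl cip_expand u_orth)
  also have "\<dots> = (\<Sum>m<d. cip I c (u \<pi> m) * (\<Sum>i<k. cip I (X (\<pi> i) (u \<pi> m)) c))"
    by (subst sum.swap) (simp add: sum_distrib_left cip_X_adj)
  also have "\<dots> = (\<Sum>m<d. of_real (1 + l \<pi> m) * of_real ((cmod (cip I (u \<pi> m) c))\<^sup>2))"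
    unfolding of_real_cmod_sq
    by (intro sum.cong refl) (simp add: cip_sum_X' cip_cnj mult_ac)
  finally have "complex_of_real ((\<Sum>i<k. (cmod (cip I (x (\<pi> i)) c))\<^sup>2) / k) =
      of_real (\<Sum>m<d. (1 + l \<pi> m) * (cmod (cip I (u \<pi> m) c))\<^sup>2)" by simp
  hence "(\<Sum>i<k. (cmod (cip I (x (\<pi> i)) c))\<^sup>2) / k = (\<Sum>m<d. (1 + l \<pi> m) * (cmod (cip I (u \<pi> m) c))\<^sup>2)"
    using of_real_eq_iff by blast
  thus ?thesis unfolding sqn_expand[OF u_orth[of \<pi>], of c] by (simp add: sum.distrib algebra_simps)
qed

lemma ln_cubic_bound:
  fixes y :: real
  assumes "0 \<le> y"
  shows "ln (1 + y) \<le> y - y\<^sup>2 / 2 + y ^ 3 / 3"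
proof -
  let ?f = "\<lambda>y :: real. y - y\<^sup>2 / 2 + y ^ 3 / 3 - ln (1 + y)"
  have "?f 0 \<le> ?f y"
  proof (rule DERIV_nonneg_imp_nondecreasing[OF assms])
    fix z :: real assume z: "0 \<le> z" "z \<le> y"
    have "(?f has_real_derivative 1 - z + z\<^sup>2 - 1 / (1 + z)) (at z)"
      using z by (auto intro!: derivative_eq_intros simp: field_simps)
    moreover have "1 - z + z\<^sup>2 - 1 / (1 + z) = z ^ 3 / (1 + z)"
      using z by (simp add: field_simps power2_eq_square power3_eq_cube)
    ultimately show "\<exists>D. (?f has_real_derivative D) (at z) \<and> 0 \<le> D" using z by auto
  qed
  thus ?thesis by simp
qed

text \<open>Markov's inequality with the exponent for which \<open>1 - \<theta> R / 2 = 1 / (1 + e / 2)\<close>. The exponent becomes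
\<open>(4 ln (1 + e / 2) - 2 e) / R\<close>, which \<open>ln_cubic_bound\<close> estimates.\<close>

lemma upper_tail:
  assumes e: "0 < e"
  shows "card {\<pi>\<in>P. \<exists>m<d. e < l \<pi> m} \<le> card P * d * exp (- (e\<^sup>2 / 2 - e ^ 3 / 6) * k / M)"
proof -
  define R where "R = M / k"
  have R: "R > 0" using M k by (simp add: R_def)
  define \<theta> where "\<theta> = 2 * e / (2 + e) / R"
  have tR: "\<theta> * R = 2 * e / (2 + e)" using R by (simp add: \<theta>_def)
  have \<theta>: "\<theta> > 0" "\<theta> * R < 2" using R e unfolding tR by (simp_all add: \<theta>_def pos_divide_less_eq)
  have v: "1 - \<theta> * R / 2 = 1 / (1 + e / 2)" unfolding tR using e by (simp add: field_simps)
  have B: "{\<pi>\<in>P. \<exists>m<d. e < l \<pi> m} = {\<pi>\<in>P. \<exists>m<d. \<theta> * e < \<theta> * l \<pi> m}"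
    using \<theta>(1) by simp
  have "card {\<pi>\<in>P. \<exists>m<d. e < l \<pi> m} * exp (\<theta> * e) \<le> \<phi> \<theta>"
    unfolding B by (rule markov_P)
  also have "\<phi> \<theta> \<le> card P * d * exp (- 2 * \<theta> - 4 / R * ln (1 / (1 + e / 2)))"
    using phi_upper[of \<theta>] \<theta> v unfolding R_def by simp
  finally have "card {\<pi>\<in>P. \<exists>m<d. e < l \<pi> m} \<le> card P * d * exp (- 2 * \<theta> - 4 / R * ln (1 / (1 + e / 2))) / exp (\<theta> * e)"
    by (simp add: pos_le_divide_eq)
  also have "\<dots> = card P * d * exp (- 2 * \<theta> - 4 / R * ln (1 / (1 + e / 2)) - \<theta> * e)"
    by (simp add: exp_diff)
  also have "- 2 * \<theta> - 4 / R * ln (1 / (1 + e / 2)) - \<theta> * e = (4 * ln (1 + e / 2) - 2 * e) / R"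
  proof -
    have "\<theta> * (2 + e) = 2 * e / R" using R e by (simp add: \<theta>_def)
    moreover have "ln (1 / (1 + e / 2)) = - ln (1 + e / 2)" using e by (simp add: ln_div)
    ultimately show ?thesis by (simp add: algebra_simps diff_divide_distrib)
  qed
  also have "card P * d * exp ((4 * ln (1 + e / 2) - 2 * e) / R) \<le> card P * d * exp (- (e\<^sup>2 / 2 - e ^ 3 / 6) / R)"
  proof -
    have "4 * ln (1 + e / 2) - 2 * e \<le> - (e\<^sup>2 / 2 - e ^ 3 / 6)"
      using ln_cubic_bound[of "e / 2"] e by (simp add: power_divide)
    hence "(4 * ln (1 + e / 2) - 2 * e) / R \<le> - (e\<^sup>2 / 2 - e ^ 3 / 6) / R"
      using R by (intro divide_right_mono) auto
    thus ?thesis by (intro mult_left_mono) auto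
  qed
  finally show ?thesis by (simp add: R_def)
qed

lemma lower_tail:
  assumes e: "0 < e"
  shows "card {\<pi>\<in>P. \<exists>m<d. l \<pi> m < - e} \<le> card P * d * exp (- (e\<^sup>2 / 2 - e ^ 3 / 6) * k / M)"
proof -
  define R where "R = M / k"
  have R: "R > 0" using M k by (simp add: R_def)
  define \<theta> where "\<theta> = e / R"
  have \<theta>: "\<theta> > 0" using R e by (auto simp: \<theta>_def)
  have "(l \<pi> m < - e) = (\<theta> * e < (- \<theta>) * l \<pi> m)" for \<pi> m
    using \<theta> mult_less_cancel_left_pos[of \<theta> e "- l \<pi> m"] by auto
  hence B: "{\<pi>\<in>P. \<exists>m<d. l \<pi> m < - e} = {\<pi>\<in>P. \<exists>m<d. \<theta> * e < (- \<theta>) * l \<pi> m}"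
    by simp
  have "card {\<pi>\<in>P. \<exists>m<d. l \<pi> m < - e} * exp (\<theta> * e) \<le> \<phi> (- \<theta>)"
    unfolding B by (rule markov_P)
  also have "\<dots> \<le> card P * d * exp (\<theta>\<^sup>2 * R / 2)"
    using phi_lower[of \<theta>] \<theta> unfolding R_def by simp
  finally have "card {\<pi>\<in>P. \<exists>m<d. l \<pi> m < - e} \<le> card P * d * exp (\<theta>\<^sup>2 * R / 2) / exp (\<theta> * e)"
    by (simp add: pos_le_divide_eq)
  also have "\<dots> = card P * d * exp (\<theta>\<^sup>2 * R / 2 - \<theta> * e)"
    by (simp add: exp_diff)
  also have "\<theta>\<^sup>2 * R / 2 - \<theta> * e = - (e\<^sup>2 / 2) / R"
    using R by (simp add: \<theta>_def power2_eq_square field_simps)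
  also have "card P * d * exp (- (e\<^sup>2 / 2) / R) \<le> card P * d * exp (- (e\<^sup>2 / 2 - e ^ 3 / 6) / R)"
  proof -
    have "- (e\<^sup>2 / 2) / R \<le> - (e\<^sup>2 / 2 - e ^ 3 / 6) / R"
      using e R by (intro divide_right_mono) auto
    thus ?thesis by (intro mult_left_mono) auto
  qed
  finally show ?thesis by (simp add: R_def)
qed

theorem sampling_embedding:
  assumes e: "0 < e"
  shows "card {\<pi>. \<pi> permutes {..<s} \<and>
       \<not> (\<forall>c. \<bar>(\<Sum>i<k. (cmod (cip {..<d} (x (\<pi> i)) c))\<^sup>2) / k - sqn {..<d} c\<bar> \<le> e * sqn {..<d} c)}
     \<le> 2 * d * exp (- (e\<^sup>2 / 2 - e ^ 3 / 6) * k / M) * card {\<pi>. \<pi> permutes {..<s}}"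
proof -
  have good: "\<bar>(\<Sum>i<k. (cmod (cip I (x (\<pi> i)) c))\<^sup>2) / k - sqn I c\<bar> \<le> e * sqn I c"
    if "\<not> (\<exists>m<d. e < l \<pi> m)" "\<not> (\<exists>m<d. l \<pi> m < - e)" for \<pi> c
  proof -
    have "\<bar>\<Sum>m<d. l \<pi> m * (cmod (cip I (u \<pi> m) c))\<^sup>2\<bar> \<le> (\<Sum>m<d. \<bar>l \<pi> m * (cmod (cip I (u \<pi> m) c))\<^sup>2\<bar>)"
      by (rule sum_abs)
    also have "\<dots> \<le> (\<Sum>m<d. e * (cmod (cip I (u \<pi> m) c))\<^sup>2)"
    proof (intro sum_mono)
      fix m assume "m \<in> I"
      hence "\<not> e < l \<pi> m" "\<not> l \<pi> m < - e" using that by auto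
      hence "\<bar>l \<pi> m\<bar> \<le> e" by linarith
      thus "\<bar>l \<pi> m * (cmod (cip I (u \<pi> m) c))\<^sup>2\<bar> \<le> e * (cmod (cip I (u \<pi> m) c))\<^sup>2"
        by (simp add: abs_mult mult_right_mono)
    qed
    also have "\<dots> = e * sqn I c" by (simp add: sqn_expand[OF u_orth[of \<pi>]] sum_distrib_left)
    finally show ?thesis by (simp add: quadratic_form)
  qed
  have "card {\<pi>. \<pi> permutes {..<s} \<and>
       \<not> (\<forall>c. \<bar>(\<Sum>i<k. (cmod (cip I (x (\<pi> i)) c))\<^sup>2) / k - sqn I c\<bar> \<le> e * sqn I c)}
    \<le> card ({\<pi>\<in>P. \<exists>m<d. e < l \<pi> m} \<union> {\<pi>\<in>P. \<exists>m<d. l \<pi> m < - e})"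
  proof (rule card_mono)
    show "finite ({\<pi>\<in>P. \<exists>m<d. e < l \<pi> m} \<union> {\<pi>\<in>P. \<exists>m<d. l \<pi> m < - e})"
      using finite_P by simp
  qed (use good in \<open>unfold P_def, blast\<close>)
  also have "\<dots> \<le> card {\<pi>\<in>P. \<exists>m<d. e < l \<pi> m} + card {\<pi>\<in>P. \<exists>m<d. l \<pi> m < - e}"
    by (rule card_Un_le)
  finally have "real (card {\<pi>. \<pi> permutes {..<s} \<and>
       \<not> (\<forall>c. \<bar>(\<Sum>i<k. (cmod (cip I (x (\<pi> i)) c))\<^sup>2) / k - sqn I c\<bar> \<le> e * sqn I c)})
    \<le> card {\<pi>\<in>P. \<exists>m<d. e < l \<pi> m} + real (card {\<pi>\<in>P. \<exists>m<d. l \<pi> m < - e})" by linarith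
  also have "\<dots> \<le> card P * d * exp (- (e\<^sup>2 / 2 - e ^ 3 / 6) * k / M) + card P * d * exp (- (e\<^sup>2 / 2 - e ^ 3 / 6) * k / M)"
    by (intro add_mono upper_tail lower_tail e)
  finally show ?thesis by (simp add: P_def mult_ac)
qed

end

section \<open>Random signs and the randomized Hadamard transform\<close>

text \<open>The sign vectors are \<open>1\<close> outside of the index set, in agreement with the default of the product
distribution.\<close>

definition signs :: "nat \<Rightarrow> (nat \<Rightarrow> real) set" where
  "signs s = PiE_dflt {..<s} 1 (\<lambda>_. {-1, 1})"

lemma finite_signs: "finite (signs s)"
  unfolding signs_def by (rule finite_PiE_dflt) auto

lemma signs_nonempty: "signs s \<noteq> {}"
  unfolding signs_def by (auto simp: PiE_dflt_empty_iff)

lemma signs_sq: "\<sigma> \<in> signs s \<Longrightarrow> i < s \<Longrightarrow> \<sigma> i * \<sigma> i = 1"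
  by (force simp: signs_def PiE_dflt_def)

lemma flip_in_signs: "\<sigma> \<in> signs s \<Longrightarrow> i < s \<Longrightarrow> \<sigma>(i := - \<sigma> i) \<in> signs s"
  by (force simp: signs_def PiE_dflt_def)

lemma sum_signs_flip:
  "i < s \<Longrightarrow> (\<Sum>\<sigma>\<in>signs s. f (\<sigma>(i := - \<sigma> i))) = (\<Sum>\<sigma>\<in>signs s. f \<sigma>)"
  by (rule sum.reindex_bij_witness[of _ "\<lambda>\<sigma>. \<sigma>(i := - \<sigma> i)" "\<lambda>\<sigma>. \<sigma>(i := - \<sigma> i)"])
    (auto simp: flip_in_signs)

text \<open>A random combination of the vectors \<open>w j\<close> with independent signs has expected squared norm \<open>d\<close>. The
Parseval identity bounds its fluctuations by those of a Gaussian vector in dimension \<open>d\<close>, in the form of the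
moment generating function of a chi-square variable.\<close>

locale parseval_frame =
  fixes s d :: nat and w :: "nat \<Rightarrow> nat \<Rightarrow> complex"
  assumes parseval: "\<And>a b. a < d \<Longrightarrow> b < d \<Longrightarrow> (\<Sum>j<s. w j a * cnj (w j b)) = of_bool (a = b)"
begin

definition y :: "(nat \<Rightarrow> real) \<Rightarrow> nat \<Rightarrow> complex" where
  "y \<sigma> a = (\<Sum>j<s. of_real (\<sigma> j) * w j a)"

text \<open>The squared norm \<open>Q\<close> is a sum of contributions \<open>\<sigma>\<^sub>i c\<^sub>i\<close> of the single signs. Each contains the
deterministic part \<open>\<parallel>w\<^sub>i\<parallel>\<^sup>2\<close>, and the remainder \<open>b\<^sub>i\<close> is odd in the sign \<open>\<sigma>\<^sub>i\<close>.\<close>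

definition Q where "Q \<sigma> = sqn {..<d} (y \<sigma>)"

definition c where "c i \<sigma> = Re (cip {..<d} (w i) (y \<sigma>))"

definition b where "b i \<sigma> = \<sigma> i * c i \<sigma> - sqn {..<d} (w i)"

lemma y_flip: "i < s \<Longrightarrow> y (\<sigma>(i := - \<sigma> i)) = (\<lambda>a. y \<sigma> a - of_real (2 * \<sigma> i) * w i a)"
proof
  fix a assume i: "i < s"
  have "y (\<sigma>(i := - \<sigma> i)) a = of_real (- \<sigma> i) * w i a + (\<Sum>j\<in>{..<s}-{i}. of_real (\<sigma> j) * w j a)"
    unfolding y_def using i by (subst sum.remove[of _ i]) auto
  moreover have "y \<sigma> a = of_real (\<sigma> i) * w i a + (\<Sum>j\<in>{..<s}-{i}. of_real (\<sigma> j) * w j a)"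
    unfolding y_def using i by (subst sum.remove[of _ i]) auto
  ultimately show "y (\<sigma>(i := - \<sigma> i)) a = y \<sigma> a - of_real (2 * \<sigma> i) * w i a"
    by (simp add: algebra_simps)
qed

lemma Q_flip: 
  assumes "\<sigma> \<in> signs s" "i < s"
  shows "Q (\<sigma>(i := - \<sigma> i)) = Q \<sigma> - 4 * b i \<sigma>"
proof -
  have "Re (cip {..<d} (y \<sigma>) (\<lambda>a. of_real (2 * \<sigma> i) * w i a)) = 2 * \<sigma> i * c i \<sigma>"
    unfolding cip_scale_right by (simp add: c_def Re_cip_commute[of _ "y \<sigma>" "w i"])
  moreover have "(2 * \<sigma> i)\<^sup>2 = 4" using signs_sq[OF assms] by (simp add: power2_eq_square)
  ultimately show ?thesis
    unfolding Q_def y_flip[OF assms(2)] sqn_diff sqn_scale b_def by (simp add: power_mult_distrib)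
qed

lemma b_flip:
  assumes "\<sigma> \<in> signs s" "i < s"
  shows "b i (\<sigma>(i := - \<sigma> i)) = - b i \<sigma>"
  using signs_sq[OF assms]
  unfolding b_def c_def y_flip[OF assms(2)] cip_diff_right cip_scale_right
  by (simp add: sqn_eq_Re_cip algebra_simps)

lemma Q_eq_sum: "Q \<sigma> = (\<Sum>i<s. \<sigma> i * c i \<sigma>)"
proof -
  have "cip {..<d} (y \<sigma>) (y \<sigma>) = cip {..<d} (\<lambda>a. \<Sum>j<s. of_real (\<sigma> j) * w j a) (y \<sigma>)"
    unfolding cip_def by (simp add: y_def)
  also have "\<dots> = (\<Sum>i<s. of_real (\<sigma> i) * cip {..<d} (w i) (y \<sigma>))"
    unfolding cip_sum_left cip_scale_left by simp
  finally have "Re (cip {..<d} (y \<sigma>) (y \<sigma>)) = Re (\<Sum>i<s. of_real (\<sigma> i) * cip {..<d} (w i) (y \<sigma>))" by simp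
  thus ?thesis by (simp add: Q_def sqn_eq_Re_cip c_def)
qed

lemma parseval_sqn: "(\<Sum>i<s. (cmod (cip {..<d} (w i) z))\<^sup>2) = sqn {..<d} z"
proof -
  have "complex_of_real (\<Sum>i<s. (cmod (cip {..<d} (w i) z))\<^sup>2) = (\<Sum>i<s. cip {..<d} z (w i) * cip {..<d} (w i) z)"
    unfolding of_real_sum of_real_cmod_sq by (simp add: cip_cnj)
  also have "\<dots> = (\<Sum>i<s. \<Sum>a<d. \<Sum>b<d. cnj (z a) * w i a * (cnj (w i b) * z b))"
    unfolding cip_def by (simp add: sum_product)
  also have "\<dots> = (\<Sum>a<d. \<Sum>i<s. \<Sum>b<d. cnj (z a) * w i a * (cnj (w i b) * z b))"
    by (rule sum.swap)
  also have "\<dots> = (\<Sum>a<d. \<Sum>b<d. \<Sum>i<s. cnj (z a) * w i a * (cnj (w i b) * z b))"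
    by (intro sum.cong refl sum.swap)
  also have "\<dots> = (\<Sum>a<d. \<Sum>b<d. cnj (z a) * z b * (\<Sum>i<s. w i a * cnj (w i b)))"
    by (simp add: sum_distrib_left mult_ac)
  also have "\<dots> = (\<Sum>a<d. \<Sum>b<d. if a = b then cnj (z a) * z b else 0)"
    by (intro sum.cong refl) (simp add: parseval)
  also have "\<dots> = complex_of_real (sqn {..<d} z)" unfolding sqn_cip by (simp add: cip_def)
  finally show ?thesis using of_real_eq_iff by blast
qed

lemma sum_c_sq_le: "(\<Sum>i<s. (c i \<sigma>)\<^sup>2) \<le> Q \<sigma>"
proof -
  have "(c i \<sigma>)\<^sup>2 \<le> (cmod (cip {..<d} (w i) (y \<sigma>)))\<^sup>2" for i
    unfolding c_def by (rule power2_le_iff_abs_le[THEN iffD2]) (auto simp: abs_Re_le_cmod)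
  hence "(\<Sum>i<s. (c i \<sigma>)\<^sup>2) \<le> (\<Sum>i<s. (cmod (cip {..<d} (w i) (y \<sigma>)))\<^sup>2)" by (intro sum_mono)
  thus ?thesis by (simp add: parseval_sqn Q_def)
qed

lemma sum_sqn_w: "(\<Sum>i<s. sqn {..<d} (w i)) = d"
proof -
  have "complex_of_real (\<Sum>i<s. sqn {..<d} (w i)) = (\<Sum>i<s. \<Sum>a<d. w i a * cnj (w i a))"
    unfolding of_real_sum sqn_cip cip_def by (simp add: mult.commute)
  also have "\<dots> = (\<Sum>a<d. \<Sum>i<s. w i a * cnj (w i a))" by (rule sum.swap)
  also have "\<dots> = (\<Sum>a<d. 1)" by (intro sum.cong refl) (simp add: parseval)
  finally have "complex_of_real (\<Sum>i<s. sqn {..<d} (w i)) = of_real (real d)" by simp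
  thus ?thesis using of_real_eq_iff by blast
qed

text \<open>Flipping the sign \<open>i\<close> negates \<open>b\<^sub>i\<close> and lowers \<open>Q\<close> by \<open>4 b\<^sub>i\<close>. Averaging over the two values of the sign
turns the sum into \<open>b\<^sub>i\<close> times a difference of exponentials of the same sign, which is nonnegative and
controlled by \<open>exp_mean_value_bound\<close>.\<close>

lemma b_exp_bounds:
  assumes i: "i < s" and \<theta>: "0 \<le> \<theta>"
  shows "0 \<le> (\<Sum>\<sigma>\<in>signs s. b i \<sigma> * exp (\<theta> * Q \<sigma>))"
    and "(\<Sum>\<sigma>\<in>signs s. b i \<sigma> * exp (\<theta> * Q \<sigma>)) \<le> 2 * \<theta> * (\<Sum>\<sigma>\<in>signs s. (b i \<sigma>)\<^sup>2 * exp (\<theta> * Q \<sigma>))"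
proof -
  let ?S = "signs s"
  let ?g = "\<lambda>\<sigma>. b i \<sigma> * (exp (\<theta> * Q \<sigma>) - exp (\<theta> * (Q \<sigma> - 4 * b i \<sigma>)))"
  have "(\<Sum>\<sigma>\<in>?S. b i \<sigma> * exp (\<theta> * Q \<sigma>)) = (\<Sum>\<sigma>\<in>?S. - b i \<sigma> * exp (\<theta> * (Q \<sigma> - 4 * b i \<sigma>)))"
    unfolding sum_signs_flip[OF i, of "\<lambda>\<sigma>. b i \<sigma> * exp (\<theta> * Q \<sigma>)", symmetric]
    by (intro sum.cong refl) (simp only: b_flip[OF _ i] Q_flip[OF _ i])
  hence two: "2 * (\<Sum>\<sigma>\<in>?S. b i \<sigma> * exp (\<theta> * Q \<sigma>)) = (\<Sum>\<sigma>\<in>?S. ?g \<sigma>)"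
    by (simp add: right_diff_distrib sum_subtractf sum_negf)
  have "0 \<le> ?g \<sigma>" for \<sigma>
  proof (cases "b i \<sigma> \<ge> 0")
    case True thus ?thesis using \<theta> by (intro mult_nonneg_nonneg) (auto intro!: mult_left_mono)
  next
    case False thus ?thesis using \<theta> by (intro mult_nonpos_nonpos) (auto intro!: mult_left_mono)
  qed
  hence "0 \<le> (\<Sum>\<sigma>\<in>?S. ?g \<sigma>)" by (intro sum_nonneg)
  thus "0 \<le> (\<Sum>\<sigma>\<in>?S. b i \<sigma> * exp (\<theta> * Q \<sigma>))" using two by linarith
  have flip2: "(\<Sum>\<sigma>\<in>?S. (b i \<sigma>)\<^sup>2 * exp (\<theta> * (Q \<sigma> - 4 * b i \<sigma>))) = (\<Sum>\<sigma>\<in>?S. (b i \<sigma>)\<^sup>2 * exp (\<theta> * Q \<sigma>))"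
    unfolding sum_signs_flip[OF i, of "\<lambda>\<sigma>. (b i \<sigma>)\<^sup>2 * exp (\<theta> * Q \<sigma>)", symmetric]
    by (intro sum.cong refl) (simp only: b_flip[OF _ i] Q_flip[OF _ i] power2_minus)
  have "?g \<sigma> \<le> 2 * \<theta> * ((b i \<sigma>)\<^sup>2 * exp (\<theta> * Q \<sigma>) + (b i \<sigma>)\<^sup>2 * exp (\<theta> * (Q \<sigma> - 4 * b i \<sigma>)))" for \<sigma>
    using exp_mean_value_bound[of "Q \<sigma>" "Q \<sigma> - 4 * b i \<sigma>" \<theta>] \<theta>
    by (simp add: abs_le_iff power_mult_distrib algebra_simps)
  hence "(\<Sum>\<sigma>\<in>?S. ?g \<sigma>) \<le> (\<Sum>\<sigma>\<in>?S. 2 * \<theta> * ((b i \<sigma>)\<^sup>2 * exp (\<theta> * Q \<sigma>) + (b i \<sigma>)\<^sup>2 * exp (\<theta> * (Q \<sigma> - 4 * b i \<sigma>))))"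
    by (intro sum_mono)
  also have "\<dots> = 2 * \<theta> * ((\<Sum>\<sigma>\<in>?S. (b i \<sigma>)\<^sup>2 * exp (\<theta> * Q \<sigma>)) + (\<Sum>\<sigma>\<in>?S. (b i \<sigma>)\<^sup>2 * exp (\<theta> * Q \<sigma>)))"
    by (simp only: sum_distrib_left[symmetric] sum.distrib flip2)
  also have "\<dots> = 2 * (2 * \<theta> * (\<Sum>\<sigma>\<in>?S. (b i \<sigma>)\<^sup>2 * exp (\<theta> * Q \<sigma>)))" by (simp add: algebra_simps)
  finally show "(\<Sum>\<sigma>\<in>?S. b i \<sigma> * exp (\<theta> * Q \<sigma>)) \<le> 2 * \<theta> * (\<Sum>\<sigma>\<in>?S. (b i \<sigma>)\<^sup>2 * exp (\<theta> * Q \<sigma>))"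
    using two by linarith
qed

text \<open>The moment generating function of \<open>Q\<close> and its derivative, as sums over all sign vectors.\<close>

definition \<Psi> where "\<Psi> \<theta> = (\<Sum>\<sigma>\<in>signs s. exp (\<theta> * Q \<sigma>))"
definition \<Psi>' where "\<Psi>' \<theta> = (\<Sum>\<sigma>\<in>signs s. Q \<sigma> * exp (\<theta> * Q \<sigma>))"

lemma Psi_deriv: "(\<Psi> has_real_derivative \<Psi>' \<theta>) (at \<theta>)"
  unfolding \<Psi>_def[abs_def] \<Psi>'_def
  by (auto intro!: derivative_eq_intros sum.cong simp: mult_ac)

text \<open>The deterministic parts of the contributions add up to \<open>d\<close>. The odd parts are bounded by \<open>b_exp_bounds\<close>, where
\<open>b\<^sub>i\<^sup>2\<close> may be replaced by \<open>c\<^sub>i\<^sup>2\<close> because the cross term has nonnegative expectation, and the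
squares \<open>c\<^sub>i\<^sup>2\<close> add up to at most \<open>Q\<close> by the Parseval identity.\<close>

lemma Psi_ineq:
  assumes \<theta>: "0 \<le> \<theta>"
  shows "\<Psi>' \<theta> \<le> d * \<Psi> \<theta> + 2 * \<theta> * \<Psi>' \<theta>"
proof -
  let ?S = "signs s"
  let ?e = "\<lambda>\<sigma>. exp (\<theta> * Q \<sigma>)"
  let ?R = "\<lambda>i. sqn {..<d} (w i)"
  have "\<Psi>' \<theta> = (\<Sum>\<sigma>\<in>?S. \<Sum>i<s. (b i \<sigma> + ?R i) * ?e \<sigma>)"
    unfolding \<Psi>'_def
  proof (intro sum.cong refl)
    fix \<sigma>
    have "Q \<sigma> = (\<Sum>i<s. b i \<sigma> + ?R i)" by (simp add: Q_eq_sum b_def)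
    hence "Q \<sigma> * E = (\<Sum>i<s. (b i \<sigma> + ?R i) * E)" for E
      by (simp only: sum_distrib_right)
    thus "Q \<sigma> * ?e \<sigma> = (\<Sum>i<s. (b i \<sigma> + ?R i) * ?e \<sigma>)" .
  qed
  also have "\<dots> = (\<Sum>i<s. \<Sum>\<sigma>\<in>?S. b i \<sigma> * ?e \<sigma>) + (\<Sum>\<sigma>\<in>?S. \<Sum>i<s. ?R i * ?e \<sigma>)"
    unfolding distrib_right sum.distrib by (rule arg_cong2[of _ _ _ _ "(+)"], rule sum.swap, rule refl)
  also have "(\<Sum>\<sigma>\<in>?S. \<Sum>i<s. ?R i * ?e \<sigma>) = d * \<Psi> \<theta>"
    unfolding \<Psi>_def by (simp only: sum_distrib_right[symmetric] sum_sqn_w sum_distrib_left[symmetric])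
  finally have eq: "\<Psi>' \<theta> = (\<Sum>i<s. \<Sum>\<sigma>\<in>?S. b i \<sigma> * ?e \<sigma>) + d * \<Psi> \<theta>" .
  have "(\<Sum>i<s. \<Sum>\<sigma>\<in>?S. b i \<sigma> * ?e \<sigma>) \<le> (\<Sum>i<s. 2 * \<theta> * (\<Sum>\<sigma>\<in>?S. (c i \<sigma>)\<^sup>2 * ?e \<sigma>))"
  proof (intro sum_mono)
    fix i assume "i \<in> {..<s}"
    hence i: "i < s" by simp
    have sq: "(b i \<sigma>)\<^sup>2 = (c i \<sigma>)\<^sup>2 - 2 * ?R i * b i \<sigma> - (?R i)\<^sup>2" if "\<sigma> \<in> ?S" for \<sigma>
    proof -
      have "(b i \<sigma> + ?R i)\<^sup>2 = (\<sigma> i * \<sigma> i) * (c i \<sigma>)\<^sup>2" by (simp add: b_def power2_eq_square mult_ac)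
      thus ?thesis unfolding signs_sq[OF that i] by (simp add: power2_sum algebra_simps)
    qed
    have "(\<Sum>\<sigma>\<in>?S. (b i \<sigma>)\<^sup>2 * ?e \<sigma>) = (\<Sum>\<sigma>\<in>?S. (c i \<sigma>)\<^sup>2 * ?e \<sigma> - 2 * ?R i * (b i \<sigma> * ?e \<sigma>) - (?R i)\<^sup>2 * ?e \<sigma>)"
      by (intro sum.cong refl) (simp only: sq left_diff_distrib mult.assoc)
    also have "\<dots> = (\<Sum>\<sigma>\<in>?S. (c i \<sigma>)\<^sup>2 * ?e \<sigma>) - 2 * ?R i * (\<Sum>\<sigma>\<in>?S. b i \<sigma> * ?e \<sigma>) - (?R i)\<^sup>2 * (\<Sum>\<sigma>\<in>?S. ?e \<sigma>)"
      by (simp only: sum_subtractf sum_distrib_left)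
    also have "\<dots> \<le> (\<Sum>\<sigma>\<in>?S. (c i \<sigma>)\<^sup>2 * ?e \<sigma>)"
    proof -
      have "0 \<le> 2 * ?R i * (\<Sum>\<sigma>\<in>?S. b i \<sigma> * ?e \<sigma>)"
        using b_exp_bounds(1)[OF i \<theta>] by (intro mult_nonneg_nonneg) auto
      moreover have "0 \<le> (?R i)\<^sup>2 * (\<Sum>\<sigma>\<in>?S. ?e \<sigma>)" by (intro mult_nonneg_nonneg sum_nonneg) auto
      ultimately show ?thesis by linarith
    qed
    finally have "2 * \<theta> * (\<Sum>\<sigma>\<in>?S. (b i \<sigma>)\<^sup>2 * ?e \<sigma>) \<le> 2 * \<theta> * (\<Sum>\<sigma>\<in>?S. (c i \<sigma>)\<^sup>2 * ?e \<sigma>)"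
      using \<theta> by (intro mult_left_mono) auto
    thus "(\<Sum>\<sigma>\<in>?S. b i \<sigma> * ?e \<sigma>) \<le> 2 * \<theta> * (\<Sum>\<sigma>\<in>?S. (c i \<sigma>)\<^sup>2 * ?e \<sigma>)"
      using b_exp_bounds(2)[OF i \<theta>] by linarith
  qed
  also have "\<dots> = 2 * \<theta> * (\<Sum>i<s. \<Sum>\<sigma>\<in>?S. (c i \<sigma>)\<^sup>2 * ?e \<sigma>)"
    by (rule sum_distrib_left[symmetric])
  also have "(\<Sum>i<s. \<Sum>\<sigma>\<in>?S. (c i \<sigma>)\<^sup>2 * ?e \<sigma>) = (\<Sum>\<sigma>\<in>?S. \<Sum>i<s. (c i \<sigma>)\<^sup>2 * ?e \<sigma>)"
    by (rule sum.swap)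
  also have "\<dots> = (\<Sum>\<sigma>\<in>?S. (\<Sum>i<s. (c i \<sigma>)\<^sup>2) * ?e \<sigma>)"
    by (intro sum.cong refl sum_distrib_right[symmetric])
  also have "2 * \<theta> * (\<Sum>\<sigma>\<in>?S. (\<Sum>i<s. (c i \<sigma>)\<^sup>2) * ?e \<sigma>) \<le> 2 * \<theta> * \<Psi>' \<theta>"
    unfolding \<Psi>'_def using \<theta> by (intro mult_left_mono sum_mono mult_right_mono sum_c_sq_le) auto
  finally show ?thesis using eq by simp
qed

text \<open>Integration of \<open>(1 - 2 \<theta>) \<Psi>' \<le> d \<Psi>\<close>. The right-hand side is the moment generating function
\<open>(1 - 2 \<theta>) powr (- d / 2)\<close> of a chi-square variable with \<open>d\<close> degrees of freedom.\<close>

lemma Psi_bound: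
  assumes \<theta>: "0 \<le> \<theta>" "2 * \<theta> < 1"
  shows "\<Psi> \<theta> \<le> card (signs s) * exp (- (d / 2) * ln (1 - 2 * \<theta>))"
proof -
  define h where "h t = \<Psi> t * exp (d / 2 * ln (1 - 2 * t))" for t
  have "h \<theta> \<le> h 0"
  proof (rule DERIV_nonpos_imp_nonincreasing[OF \<theta>(1)])
    fix t assume t: "0 \<le> t" "t \<le> \<theta>"
    define v where "v = 1 - 2 * t"
    have v: "v > 0" using t \<theta> by (auto simp: v_def)
    let ?E = "exp (d / 2 * ln (1 - 2 * t))"
    have d: "(h has_real_derivative ?E * (\<Psi>' t - \<Psi> t * (d / v))) (at t)"
    proof -
      have l: "((\<lambda>t. ln (1 - 2 * t)) has_real_derivative - 2 / v) (at t)"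
        using v by (auto intro!: derivative_eq_intros simp: v_def)
      note ex = DERIV_fun_exp[OF DERIV_cmult[OF l, of "d / 2"]]
      show ?thesis unfolding h_def[abs_def]
        by (rule DERIV_cong[OF DERIV_mult[OF Psi_deriv ex]]) (simp add: algebra_simps)
    qed
    have "\<Psi>' t * v \<le> d * \<Psi> t" using Psi_ineq[OF t(1)] by (simp add: v_def algebra_simps)
    hence "\<Psi>' t - \<Psi> t * (d / v) \<le> 0" using v by (simp add: field_simps)
    thus "\<exists>z. (h has_real_derivative z) (at t) \<and> z \<le> 0"
      using d by (intro exI[of _ "?E * (\<Psi>' t - \<Psi> t * (d / v))"] conjI mult_nonneg_nonpos) auto
  qed
  also have "h 0 = card (signs s)" by (simp add: h_def \<Psi>_def)
  finally show ?thesis by (simp add: h_def exp_minus field_simps)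
qed

lemma rademacher_tail:
  assumes d: "0 < d" and t: "0 < t"
  shows "card {\<sigma>\<in>signs s. (sqrt d + t)\<^sup>2 < sqn {..<d} (\<lambda>a. \<Sum>j<s. of_real (\<sigma> j) * w j a)}
     \<le> card (signs s) * exp (- t\<^sup>2 / 2)"
proof -
  define z where "z = sqrt d + t"
  \<comment> \<open>This choice makes \<open>1 - 2 \<theta> = 1 / (1 + t / \<surd>d)\<close>, and \<open>ln (1 + x) \<le> x\<close> then suffices.\<close>
  define \<theta> where "\<theta> = t / (2 * z)"
  have sd: "sqrt d > 0" using d by simp
  have z: "z > 0" "z > t" using sd t unfolding z_def by linarith+
  have \<theta>: "0 < \<theta>" "2 * \<theta> < 1" using z t by (simp_all add: \<theta>_def)
  have v: "1 - 2 * \<theta> = 1 / (1 + t / sqrt d)" using sd z by (simp add: \<theta>_def z_def field_simps)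
  let ?B = "{\<sigma>\<in>signs s. z\<^sup>2 < Q \<sigma>}"
  have "card ?B * exp (\<theta> * z\<^sup>2) = (\<Sum>\<sigma>\<in>?B. exp (\<theta> * z\<^sup>2))" by simp
  also have "\<dots> \<le> (\<Sum>\<sigma>\<in>?B. exp (\<theta> * Q \<sigma>))" using \<theta> by (intro sum_mono) auto
  also have "\<dots> \<le> \<Psi> \<theta>" unfolding \<Psi>_def using finite_signs by (intro sum_mono2) auto
  also have "\<dots> \<le> card (signs s) * exp (- (d / 2) * ln (1 - 2 * \<theta>))"
    using \<theta> by (intro Psi_bound) auto
  also have "\<dots> \<le> card (signs s) * exp (sqrt d * t / 2)"
  proof -
    have "ln (1 + t / sqrt d) \<le> t / sqrt d" using sd t by (intro ln_add_one_self_le_self) auto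
    hence "d / 2 * ln (1 + t / sqrt d) \<le> d / 2 * (t / sqrt d)" by (intro mult_left_mono) auto
    also have "\<dots> = sqrt d * t / 2" using sd by (simp add: field_simps)
    finally have "- (d / 2) * ln (1 - 2 * \<theta>) \<le> sqrt d * t / 2"
      unfolding v using sd t by (simp add: ln_div add_pos_pos)
    thus ?thesis by (intro mult_left_mono) auto
  qed
  finally have "card ?B \<le> card (signs s) * exp (sqrt d * t / 2) / exp (\<theta> * z\<^sup>2)"
    by (simp add: pos_le_divide_eq)
  also have "\<dots> = card (signs s) * exp (sqrt d * t / 2 - \<theta> * z\<^sup>2)" by (simp add: exp_diff)
  also have "sqrt d * t / 2 - \<theta> * z\<^sup>2 = - t\<^sup>2 / 2"
  proof -
    have "\<theta> * z\<^sup>2 = t * z / 2" using z by (simp add: \<theta>_def power2_eq_square)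
    thus ?thesis by (simp add: z_def power2_eq_square algebra_simps)
  qed
  finally show ?thesis unfolding z_def Q_def y_def[abs_def] .
qed

end

text \<open>The rows of \<open>H\<close> have entries \<open>\<plusminus>1\<close> and its columns are orthogonal. The family \<open>v\<close> is an orthonormal basis of the
subspace that is to be embedded.\<close>

locale srht =
  fixes s d k :: nat and H :: "nat \<Rightarrow> nat \<Rightarrow> real" and v :: "nat \<Rightarrow> nat \<Rightarrow> complex"
  assumes k: "0 < k" "k \<le> s" and d: "0 < d"
    and H_sign: "\<And>r j. r < s \<Longrightarrow> j < s \<Longrightarrow> H r j * H r j = 1"
    and H_orth: "\<And>i j. i < s \<Longrightarrow> j < s \<Longrightarrow> (\<Sum>r<s. H r i * H r j) = s * of_bool (i = j)"
    and v: "orthonormal {..<s} d v"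
begin

text \<open>The rows of the matrix \<open>H D v\<close>, conjugated so that \<open>cip\<close> with \<open>x \<sigma> r\<close> applies the row.\<close>

definition x :: "(nat \<Rightarrow> real) \<Rightarrow> nat \<Rightarrow> nat \<Rightarrow> complex" where
  "x \<sigma> r a = (\<Sum>j<s. of_real (\<sigma> j) * (of_real (H r j) * cnj (v a j)))"

lemma isotropic:
  assumes "\<sigma> \<in> signs s" "a < d" "b < d"
  shows "(\<Sum>r<s. x \<sigma> r a * cnj (x \<sigma> r b)) = of_nat s * of_bool (a = b)"
proof -
  have "(\<Sum>r<s. x \<sigma> r a * cnj (x \<sigma> r b))
    = (\<Sum>r<s. \<Sum>i<s. \<Sum>j<s. of_real (H r i * H r j) * (of_real (\<sigma> i * \<sigma> j) * (cnj (v a i) * v b j)))"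
    unfolding x_def cnj_sum sum_product by (intro sum.cong refl) (simp add: mult_ac)
  also have "\<dots> = (\<Sum>i<s. \<Sum>r<s. \<Sum>j<s. of_real (H r i * H r j) * (of_real (\<sigma> i * \<sigma> j) * (cnj (v a i) * v b j)))"
    by (rule sum.swap)
  also have "\<dots> = (\<Sum>i<s. \<Sum>j<s. \<Sum>r<s. of_real (H r i * H r j) * (of_real (\<sigma> i * \<sigma> j) * (cnj (v a i) * v b j)))"
    by (intro sum.cong refl sum.swap)
  also have "\<dots> = (\<Sum>i<s. \<Sum>j<s. of_real (\<Sum>r<s. H r i * H r j) * (of_real (\<sigma> i * \<sigma> j) * (cnj (v a i) * v b j)))"
    by (simp add: sum_distrib_right)
  also have "\<dots> = (\<Sum>i<s. \<Sum>j<s. if i = j then of_nat s * (cnj (v a i) * v b i) else 0)"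
    by (intro sum.cong refl) (simp add: H_orth signs_sq[OF assms(1)] del: of_real_mult of_real_sum)
  also have "\<dots> = of_nat s * cip {..<s} (v a) (v b)" by (simp add: cip_def sum_distrib_left)
  finally show ?thesis using v assms by (simp add: orthonormal_def)
qed

lemma cip_x: "cip {..<d} (x \<sigma> r) c = (\<Sum>j<s. of_real (H r j * \<sigma> j) * (\<Sum>a<d. c a * v a j))"
proof -
  have "cip {..<d} (x \<sigma> r) c = (\<Sum>a<d. \<Sum>j<s. of_real (H r j * \<sigma> j) * (c a * v a j))"
    unfolding cip_def x_def cnj_sum sum_distrib_right by (intro sum.cong refl) (simp add: mult_ac)
  also have "\<dots> = (\<Sum>j<s. \<Sum>a<d. of_real (H r j * \<sigma> j) * (c a * v a j))" by (rule sum.swap)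
  finally show ?thesis by (simp add: sum_distrib_left)
qed

lemma row_tail:
  assumes r: "r < s" and t: "0 < t"
  shows "card {\<sigma>\<in>signs s. (sqrt d + t)\<^sup>2 < sqn {..<d} (x \<sigma> r)} \<le> card (signs s) * exp (- t\<^sup>2 / 2)"
proof -
  interpret parseval_frame s d "\<lambda>j a. of_real (H r j) * cnj (v a j)"
  proof
    fix a b assume ab: "a < d" "b < d"
    have "(\<Sum>j<s. of_real (H r j) * cnj (v a j) * cnj (of_real (H r j) * cnj (v b j)))
       = (\<Sum>j<s. of_real (H r j * H r j) * (cnj (v a j) * v b j))"
      by (simp add: mult_ac)
    also have "\<dots> = cip {..<s} (v a) (v b)" unfolding cip_def
      by (intro sum.cong refl) (simp add: H_sign r)
    finally show "(\<Sum>j<s. of_real (H r j) * cnj (v a j) * cnj (of_real (H r j) * cnj (v b j))) = of_bool (a = b)"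
      using v ab by (simp add: orthonormal_def)
  qed
  from rademacher_tail[OF d t] show ?thesis unfolding x_def[abs_def] .
qed

definition good :: "real \<Rightarrow> (nat \<Rightarrow> nat) \<Rightarrow> (nat \<Rightarrow> real) \<Rightarrow> bool" where
  "good e \<pi> \<sigma> \<longleftrightarrow> (\<forall>c. \<bar>(\<Sum>i<k. (cmod (\<Sum>j<s. of_real (H (\<pi> i) j * \<sigma> j) * (\<Sum>a<d. c a * v a j)))\<^sup>2) / k
       - sqn {..<d} c\<bar> \<le> e * sqn {..<d} c)"

text \<open>Sign vectors for which some row is long are discarded by a union bound over the \<open>s\<close> rows. For each of the
others the rows form an isotropic family and the sampling bound applies. The statement counts pairs, which is
the same as probability for the uniform law.\<close>

theorem srht_count:
  assumes e: "0 < e" and t: "0 < t"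
  shows "card {(\<pi>, \<sigma>). \<pi> permutes {..<s} \<and> \<sigma> \<in> signs s \<and> \<not> good e \<pi> \<sigma>}
    \<le> (s * exp (- t\<^sup>2 / 2) + 2 * d * exp (- (e\<^sup>2 / 2 - e ^ 3 / 6) * k / (sqrt d + t)\<^sup>2))
       * (card {\<pi>. \<pi> permutes {..<s}} * card (signs s))"
proof -
  define P where "P = {\<pi>. \<pi> permutes {..<s}}"
  have fP: "finite P" unfolding P_def by (rule finite_permutations) simp
  define q where "q = 2 * d * exp (- (e\<^sup>2 / 2 - e ^ 3 / 6) * k / (sqrt d + t)\<^sup>2)"
  define N where "N = {\<sigma>\<in>signs s. \<exists>r<s. (sqrt d + t)\<^sup>2 < sqn {..<d} (x \<sigma> r)}"
  have fN: "finite N" unfolding N_def using finite_signs by simp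
  have "card N \<le> (\<Sum>r<s. card {\<sigma>\<in>signs s. (sqrt d + t)\<^sup>2 < sqn {..<d} (x \<sigma> r)})"
  proof -
    have "N = (\<Union>r\<in>{..<s}. {\<sigma>\<in>signs s. (sqrt d + t)\<^sup>2 < sqn {..<d} (x \<sigma> r)})" by (auto simp: N_def)
    thus ?thesis by (simp add: card_UN_le)
  qed
  hence "real (card N) \<le> (\<Sum>r<s. real (card {\<sigma>\<in>signs s. (sqrt d + t)\<^sup>2 < sqn {..<d} (x \<sigma> r)}))"
    by (simp only: of_nat_le_iff flip: of_nat_sum)
  also have "\<dots> \<le> (\<Sum>r<s. card (signs s) * exp (- t\<^sup>2 / 2))"
    by (intro sum_mono row_tail t) auto
  finally have N: "real (card N) \<le> s * exp (- t\<^sup>2 / 2) * card (signs s)" by (simp add: mult_ac)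
  have per: "card {\<pi>\<in>P. \<not> good e \<pi> \<sigma>} \<le> q * card P" if \<sigma>: "\<sigma> \<in> signs s - N" for \<sigma>
  proof -
    have "0 < sqrt d + t" using t by (simp add: add_nonneg_pos)
    interpret R: isotropic_rows s k d "x \<sigma>" "(sqrt d + t)\<^sup>2"
    proof
      fix r assume r: "r < s"
      have "\<sigma> \<in> signs s" "\<sigma> \<notin> N" using \<sigma> by auto
      hence "\<not> (sqrt d + t)\<^sup>2 < sqn {..<d} (x \<sigma> r)" using r unfolding N_def by blast
      thus "sqn {..<d} (x \<sigma> r) \<le> (sqrt d + t)\<^sup>2" by (rule leI)
    next
      show "0 < (sqrt d + t)\<^sup>2" using \<open>0 < sqrt d + t\<close> by simp
      show "(\<Sum>r<s. x \<sigma> r a * cnj (x \<sigma> r b)) = of_nat s * of_bool (a = b)" if "a < d" "b < d" for a b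
        using \<sigma> that by (intro isotropic) auto
    qed (fact k)+
    show ?thesis
      using R.sampling_embedding[OF e] unfolding good_def P_def q_def cip_x mem_Collect_eq .
  qed
  have "{(\<pi>, \<sigma>). \<pi> permutes {..<s} \<and> \<sigma> \<in> signs s \<and> \<not> good e \<pi> \<sigma>}
     \<subseteq> P \<times> N \<union> (\<lambda>(\<sigma>, \<pi>). (\<pi>, \<sigma>)) ` (SIGMA \<sigma> : signs s - N. {\<pi>\<in>P. \<not> good e \<pi> \<sigma>})"
    by (auto simp: P_def image_iff)
  hence "card {(\<pi>, \<sigma>). \<pi> permutes {..<s} \<and> \<sigma> \<in> signs s \<and> \<not> good e \<pi> \<sigma>}
    \<le> card (P \<times> N \<union> (\<lambda>(\<sigma>, \<pi>). (\<pi>, \<sigma>)) ` (SIGMA \<sigma> : signs s - N. {\<pi>\<in>P. \<not> good e \<pi> \<sigma>}))"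
    using fP fN finite_signs by (intro card_mono) auto
  also have "\<dots> \<le> card (P \<times> N) + card ((\<lambda>(\<sigma>, \<pi>). (\<pi>, \<sigma>)) ` (SIGMA \<sigma> : signs s - N. {\<pi>\<in>P. \<not> good e \<pi> \<sigma>}))"
    by (rule card_Un_le)
  also have "\<dots> \<le> card P * card N + card (SIGMA \<sigma> : signs s - N. {\<pi>\<in>P. \<not> good e \<pi> \<sigma>})"
    using fP finite_signs by (intro add_mono card_image_le) (auto simp: card_cartesian_product)
  also have "card (SIGMA \<sigma> : signs s - N. {\<pi>\<in>P. \<not> good e \<pi> \<sigma>}) = (\<Sum>\<sigma>\<in>signs s - N. card {\<pi>\<in>P. \<not> good e \<pi> \<sigma>})"
    using fP finite_signs by (intro card_SigmaI) auto
  finally have "real (card {(\<pi>, \<sigma>). \<pi> permutes {..<s} \<and> \<sigma> \<in> signs s \<and> \<not> good e \<pi> \<sigma>})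
     \<le> real (card P * card N + (\<Sum>\<sigma>\<in>signs s - N. card {\<pi>\<in>P. \<not> good e \<pi> \<sigma>}))"
    by (simp only: of_nat_le_iff)
  also have "\<dots> = real (card P) * real (card N) + (\<Sum>\<sigma>\<in>signs s - N. real (card {\<pi>\<in>P. \<not> good e \<pi> \<sigma>}))"
    by simp
  also have "\<dots> \<le> card P * (s * exp (- t\<^sup>2 / 2) * card (signs s)) + (\<Sum>\<sigma>\<in>signs s - N. q * card P)"
    by (intro add_mono mult_left_mono N sum_mono per) auto
  also have "\<dots> \<le> card P * (s * exp (- t\<^sup>2 / 2) * card (signs s)) + (\<Sum>\<sigma>\<in>signs s. q * card P)"
    using finite_signs by (intro add_left_mono sum_mono2) (auto simp: q_def)
  finally show ?thesis by (simp add: P_def q_def algebra_simps)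
qed

end

section \<open>The law of the subsampled randomized Hadamard transform\<close>

lemma walsh_hadamard_carrier: "walsh_hadamard m \<in> carrier_mat (2 ^ m) (2 ^ m)"
proof (induction m)
  case (Suc m)
  have "four_block_mat (walsh_hadamard m) (walsh_hadamard m) (walsh_hadamard m) (- walsh_hadamard m)
     \<in> carrier_mat (2 ^ m + 2 ^ m) (2 ^ m + 2 ^ m)"
    by (intro four_block_carrier_mat Suc)  (use Suc in auto)
  thus ?case by (simp add: Let_def mult_2)
qed simp

lemma walsh_hadamard_Suc_entry:
  assumes "i < 2 ^ Suc m" "j < 2 ^ Suc m"
  shows "walsh_hadamard (Suc m) $$ (i, j) =
     (if i < 2 ^ m then 1 else if j < 2 ^ m then 1 else - 1) * walsh_hadamard m $$ (i mod 2 ^ m, j mod 2 ^ m)"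
proof -
  have c: "walsh_hadamard m \<in> carrier_mat (2 ^ m) (2 ^ m)" by (rule walsh_hadamard_carrier)
  have m: "x mod 2 ^ m = (if x < 2 ^ m then x else x - 2 ^ m)" if "x < 2 ^ Suc m" for x :: nat
    using that by (auto simp: mod_if)
  show ?thesis using assms c unfolding m[OF assms(1)] m[OF assms(2)] by (auto simp: Let_def)
qed

lemma walsh_hadamard_sign:
  "i < 2 ^ m \<Longrightarrow> j < 2 ^ m \<Longrightarrow> walsh_hadamard m $$ (i, j) * walsh_hadamard m $$ (i, j) = 1"
proof (induction m arbitrary: i j)
  case (Suc m)
  have "walsh_hadamard m $$ (i mod 2 ^ m, j mod 2 ^ m) * walsh_hadamard m $$ (i mod 2 ^ m, j mod 2 ^ m) = 1"
    by (rule Suc.IH) simp_all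
  thus ?case unfolding walsh_hadamard_Suc_entry[OF Suc.prems]
    by (cases "i < 2 ^ m"; cases "j < 2 ^ m") simp_all
qed simp

lemma sum_double:
  fixes n :: nat
  shows "(\<Sum>r<2 * n. f r) = (\<Sum>r<n. f r + f (r + n) :: real)"
proof -
  have "(\<Sum>r<2 * n. f r) = (\<Sum>r\<in>{0..<n} \<union> {n..<n + n}. f r)" by (intro sum.cong) auto
  also have "\<dots> = (\<Sum>r\<in>{0..<n}. f r) + (\<Sum>r\<in>{n..<n + n}. f r)" by (intro sum.union_disjoint) auto
  also have "(\<Sum>r\<in>{n..<n + n}. f r) = (\<Sum>r\<in>{0..<n}. f (r + n))"
    using sum.shift_bounds_nat_ivl[of f 0 n n] by simp
  finally show ?thesis by (simp add: sum.distrib atLeast0LessThan)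
qed

text \<open>The upper and the lower half of the rows contribute the same inner product of columns of the smaller matrix,
with signs that agree exactly if both columns lie in the same half.\<close>

lemma walsh_hadamard_orthogonal:
  "i < 2 ^ m \<Longrightarrow> j < 2 ^ m \<Longrightarrow>
   (\<Sum>r<2 ^ m. walsh_hadamard m $$ (r, i) * walsh_hadamard m $$ (r, j)) = real (2 ^ m) * of_bool (i = j)"
proof (induction m arbitrary: i j)
  case (Suc m)
  define h where "h = walsh_hadamard m"
  let ?i = "i mod 2 ^ m" and ?j = "j mod 2 ^ m"
  define \<sigma> :: real where "\<sigma> = (if i < 2 ^ m \<longleftrightarrow> j < 2 ^ m then 1 else - 1)"
  have "(\<Sum>r<2 ^ Suc m. walsh_hadamard (Suc m) $$ (r, i) * walsh_hadamard (Suc m) $$ (r, j))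
     = (\<Sum>r<2 ^ m. h $$ (r, ?i) * h $$ (r, ?j) + \<sigma> * (h $$ (r, ?i) * h $$ (r, ?j)))"
    unfolding power_Suc sum_double
  proof (intro sum.cong refl)
    fix r :: nat assume "r \<in> {..<2 ^ m}"
    hence r: "r < 2 ^ Suc m" "r + 2 ^ m < 2 ^ Suc m" "r < 2 ^ m" by auto
    show "walsh_hadamard (Suc m) $$ (r, i) * walsh_hadamard (Suc m) $$ (r, j) +
         walsh_hadamard (Suc m) $$ (r + 2 ^ m, i) * walsh_hadamard (Suc m) $$ (r + 2 ^ m, j)
       = h $$ (r, ?i) * h $$ (r, ?j) + \<sigma> * (h $$ (r, ?i) * h $$ (r, ?j))"
      unfolding walsh_hadamard_Suc_entry[OF r(1) Suc.prems(1)] walsh_hadamard_Suc_entry[OF r(1) Suc.prems(2)]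
        walsh_hadamard_Suc_entry[OF r(2) Suc.prems(1)] walsh_hadamard_Suc_entry[OF r(2) Suc.prems(2)]
      using r(3) by (simp add: h_def \<sigma>_def)
  qed
  also have "\<dots> = (1 + \<sigma>) * (\<Sum>r<2 ^ m. h $$ (r, ?i) * h $$ (r, ?j))"
    by (simp add: sum.distrib distrib_right flip: sum_distrib_left)
  also have "\<dots> = (1 + \<sigma>) * (real (2 ^ m) * of_bool (?i = ?j))"
    unfolding h_def by (subst Suc.IH) simp_all
  also have "\<dots> = real (2 ^ Suc m) * of_bool (i = j)"
  proof (cases "i < 2 ^ m \<longleftrightarrow> j < 2 ^ m")
    case True
    have "?i = ?j \<longleftrightarrow> i = j" using True Suc.prems by (auto simp: mod_if)
    thus ?thesis using True by (simp add: \<sigma>_def)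
  next
    case False
    hence "i \<noteq> j" by auto
    thus ?thesis using False by (simp add: \<sigma>_def)
  qed
  finally show ?case .
qed simp

lemma psrht_mat_carrier: "psrht_mat k n m \<pi> \<sigma> \<in> carrier_mat k n"
  by (simp add: psrht_mat_def)

lemma psrht_mat_entry:
  assumes \<pi>: "\<pi> permutes {..<2 ^ m}" and k: "k \<le> 2 ^ m" and n: "n \<le> 2 ^ m" and i: "i < k" and j: "j < n"
  shows "psrht_mat k n m \<pi> \<sigma> $$ (i, j) = walsh_hadamard m $$ (\<pi> i, j) * \<sigma> j / sqrt k"
proof -
  let ?s = "2 ^ m :: nat" and ?H = "walsh_hadamard m"
  have H: "?H \<in> carrier_mat ?s ?s" by (rule walsh_hadamard_carrier)
  have pi: "\<pi> i < ?s" using \<pi> i k permutes_in_image[of \<pi> "{..<?s}" i] by simp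
  have R: "row_sampling_mat k ?s \<pi> \<in> carrier_mat k ?s" by (simp add: row_sampling_mat_def)
  have RH: "(row_sampling_mat k ?s \<pi> * ?H) $$ (i, l) = ?H $$ (\<pi> i, l)" if l: "l < ?s" for l
  proof -
    have "(row_sampling_mat k ?s \<pi> * ?H) $$ (i, l) = (\<Sum>r<?s. row_sampling_mat k ?s \<pi> $$ (i, r) * ?H $$ (r, l))"
      using i l R H by (simp add: scalar_prod_def atLeast0LessThan)
    also have "\<dots> = (\<Sum>r<?s. if r = \<pi> i then ?H $$ (r, l) else 0)"
      using i pi by (intro sum.cong refl) (auto simp: row_sampling_mat_def)
    finally show ?thesis using pi by simp
  qed
  have "(row_sampling_mat k ?s \<pi> * ?H * sign_mat ?s \<sigma>) $$ (i, j)
     = (\<Sum>l<?s. (row_sampling_mat k ?s \<pi> * ?H) $$ (i, l) * sign_mat ?s \<sigma> $$ (l, j))"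
    using i j n R H by (simp add: scalar_prod_def atLeast0LessThan sign_mat_def)
  also have "\<dots> = (\<Sum>l<?s. if l = j then ?H $$ (\<pi> i, l) * \<sigma> l else 0)"
    using j n by (intro sum.cong refl) (auto simp: RH sign_mat_def)
  also have "\<dots> = ?H $$ (\<pi> i, j) * \<sigma> j" using j n by simp
  finally show ?thesis using i j n R H
    by (simp add: psrht_mat_def sign_mat_def)
qed

text \<open>A real matrix acting on a complex vector, of which only the first \<open>n\<close> entries are read.\<close>

definition mat_apply :: "nat \<Rightarrow> real mat \<Rightarrow> (nat \<Rightarrow> complex) \<Rightarrow> nat \<Rightarrow> complex" where
  "mat_apply n A z i = (\<Sum>j<n. of_real (A $$ (i, j)) * z j)"

definition preserves :: "real \<Rightarrow> nat \<Rightarrow> nat \<Rightarrow> real mat \<Rightarrow> (nat \<Rightarrow> complex) \<Rightarrow> bool" where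
  "preserves e k n A z \<longleftrightarrow> \<bar>sqn {..<k} (mat_apply n A z) - sqn {..<n} z\<bar> \<le> e * sqn {..<n} z"

lemma sqn_orthonormal_combination:
  assumes v: "orthonormal I m v"
  shows "sqn I (\<lambda>i. \<Sum>a<m. c a * v a i) = sqn {..<m} c"
proof -
  have "complex_of_real (sqn I (\<lambda>i. \<Sum>a<m. c a * v a i)) = (\<Sum>a<m. \<Sum>b<m. cnj (c a) * (c b * cip I (v a) (v b)))"
    unfolding sqn_cip cip_sum_left cip_scale_left cip_sum_right cip_scale_right
    by (simp add: sum_distrib_left)
  also have "\<dots> = (\<Sum>a<m. \<Sum>b<m. if a = b then cnj (c a) * c b else 0)"
    using v by (intro sum.cong refl) (simp add: orthonormal_def)
  also have "\<dots> = of_real (sqn {..<m} c)" unfolding sqn_cip by (simp add: cip_def)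
  finally show ?thesis using of_real_eq_iff by blast
qed

lemma pair_pmf_of_set:
  assumes "finite A" "A \<noteq> {}" "finite B" "B \<noteq> {}"
  shows "pair_pmf (pmf_of_set A) (pmf_of_set B) = pmf_of_set (A \<times> B)"
proof (rule pmf_eqI)
  fix x :: "'a \<times> 'b"
  obtain a b where x: "x = (a, b)" by (cases x)
  have "A \<times> B \<noteq> {}" "finite (A \<times> B)" using assms by auto
  thus "pmf (pair_pmf (pmf_of_set A) (pmf_of_set B)) x = pmf (pmf_of_set (A \<times> B)) x"
    using assms unfolding x by (simp add: pmf_pair indicator_def card_cartesian_product)
qed

text \<open>The law of the permutation and the signs. The value \<open>1\<close> is the default of the product outside of the
index set.\<close>

definition psrht_pmf :: "nat \<Rightarrow> ((nat \<Rightarrow> nat) \<times> (nat \<Rightarrow> real)) pmf" where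
  "psrht_pmf m = pair_pmf (pmf_of_set {\<pi>. \<pi> permutes {..<2 ^ m}}) (Pi_pmf {..<2 ^ m} 1 (\<lambda>_. pmf_of_set {-1, 1}))"

lemma psrht_pmf: "psrht_pmf m = pmf_of_set ({\<pi>. \<pi> permutes {..<2 ^ m}} \<times> signs (2 ^ m))"
proof -
  have "Pi_pmf {..<2 ^ m} 1 (\<lambda>_. pmf_of_set {-1, 1 :: real}) = pmf_of_set (signs (2 ^ m))"
    unfolding signs_def by (rule Pi_pmf_of_set) auto
  moreover have "{\<pi>. \<pi> permutes {..<2 ^ m :: nat}} \<noteq> {}" using permutes_id by blast
  ultimately show ?thesis unfolding psrht_pmf_def
    using finite_signs signs_nonempty by (simp add: pair_pmf_of_set finite_permutations)
qed

lemma mat_apply_psrht: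
  assumes "\<pi> permutes {..<2 ^ m}" "k \<le> 2 ^ m" "n \<le> 2 ^ m" "i < k"
  shows "mat_apply n (psrht_mat k n m \<pi> \<sigma>) z i
     = (\<Sum>j<n. of_real (walsh_hadamard m $$ (\<pi> i, j) * \<sigma> j) * z j) / of_real (sqrt k)"
  unfolding mat_apply_def sum_divide_distrib
  by (intro sum.cong refl) (simp add: psrht_mat_entry[OF assms])

text \<open>The family \<open>z\<close> may be linearly dependent, so it is first replaced by an orthonormal basis of its span, with \<open>d' \<le> d\<close>
elements. The basis is extended by zero from \<open>n\<close> to \<open>s\<close> coordinates, which accounts for the use of the first
\<open>n\<close> columns only.\<close>

theorem psrht_pmf_embedding:
  fixes z :: "nat \<Rightarrow> nat \<Rightarrow> complex"
  assumes n: "n \<le> 2 ^ m" "2 ^ m < 2 * n" and k0: "0 < k" "k \<le> 2 ^ m"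
    and e: "0 < e" "e < 1" and \<delta>: "0 < \<delta>" "\<delta> < 1" and d: "0 < d"
    and k: "2 * ((sqrt d + sqrt (8 * ln (6 * real n / \<delta>)))\<^sup>2 / (e\<^sup>2 - e ^ 3 / 3)) * ln (3 * real d / \<delta>) \<le> k"
  shows "measure_pmf.prob (psrht_pmf m)
     {(\<pi>, \<sigma>). \<not> (\<forall>c. preserves e k n (psrht_mat k n m \<pi> \<sigma>) (\<lambda>j. \<Sum>a<d. c a * z a j))} \<le> \<delta>"
proof -
  define s where "s = (2 ^ m :: nat)"
  define P where "P = {\<pi>. \<pi> permutes {..<s}}"
  have ns: "n \<le> s" "s < 2 * n" "k \<le> s" using n k0 by (simp_all add: s_def)
  have "id \<in> P" by (simp add: P_def permutes_id)
  moreover have "finite P" unfolding P_def by (rule finite_permutations) simp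
  ultimately have fP: "finite P" "P \<noteq> {}" by blast+
  let ?bad = "{(\<pi>, \<sigma>). \<not> (\<forall>c. preserves e k n (psrht_mat k n m \<pi> \<sigma>) (\<lambda>j. \<Sum>a<d. c a * z a j))}"
  obtain d' v where v: "d' \<le> d" "orthonormal {..<n} d' v"
     and zv: "\<And>a j. a < d \<Longrightarrow> j < n \<Longrightarrow> z a j = (\<Sum>b<d'. cip {..<n} (v b) (z a) * v b j)"
    using gram_schmidt_subfield[of "{..<n}" UNIV d z] by auto
  have comb: "\<exists>c'. \<forall>j<n. (\<Sum>a<d. c a * z a j) = (\<Sum>b<d'. c' b * v b j)" for c
  proof (intro exI allI impI)
    fix j assume j: "j < n"
    have "(\<Sum>a<d. c a * z a j) = (\<Sum>a<d. \<Sum>b<d'. c a * cip {..<n} (v b) (z a) * v b j)"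
    proof (intro sum.cong refl)
      fix a assume "a \<in> {..<d}"
      hence "z a j = (\<Sum>b<d'. cip {..<n} (v b) (z a) * v b j)" using zv j by blast
      hence "c a * z a j = c a * (\<Sum>b<d'. cip {..<n} (v b) (z a) * v b j)" by (rule arg_cong)
      thus "c a * z a j = (\<Sum>b<d'. c a * cip {..<n} (v b) (z a) * v b j)" by (simp add: sum_distrib_left mult.assoc)
    qed
    also have "\<dots> = (\<Sum>b<d'. \<Sum>a<d. c a * cip {..<n} (v b) (z a) * v b j)" by (rule sum.swap)
    finally show "(\<Sum>a<d. c a * z a j) = (\<Sum>b<d'. (\<Sum>a<d. c a * cip {..<n} (v b) (z a)) * v b j)"
      by (simp add: sum_distrib_right)
  qed
  have pres_cong: "preserves e k n A f = preserves e k n A g" if "\<And>j. j < n \<Longrightarrow> f j = g j" for A f g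
  proof -
    have "mat_apply n A f = mat_apply n A g" unfolding mat_apply_def using that by (intro ext sum.cong refl) simp
    moreover have "sqn {..<n} f = sqn {..<n} g" unfolding sqn_def using that by (intro sum.cong refl) simp
    ultimately show ?thesis unfolding preserves_def by simp
  qed
  show ?thesis
  proof (cases "d' = 0")
    case True
    have "?bad = {}"
    proof -
      have "preserves e k n A (\<lambda>j. \<Sum>a<d. c a * z a j)" for A c
      proof -
        obtain c' where "\<forall>j<n. (\<Sum>a<d. c a * z a j) = (\<Sum>b<d'. c' b * v b j)" using comb by blast
        hence "preserves e k n A (\<lambda>j. \<Sum>a<d. c a * z a j) = preserves e k n A (\<lambda>_. 0)"
          using True by (intro pres_cong) simp
        thus ?thesis by (simp add: preserves_def mat_apply_def sqn_def)
      qed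
      thus ?thesis by auto
    qed
    thus ?thesis using \<delta> by (simp only: measure_empty)
  next
    case False
    \<comment> \<open>extension by zero to all \<open>s\<close> columns\<close>
    define v' where "v' a j = (if j < n then v a j else 0)" for a j
    have cut: "(\<Sum>j<s. if j < n then f j else 0) = (\<Sum>j<n. f j)" for f :: "nat \<Rightarrow> complex"
      using ns(1) by (intro sum.mono_neutral_cong_right) auto
    have v': "orthonormal {..<s} d' v'"
    proof -
      have "cip {..<s} (v' a) (v' b) = cip {..<n} (v a) (v b)" for a b
        unfolding cip_def cut[symmetric] by (intro sum.cong refl) (simp add: v'_def)
      thus ?thesis using v(2) by (simp add: orthonormal_def)
    qed
    interpret S: srht s d' k "\<lambda>r j. walsh_hadamard m $$ (r, j)" v'
    proof
      show "0 < k" "k \<le> s" by fact+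
      show "0 < d'" using False by simp
      show "walsh_hadamard m $$ (r, j) * walsh_hadamard m $$ (r, j) = 1" if "r < s" "j < s" for r j
        by (rule walsh_hadamard_sign) (use that in \<open>simp_all add: s_def\<close>)
      show "(\<Sum>r<s. walsh_hadamard m $$ (r, i) * walsh_hadamard m $$ (r, j)) = s * of_bool (i = j)"
        if "i < s" "j < s" for i j
        using walsh_hadamard_orthogonal[of i m j] that by (simp add: s_def)
      show "orthonormal {..<s} d' v'" by (rule v')
    qed
    have good_pres: "preserves e k n (psrht_mat k n m \<pi> \<sigma>) (\<lambda>j. \<Sum>a<d. c a * z a j)"
      if good: "S.good e \<pi> \<sigma>" and \<pi>: "\<pi> permutes {..<2 ^ m}" for \<pi> \<sigma> c
    proof -
      obtain c' where c': "\<And>j. j < n \<Longrightarrow> (\<Sum>a<d. c a * z a j) = (\<Sum>b<d'. c' b * v b j)" using comb by blast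
      have row: "(\<Sum>j<s. of_real (walsh_hadamard m $$ (\<pi> i, j) * \<sigma> j) * (\<Sum>a<d'. c' a * v' a j))
         = (\<Sum>j<n. of_real (walsh_hadamard m $$ (\<pi> i, j) * \<sigma> j) * (\<Sum>a<d'. c' a * v a j))" for i
        unfolding cut[symmetric] by (intro sum.cong refl) (simp add: v'_def)
      have sq: "sqn {..<k} (mat_apply n (psrht_mat k n m \<pi> \<sigma>) (\<lambda>j. \<Sum>b<d'. c' b * v b j))
         = (\<Sum>i<k. (cmod (\<Sum>j<s. of_real (walsh_hadamard m $$ (\<pi> i, j) * \<sigma> j) * (\<Sum>a<d'. c' a * v' a j)))\<^sup>2) / k"
        unfolding sqn_def row sum_divide_distrib
        by (intro sum.cong refl) (simp add: mat_apply_psrht[OF \<pi> k0(2) n(1)] norm_divide power_divide)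
      have "preserves e k n (psrht_mat k n m \<pi> \<sigma>) (\<lambda>j. \<Sum>b<d'. c' b * v b j)"
        unfolding preserves_def sq sqn_orthonormal_combination[OF v(2)]
        using good unfolding S.good_def by blast
      moreover have "preserves e k n (psrht_mat k n m \<pi> \<sigma>) (\<lambda>j. \<Sum>a<d. c a * z a j)
          = preserves e k n (psrht_mat k n m \<pi> \<sigma>) (\<lambda>j. \<Sum>b<d'. c' b * v b j)"
        by (rule pres_cong) (rule c')
      ultimately show ?thesis by simp
    qed
    \<comment> \<open>With this \<open>t\<close>, \<open>exp (- t\<^sup>2 / 2) \<le> \<delta> / (6 n)\<close>, and the union bound over \<open>s < 2 n\<close> rows stays below \<open>\<delta> / 3\<close>.\<close>
    define t where "t = sqrt (8 * ln (6 * real n / \<delta>))"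
    have n0: "0 < n" using ns by simp
    have nd: "6 * real n / \<delta> > 1" "3 * real d / \<delta> > 1" using \<delta> n0 d by (simp_all add: pos_less_divide_eq)
    have t: "0 < t" unfolding t_def using nd by simp
    have t2: "t\<^sup>2 / 2 = 4 * ln (6 * real n / \<delta>)" unfolding t_def using nd by (simp add: less_imp_le)
    define E where "E = e\<^sup>2 / 2 - e ^ 3 / 6"
    have E: "E > 0"
    proof -
      have "e ^ 3 \<le> e\<^sup>2" using e by (intro power_decreasing) auto
      moreover have "0 < e\<^sup>2" using e by simp
      ultimately show ?thesis unfolding E_def by linarith
    qed
    define Mx where "Mx = (sqrt d' + t)\<^sup>2"
    have "0 < sqrt d' + t" using t by (simp add: add_nonneg_pos)
    hence Mx: "0 < Mx" by (simp add: Mx_def)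
    have "Mx \<le> (sqrt d + t)\<^sup>2" unfolding Mx_def using v(1) t by (intro power_mono) auto
    have kM: "ln (3 * real d / \<delta>) \<le> E * k / Mx"
    proof -
      have "(sqrt d + t)\<^sup>2 / E * ln (3 * real d / \<delta>) \<le> k"
      proof -
        have "2 * ((sqrt d + t)\<^sup>2 / (e\<^sup>2 - e ^ 3 / 3)) = (sqrt d + t)\<^sup>2 / E"
          unfolding E_def by (simp add: field_simps)
        thus ?thesis using k unfolding t_def[symmetric] by (simp only:)
      qed
      moreover have "Mx / E * ln (3 * real d / \<delta>) \<le> (sqrt d + t)\<^sup>2 / E * ln (3 * real d / \<delta>)"
        using \<open>Mx \<le> _\<close> E nd by (intro mult_right_mono divide_right_mono) auto
      ultimately have "Mx / E * ln (3 * real d / \<delta>) \<le> k" by linarith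
      thus ?thesis using Mx E by (simp add: field_simps)
    qed
    have "measure_pmf.prob (psrht_pmf m) ?bad \<le>
       card {(\<pi>, \<sigma>). \<pi> permutes {..<s} \<and> \<sigma> \<in> signs s \<and> \<not> S.good e \<pi> \<sigma>} / card (P \<times> signs s)"
    proof -
      have fin: "finite (P \<times> signs s)" "P \<times> signs s \<noteq> {}" using fP finite_signs signs_nonempty by auto
      have "measure_pmf.prob (psrht_pmf m) ?bad = card ((P \<times> signs s) \<inter> ?bad) / card (P \<times> signs s)"
        unfolding psrht_pmf P_def s_def by (rule measure_pmf_of_set) (use fin in \<open>simp_all add: P_def s_def\<close>)
      also have "\<dots> \<le> card {(\<pi>, \<sigma>). \<pi> permutes {..<s} \<and> \<sigma> \<in> signs s \<and> \<not> S.good e \<pi> \<sigma>} / card (P \<times> signs s)"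
      proof (intro divide_right_mono of_nat_mono card_mono)
        show "finite {(\<pi>, \<sigma>). \<pi> permutes {..<s} \<and> \<sigma> \<in> signs s \<and> \<not> S.good e \<pi> \<sigma>}"
          by (rule finite_subset[OF _ fin(1)]) (auto simp: P_def)
        show "(P \<times> signs s) \<inter> ?bad \<subseteq> {(\<pi>, \<sigma>). \<pi> permutes {..<s} \<and> \<sigma> \<in> signs s \<and> \<not> S.good e \<pi> \<sigma>}"
        proof
          fix x assume x: "x \<in> (P \<times> signs s) \<inter> ?bad"
          obtain \<pi> \<sigma> where px: "x = (\<pi>, \<sigma>)" by (cases x)
          with x have "\<pi> \<in> P" "\<sigma> \<in> signs s"
            "\<not> (\<forall>c. preserves e k n (psrht_mat k n m \<pi> \<sigma>) (\<lambda>j. \<Sum>a<d. c a * z a j))" by auto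
          hence "\<pi> permutes {..<s} \<and> \<sigma> \<in> signs s \<and> \<not> S.good e \<pi> \<sigma>"
            using good_pres[of \<pi> \<sigma>] unfolding P_def s_def by blast
          thus "x \<in> {(\<pi>, \<sigma>). \<pi> permutes {..<s} \<and> \<sigma> \<in> signs s \<and> \<not> S.good e \<pi> \<sigma>}"
            unfolding px by simp
        qed
      qed simp
      finally show ?thesis .
    qed
    also have "\<dots> \<le> real s * exp (- t\<^sup>2 / 2) + 2 * real d' * exp (- (e\<^sup>2 / 2 - e ^ 3 / 6) * k / (sqrt d' + t)\<^sup>2)"
    proof -
      have "0 < card (P \<times> signs s)" using fP finite_signs signs_nonempty by (simp add: card_cartesian_product card_gt_0_iff)
      thus ?thesis using S.srht_count[OF e(1) t]
        by (simp add: pos_divide_le_eq card_cartesian_product P_def)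
    qed
    also have "\<dots> \<le> \<delta> / 3 + 2 * (\<delta> / 3)"
    proof (rule add_mono)
      have "exp (- t\<^sup>2 / 2) \<le> exp (- ln (6 * real n / \<delta>))"
        using t2 nd(1) by (simp add: ln_gt_zero_iff[symmetric] less_imp_le)
      also have "\<dots> = \<delta> / (6 * real n)" using nd n0 \<delta> by (simp add: exp_minus)
      finally have "real s * exp (- t\<^sup>2 / 2) \<le> s * (\<delta> / (6 * real n))" by (intro mult_left_mono) auto
      also have "\<dots> \<le> (2 * real n) * (\<delta> / (6 * real n))" using ns \<delta> by (intro mult_right_mono) auto
      also have "\<dots> = \<delta> / 3" using n0 by simp
      finally show "real s * exp (- t\<^sup>2 / 2) \<le> \<delta> / 3" .
      have "exp (- E * k / Mx) \<le> exp (- ln (3 * real d / \<delta>))" using kM by simp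
      also have "\<dots> = \<delta> / (3 * real d)" using nd d \<delta> by (simp add: exp_minus)
      finally have "2 * real d' * exp (- E * k / Mx) \<le> 2 * d * (\<delta> / (3 * real d))"
        using v(1) by (intro mult_mono) auto
      also have "\<dots> = 2 * (\<delta> / 3)" using d by simp
      finally show "2 * real d' * exp (- (e\<^sup>2 / 2 - e ^ 3 / 6) * k / (sqrt d' + t)\<^sup>2) \<le> 2 * (\<delta> / 3)"
        unfolding E_def Mx_def .
    qed
    finally show ?thesis by simp
  qed
qed

section \<open>Gaussian matrices\<close>

text \<open>Completing the square: the weight \<open>exp (\<theta> k x\<^sup>2)\<close> changes the variance \<open>1 / k\<close> into \<open>1 / (k (1 - 2 \<theta>))\<close>
and the total mass into \<open>1 / sqrt (1 - 2 \<theta>)\<close>.\<close>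

lemma normal_density_times_exp_square:
  assumes k: "0 < k" and \<theta>: "2 * \<theta> < 1"
  shows "normal_density 0 (1 / sqrt k) x * exp (\<theta> * k * x\<^sup>2)
     = 1 / sqrt (1 - 2 * \<theta>) * normal_density 0 (1 / sqrt (k * (1 - 2 * \<theta>))) x"
proof -
  have v: "1 - 2 * \<theta> > 0" using \<theta> by simp
  have 1: "- (x\<^sup>2) / (2 * (1 / sqrt k)\<^sup>2) + \<theta> * k * x\<^sup>2 = - (x\<^sup>2) / (2 * (1 / sqrt (k * (1 - 2 * \<theta>)))\<^sup>2)"
    using k v by (simp add: power_divide field_simps)
  have 2: "1 / sqrt (2 * pi * (1 / sqrt k)\<^sup>2) = 1 / sqrt (1 - 2 * \<theta>) * (1 / sqrt (2 * pi * (1 / sqrt (k * (1 - 2 * \<theta>)))\<^sup>2))"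
  proof -
    have "sqrt (2 * pi * (1 / sqrt k)\<^sup>2) = sqrt (1 - 2 * \<theta>) * sqrt (2 * pi * (1 / sqrt (k * (1 - 2 * \<theta>)))\<^sup>2)"
      unfolding real_sqrt_mult[symmetric] using k v by (simp add: power_divide field_simps)
    thus ?thesis by simp
  qed
  have "normal_density 0 (1 / sqrt k) x * exp (\<theta> * k * x\<^sup>2)
     = 1 / sqrt (2 * pi * (1 / sqrt k)\<^sup>2) * exp (- (x\<^sup>2) / (2 * (1 / sqrt k)\<^sup>2) + \<theta> * k * x\<^sup>2)"
    unfolding normal_density_def exp_add by simp
  also have "\<dots> = 1 / sqrt (1 - 2 * \<theta>) * normal_density 0 (1 / sqrt (k * (1 - 2 * \<theta>))) x"
    unfolding 1 unfolding 2 unfolding normal_density_def by simp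
  finally show ?thesis .
qed

context prob_space
begin

lemma normal_square_mgf:
  assumes k: "0 < k" and \<theta>: "2 * \<theta> < 1"
    and X: "distributed M lborel X (normal_density 0 (1 / sqrt k))"
  shows "(\<integral>\<^sup>+\<omega>. ennreal (exp (\<theta> * k * (X \<omega>)\<^sup>2)) \<partial>M) = ennreal (1 / sqrt (1 - 2 * \<theta>))"
proof -
  have v: "1 - 2 * \<theta> > 0" using \<theta> by simp
  have s: "1 / sqrt (k * (1 - 2 * \<theta>)) > 0" using k v by simp
  interpret N: prob_space "density lborel (normal_density 0 (1 / sqrt (k * (1 - 2 * \<theta>))))"
    by (rule prob_space_normal_density[OF s])
  have "(\<integral>\<^sup>+x. ennreal (normal_density 0 (1 / sqrt (k * (1 - 2 * \<theta>))) x) \<partial>lborel) = 1"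
    using N.emeasure_space_1 by (simp add: emeasure_density)
  moreover have "(\<integral>\<^sup>+\<omega>. ennreal (exp (\<theta> * k * (X \<omega>)\<^sup>2)) \<partial>M)
     = (\<integral>\<^sup>+x. ennreal (normal_density 0 (1 / sqrt k) x) * ennreal (exp (\<theta> * k * x\<^sup>2)) \<partial>lborel)"
    by (rule distributed_nn_integral[OF X, symmetric]) simp
  moreover have "\<dots> = (\<integral>\<^sup>+x. ennreal (1 / sqrt (1 - 2 * \<theta>)) * ennreal (normal_density 0 (1 / sqrt (k * (1 - 2 * \<theta>))) x) \<partial>lborel)"
    using v by (intro nn_integral_cong) (simp add: normal_density_times_exp_square[OF k \<theta>] flip: ennreal_mult)
  moreover have "\<dots> = ennreal (1 / sqrt (1 - 2 * \<theta>)) * (\<integral>\<^sup>+x. ennreal (normal_density 0 (1 / sqrt (k * (1 - 2 * \<theta>))) x) \<partial>lborel)"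
    by (rule nn_integral_cmult) simp
  ultimately show ?thesis by simp
qed

text \<open>Rotation invariance of the Gaussian law. The vanishing coefficients are left out because a normal density with
standard deviation \<open>0\<close> does not describe a constant.\<close>

lemma row_combination_normal:
  fixes A :: "nat \<times> nat \<Rightarrow> 'a \<Rightarrow> real"
  assumes k: "0 < k"
    and indep: "indep_vars (\<lambda>_. borel) A ({..<k} \<times> {..<p})"
    and normal: "\<And>ij. ij \<in> {..<k} \<times> {..<p} \<Longrightarrow> distributed M lborel (A ij) (normal_density 0 (1 / sqrt k))"
    and u: "(\<Sum>j<p. (u j)\<^sup>2) = 1" and i: "i < k"
  shows "distributed M lborel (\<lambda>\<omega>. \<Sum>j<p. u j * A (i, j) \<omega>) (normal_density 0 (1 / sqrt k))"
proof -
  define J where "J = {j. j < p \<and> u j \<noteq> 0}"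
  have J: "finite J" "J \<subseteq> {..<p}" by (auto simp: J_def)
  have uJ: "(\<Sum>j\<in>J. (u j)\<^sup>2) = 1"
    unfolding u[symmetric] by (rule sum.mono_neutral_left) (auto simp: J_def)
  hence "J \<noteq> {}" by auto
  have ind: "indep_vars (\<lambda>_. borel) (\<lambda>j. A (i, j)) J"
  proof -
    have "indep_vars (\<lambda>j. PiM {(i, j)} (\<lambda>_. borel)) (\<lambda>j \<omega>. restrict (\<lambda>ij. A ij \<omega>) {(i, j)}) J"
      by (rule indep_vars_restrict[OF indep]) (use i J in \<open>auto simp: disjoint_family_on_def\<close>)
    hence "indep_vars (\<lambda>_. borel) (\<lambda>j \<omega>. (\<lambda>f. f (i, j)) (restrict (\<lambda>ij. A ij \<omega>) {(i, j)})) J"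
      by (rule indep_vars_compose2) (auto intro!: measurable_component_singleton)
    thus ?thesis by simp
  qed
  have ind2: "indep_vars (\<lambda>_. borel) (\<lambda>j \<omega>. u j * A (i, j) \<omega>) J"
    by (rule indep_vars_compose2[OF ind]) simp
  have "distributed M lborel (\<lambda>\<omega>. \<Sum>j\<in>J. u j * A (i, j) \<omega>)
     (normal_density (\<Sum>j\<in>J. 0) (sqrt (\<Sum>j\<in>J. (\<bar>u j\<bar> * (1 / sqrt k))\<^sup>2)))"
  proof (rule sum_indep_normal[OF J(1) \<open>J \<noteq> {}\<close> ind2])
    fix j assume j: "j \<in> J"
    thus "0 < \<bar>u j\<bar> * (1 / sqrt k)" using k by (simp add: J_def)
    have "distributed M lborel (\<lambda>\<omega>. 0 + u j * A (i, j) \<omega>) (normal_density (0 + u j * 0) (\<bar>u j\<bar> * (1 / sqrt k)))"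
      by (rule normal_density_affine) (use j k i normal J in \<open>auto simp: J_def\<close>)
    thus "distributed M lborel (\<lambda>\<omega>. u j * A (i, j) \<omega>) (normal_density 0 (\<bar>u j\<bar> * (1 / sqrt k)))"
      by simp
  qed
  also have "(\<Sum>j\<in>J. (\<bar>u j\<bar> * (1 / sqrt k))\<^sup>2) = (\<Sum>j\<in>J. (u j)\<^sup>2) / k"
    by (simp add: power_mult_distrib power_divide sum_divide_distrib)
  also have "sqrt \<dots> = 1 / sqrt k" by (simp add: uJ real_sqrt_divide)
  also have "(\<lambda>\<omega>. \<Sum>j\<in>J. u j * A (i, j) \<omega>) = (\<lambda>\<omega>. \<Sum>j<p. u j * A (i, j) \<omega>)"
    by (intro ext sum.mono_neutral_left) (auto simp: J_def)
  finally show ?thesis by simp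
qed

lemma row_combinations_indep:
  fixes A :: "nat \<times> nat \<Rightarrow> 'a \<Rightarrow> real"
  assumes indep: "indep_vars (\<lambda>_. borel) A ({..<k} \<times> {..<p})"
  shows "indep_vars (\<lambda>_. borel) (\<lambda>i \<omega>. \<Sum>j<p. u j * A (i, j) \<omega>) {..<k}"
proof -
  have "indep_vars (\<lambda>i. PiM ({i} \<times> {..<p}) (\<lambda>_. borel)) (\<lambda>i \<omega>. restrict (\<lambda>ij. A ij \<omega>) ({i} \<times> {..<p})) {..<k}"
    by (rule indep_vars_restrict[OF indep]) (auto simp: disjoint_family_on_def)
  hence "indep_vars (\<lambda>_. borel) (\<lambda>i \<omega>. (\<lambda>f. \<Sum>j<p. u j * f (i, j)) (restrict (\<lambda>ij. A ij \<omega>) ({i} \<times> {..<p}))) {..<k}"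
    by (rule indep_vars_compose2) (auto intro!: borel_measurable_sum borel_measurable_times measurable_component_singleton)
  thus ?thesis by simp
qed

lemma chi_square_mgf:
  fixes A :: "nat \<times> nat \<Rightarrow> 'a \<Rightarrow> real"
  assumes k: "0 < k" and \<theta>: "2 * \<theta> < 1"
    and indep: "indep_vars (\<lambda>_. borel) A ({..<k} \<times> {..<p})"
    and normal: "\<And>ij. ij \<in> {..<k} \<times> {..<p} \<Longrightarrow> distributed M lborel (A ij) (normal_density 0 (1 / sqrt k))"
    and u: "(\<Sum>j<p. (u j)\<^sup>2) = 1"
  shows "(\<integral>\<^sup>+\<omega>. ennreal (exp (\<theta> * k * (\<Sum>i<k. (\<Sum>j<p. u j * A (i, j) \<omega>)\<^sup>2))) \<partial>M)
      = ennreal ((1 / sqrt (1 - 2 * \<theta>)) ^ k)"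
proof -
  let ?g = "\<lambda>i \<omega>. \<Sum>j<p. u j * A (i, j) \<omega>"
  have "(\<integral>\<^sup>+\<omega>. ennreal (exp (\<theta> * k * (\<Sum>i<k. (?g i \<omega>)\<^sup>2))) \<partial>M)
     = (\<integral>\<^sup>+\<omega>. (\<Prod>i<k. ennreal (exp (\<theta> * k * (?g i \<omega>)\<^sup>2))) \<partial>M)"
    by (simp add: sum_distrib_left exp_sum prod_ennreal)
  also have "\<dots> = (\<Prod>i<k. \<integral>\<^sup>+\<omega>. ennreal (exp (\<theta> * k * (?g i \<omega>)\<^sup>2)) \<partial>M)"
  proof (rule indep_vars_nn_integral)
    show "indep_vars (\<lambda>_. borel) (\<lambda>i \<omega>. ennreal (exp (\<theta> * k * (?g i \<omega>)\<^sup>2))) {..<k}"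
      by (rule indep_vars_compose2[OF row_combinations_indep[OF indep]]) measurable
  qed auto
  also have "\<dots> = (\<Prod>i<k. ennreal (1 / sqrt (1 - 2 * \<theta>)))"
    using k \<theta> by (intro prod.cong refl normal_square_mgf row_combination_normal[OF k indep normal u]) auto
  also have "\<dots> = ennreal ((1 / sqrt (1 - 2 * \<theta>)) ^ k)"
    using \<theta> by (simp add: ennreal_power)
  finally show ?thesis .
qed

text \<open>With \<open>w\<^sub>r\<close> the squared norm of the row \<open>r\<close> of \<open>Z\<close>, the squared norm of the image is \<open>\<Sum>\<^sub>r w\<^sub>r T\<^sub>r\<close>, where each
\<open>T\<^sub>r\<close> is a normalized chi-square variable and the weights add up to \<open>1\<close>. Convexity of the exponential then
allows the dependent variables \<open>T\<^sub>r\<close> to be treated one at a time.\<close>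

lemma gaussian_mgf:
  fixes A :: "nat \<times> nat \<Rightarrow> 'a \<Rightarrow> real" and Z :: "'r \<Rightarrow> nat \<Rightarrow> real"
  assumes k: "0 < k" and \<theta>: "2 * \<theta> < 1"
    and indep: "indep_vars (\<lambda>_. borel) A ({..<k} \<times> {..<p})"
    and normal: "\<And>ij. ij \<in> {..<k} \<times> {..<p} \<Longrightarrow> distributed M lborel (A ij) (normal_density 0 (1 / sqrt k))"
    and R: "finite R" and Z: "(\<Sum>r\<in>R. \<Sum>j<p. (Z r j)\<^sup>2) = 1"
  shows "(\<integral>\<^sup>+\<omega>. ennreal (exp (\<theta> * k * (\<Sum>r\<in>R. \<Sum>i<k. (\<Sum>j<p. Z r j * A (i, j) \<omega>)\<^sup>2))) \<partial>M)
      \<le> ennreal ((1 / sqrt (1 - 2 * \<theta>)) ^ k)"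
proof -
  have Am: "A ij \<in> borel_measurable M" if "ij \<in> {..<k} \<times> {..<p}" for ij
    using indep that by (auto simp: indep_vars_def)
  define w where "w r = (\<Sum>j<p. (Z r j)\<^sup>2)" for r
  \<comment> \<open>zero rows cannot be normalized and contribute nothing\<close>
  define R' where "R' = {r\<in>R. w r \<noteq> 0}"
  define u where "u r j = Z r j / sqrt (w r)" for r j
  have w0: "0 \<le> w r" for r by (simp add: w_def sum_nonneg)
  have R': "finite R'" using R by (simp add: R'_def)
  have w1: "(\<Sum>r\<in>R'. w r) = 1"
    using Z R unfolding w_def[symmetric] by (subst sum.mono_neutral_left[of R R']) (auto simp: R'_def)
  have u1: "(\<Sum>j<p. (u r j)\<^sup>2) = 1" if "r \<in> R'" for r
    using that w0[of r] by (simp add: u_def power_divide R'_def flip: sum_divide_distrib) (simp add: w_def)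
  let ?T = "\<lambda>r \<omega>. \<Sum>i<k. (\<Sum>j<p. u r j * A (i, j) \<omega>)\<^sup>2"
  have Tm [measurable]: "?T r \<in> borel_measurable M" for r
    by (intro borel_measurable_sum borel_measurable_power borel_measurable_times Am) auto
  have T: "(\<Sum>r\<in>R. \<Sum>i<k. (\<Sum>j<p. Z r j * A (i, j) \<omega>)\<^sup>2) = (\<Sum>r\<in>R'. w r * ?T r \<omega>)" for \<omega>
  proof -
    have "(\<Sum>r\<in>R. \<Sum>i<k. (\<Sum>j<p. Z r j * A (i, j) \<omega>)\<^sup>2) = (\<Sum>r\<in>R'. \<Sum>i<k. (\<Sum>j<p. Z r j * A (i, j) \<omega>)\<^sup>2)"
    proof (rule sum.mono_neutral_right)
      show "\<forall>r\<in>R - R'. (\<Sum>i<k. (\<Sum>j<p. Z r j * A (i, j) \<omega>)\<^sup>2) = 0"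
      proof
        fix r assume "r \<in> R - R'"
        hence "w r = 0" by (auto simp: R'_def)
        hence "Z r j = 0" if "j < p" for j
          using that unfolding w_def by (simp add: sum_nonneg_eq_0_iff)
        thus "(\<Sum>i<k. (\<Sum>j<p. Z r j * A (i, j) \<omega>)\<^sup>2) = 0" by simp
      qed
    qed (use R in \<open>auto simp: R'_def\<close>)
    also have "\<dots> = (\<Sum>r\<in>R'. w r * ?T r \<omega>)"
    proof (intro sum.cong refl)
      fix r assume r: "r \<in> R'"
      have "Z r j = sqrt (w r) * u r j" for j using r w0[of r] by (simp add: u_def R'_def)
      thus "(\<Sum>i<k. (\<Sum>j<p. Z r j * A (i, j) \<omega>)\<^sup>2) = w r * ?T r \<omega>"
        using w0[of r] by (simp add: mult.assoc power_mult_distrib flip: sum_distrib_left)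
    qed
    finally show ?thesis .
  qed
  have jensen: "exp (\<theta> * k * (\<Sum>r\<in>R'. w r * ?T r \<omega>)) \<le> (\<Sum>r\<in>R'. w r * exp (\<theta> * k * ?T r \<omega>))" for \<omega>
  proof -
    have "exp (\<Sum>r\<in>R'. w r *\<^sub>R (\<theta> * k * ?T r \<omega>)) \<le> (\<Sum>r\<in>R'. w r * exp (\<theta> * k * ?T r \<omega>))"
      by (rule convex_on_sum[OF R' _ exp_convex]) (use w1 w0 in auto)
    thus ?thesis by (simp add: sum_distrib_left mult_ac)
  qed
  have "(\<integral>\<^sup>+\<omega>. ennreal (exp (\<theta> * k * (\<Sum>r\<in>R. \<Sum>i<k. (\<Sum>j<p. Z r j * A (i, j) \<omega>)\<^sup>2))) \<partial>M)
     \<le> (\<integral>\<^sup>+\<omega>. (\<Sum>r\<in>R'. ennreal (w r) * ennreal (exp (\<theta> * k * ?T r \<omega>))) \<partial>M)"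
    unfolding T
  proof (intro nn_integral_mono)
    fix \<omega>
    have "ennreal (exp (\<theta> * k * (\<Sum>r\<in>R'. w r * ?T r \<omega>))) \<le> ennreal (\<Sum>r\<in>R'. w r * exp (\<theta> * k * ?T r \<omega>))"
      by (rule ennreal_leI[OF jensen])
    also have "\<dots> = (\<Sum>r\<in>R'. ennreal (w r * exp (\<theta> * k * ?T r \<omega>)))"
      by (rule sum_ennreal[symmetric]) (simp add: w0)
    finally show "ennreal (exp (\<theta> * k * (\<Sum>r\<in>R'. w r * ?T r \<omega>)))
        \<le> (\<Sum>r\<in>R'. ennreal (w r) * ennreal (exp (\<theta> * k * ?T r \<omega>)))"
      by (simp add: ennreal_mult w0)
  qed
  also have "\<dots> = (\<Sum>r\<in>R'. \<integral>\<^sup>+\<omega>. ennreal (w r) * ennreal (exp (\<theta> * k * ?T r \<omega>)) \<partial>M)"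
    by (intro nn_integral_sum) measurable
  also have "\<dots> = (\<Sum>r\<in>R'. ennreal (w r) * ennreal ((1 / sqrt (1 - 2 * \<theta>)) ^ k))"
  proof (intro sum.cong refl)
    fix r assume r: "r \<in> R'"
    have "(\<integral>\<^sup>+\<omega>. ennreal (w r) * ennreal (exp (\<theta> * k * ?T r \<omega>)) \<partial>M)
       = ennreal (w r) * (\<integral>\<^sup>+\<omega>. ennreal (exp (\<theta> * k * ?T r \<omega>)) \<partial>M)"
      by (intro nn_integral_cmult) measurable
    thus "(\<integral>\<^sup>+\<omega>. ennreal (w r) * ennreal (exp (\<theta> * k * ?T r \<omega>)) \<partial>M)
       = ennreal (w r) * ennreal ((1 / sqrt (1 - 2 * \<theta>)) ^ k)"
      by (simp only: chi_square_mgf[OF k \<theta> indep normal u1[OF r]])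
  qed
  also have "\<dots> = ennreal ((1 / sqrt (1 - 2 * \<theta>)) ^ k)"
  proof -
    have "(\<Sum>r\<in>R'. ennreal (w r)) = ennreal (\<Sum>r\<in>R'. w r)" by (rule sum_ennreal) (rule w0)
    hence "(\<Sum>r\<in>R'. ennreal (w r)) = 1" by (simp add: w1)
    thus ?thesis by (simp flip: sum_distrib_right)
  qed
  finally show ?thesis .
qed

lemma markov_exp:
  assumes f: "f \<in> borel_measurable M" and le: "(\<integral>\<^sup>+\<omega>. ennreal (exp (f \<omega>)) \<partial>M) \<le> ennreal C" and C: "0 \<le> C"
  shows "prob {\<omega>\<in>space M. a \<le> f \<omega>} \<le> C * exp (- a)"
proof -
  have "{\<omega>\<in>space M. a \<le> f \<omega>} = {\<omega>\<in>space M. 1 \<le> ennreal (exp (- a)) * ennreal (exp (f \<omega>))}"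
    by (auto simp: ennreal_mult[symmetric] exp_add[symmetric] ennreal_ge_1)
  also have "emeasure M \<dots> \<le> ennreal (exp (- a)) * (\<integral>\<^sup>+\<omega>. ennreal (exp (f \<omega>)) \<partial>M)"
  proof -
    have "emeasure M {\<omega>\<in>space M. 1 \<le> ennreal (exp (- a)) * ennreal (exp (f \<omega>))}
       \<le> ennreal (exp (- a)) * (\<integral>\<^sup>+\<omega>. ennreal (exp (f \<omega>)) * indicator (space M) \<omega> \<partial>M)"
      using f by (intro nn_integral_Markov_inequality) auto
    also have "(\<integral>\<^sup>+\<omega>. ennreal (exp (f \<omega>)) * indicator (space M) \<omega> \<partial>M) = (\<integral>\<^sup>+\<omega>. ennreal (exp (f \<omega>)) \<partial>M)"
      by (intro nn_integral_cong) (simp add: indicator_def)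
    finally show ?thesis .
  qed
  also have "\<dots> \<le> ennreal (exp (- a)) * ennreal C" by (rule mult_left_mono[OF le]) simp
  also have "\<dots> = ennreal (C * exp (- a))" using C by (simp add: ennreal_mult[symmetric] mult.commute)
  finally show ?thesis using C by (simp add: emeasure_eq_measure)
qed

end

lemma half_ln_upper:
  fixes \<theta> :: real
  assumes "0 \<le> \<theta>" "2 * \<theta> < 1"
  shows "- ln (1 - 2 * \<theta>) / 2 \<le> \<theta> + \<theta>\<^sup>2 / (1 - 2 * \<theta>)"
proof -
  let ?f = "\<lambda>\<theta> :: real. \<theta> + \<theta>\<^sup>2 / (1 - 2 * \<theta>) + ln (1 - 2 * \<theta>) / 2"
  have "?f 0 \<le> ?f \<theta>"
  proof (rule DERIV_nonneg_imp_nondecreasing[OF assms(1)])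
    fix z assume z: "0 \<le> z" "z \<le> \<theta>"
    have v: "1 - 2 * z > 0" using z assms by simp
    have d1: "((\<lambda>\<theta>. \<theta>\<^sup>2 / (1 - 2 * \<theta>)) has_real_derivative (2 * z * (1 - 2 * z) + 2 * z\<^sup>2) / (1 - 2 * z)\<^sup>2) (at z)"
      using v by (auto intro!: derivative_eq_intros simp: power2_eq_square)
    have d2: "((\<lambda>\<theta>. ln (1 - 2 * \<theta>)) has_real_derivative - 2 / (1 - 2 * z)) (at z)"
      using v by (auto intro!: derivative_eq_intros)
    have "(?f has_real_derivative 1 + (2 * z * (1 - 2 * z) + 2 * z\<^sup>2) / (1 - 2 * z)\<^sup>2 + - 2 / (1 - 2 * z) / 2) (at z)"
      by (rule DERIV_add[OF DERIV_add[OF DERIV_ident d1] DERIV_cdivide[OF d2]])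
    moreover have "1 + (2 * z * (1 - 2 * z) + 2 * z\<^sup>2) / (1 - 2 * z)\<^sup>2 + - 2 / (1 - 2 * z) / 2 = 2 * z\<^sup>2 / (1 - 2 * z)\<^sup>2"
    proof -
      define v where "v = 1 - 2 * z"
      have v: "v > 0" and z: "z = (1 - v) / 2" using \<open>1 - 2 * z > 0\<close> by (simp_all add: v_def)
      show ?thesis unfolding v_def[symmetric] unfolding z using v by (simp add: field_simps power2_eq_square)
    qed
    ultimately show "\<exists>D. (?f has_real_derivative D) (at z) \<and> 0 \<le> D" by auto
  qed
  thus ?thesis by simp
qed

lemma half_ln_lower:
  fixes \<theta> :: real
  assumes "0 \<le> \<theta>"
  shows "- ln (1 + 2 * \<theta>) / 2 \<le> - \<theta> + \<theta>\<^sup>2"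
proof -
  let ?f = "\<lambda>\<theta> :: real. \<theta>\<^sup>2 - \<theta> + ln (1 + 2 * \<theta>) / 2"
  have "?f 0 \<le> ?f \<theta>"
  proof (rule DERIV_nonneg_imp_nondecreasing[OF assms(1)])
    fix z assume z: "0 \<le> z" "z \<le> \<theta>"
    have d1: "((\<lambda>\<theta>. \<theta>\<^sup>2 - \<theta>) has_real_derivative 2 * z - 1) (at z)"
      by (auto intro!: derivative_eq_intros)
    have d2: "((\<lambda>\<theta>. ln (1 + 2 * \<theta>)) has_real_derivative 2 / (1 + 2 * z)) (at z)"
      using z by (auto intro!: derivative_eq_intros)
    have "(?f has_real_derivative 2 * z - 1 + 1 / (1 + 2 * z)) (at z)"
      by (rule DERIV_cong[OF DERIV_add[OF d1 DERIV_cdivide[OF d2]]]) (use z in \<open>simp add: field_simps\<close>)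
    moreover have "2 * z - 1 + 1 / (1 + 2 * z) = 4 * z\<^sup>2 / (1 + 2 * z)"
      using z by (simp add: field_simps power2_eq_square)
    ultimately show "\<exists>D. (?f has_real_derivative D) (at z) \<and> 0 \<le> D" using z by auto
  qed
  thus ?thesis by simp
qed

lemma inverse_sqrt_power_exp:
  assumes "0 < v" shows "(1 / sqrt v) ^ k = exp (real k * (- ln v / 2))"
proof -
  have "exp (ln v / 2) = exp (ln (sqrt v))" using assms by (simp only: ln_sqrt)
  hence "exp (ln v / 2) = sqrt v" using assms by simp
  hence "1 / sqrt v = exp (- ln v / 2)" by (simp add: exp_minus inverse_eq_divide)
  thus ?thesis by (simp only: exp_of_nat_mult)
qed

context prob_space
begin

text \<open>Both tails use the exponent \<open>\<theta> = 2 t / 5\<close>, close to the optimal \<open>t / 2\<close> for small \<open>t\<close>. The limit \<open>5 / 28\<close> for \<open>t\<close>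
is the value \<open>5 e / 7\<close> at the largest relative error \<open>e = 1 / 4\<close> that occurs, and it keeps \<open>2 \<theta> \<le> 1 / 7\<close>.\<close>

lemma gaussian_deviation:
  fixes A :: "nat \<times> nat \<Rightarrow> 'a \<Rightarrow> real" and Z :: "'r \<Rightarrow> nat \<Rightarrow> real"
  assumes k: "0 < k" and t: "0 < t" "t \<le> 5 / 28"
    and indep: "indep_vars (\<lambda>_. borel) A ({..<k} \<times> {..<p})"
    and normal: "\<And>ij. ij \<in> {..<k} \<times> {..<p} \<Longrightarrow> distributed M lborel (A ij) (normal_density 0 (1 / sqrt k))"
    and R: "finite R" and Z: "(\<Sum>r\<in>R. \<Sum>j<p. (Z r j)\<^sup>2) = 1"
  shows "prob {\<omega>\<in>space M. t \<le> \<bar>(\<Sum>r\<in>R. \<Sum>i<k. (\<Sum>j<p. Z r j * A (i, j) \<omega>)\<^sup>2) - 1\<bar>} \<le> 2 * exp (- 21 / 100 * t\<^sup>2 * k)"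
proof -
  have Am: "A ij \<in> borel_measurable M" if "ij \<in> {..<k} \<times> {..<p}" for ij
    using indep that by (auto simp: indep_vars_def)
  define T where "T \<omega> = (\<Sum>r\<in>R. \<Sum>i<k. (\<Sum>j<p. Z r j * A (i, j) \<omega>)\<^sup>2)" for \<omega>
  have Tm [measurable]: "T \<in> borel_measurable M"
    unfolding T_def by (intro borel_measurable_sum borel_measurable_power borel_measurable_times Am) auto
  define \<theta> where "\<theta> = 2 * t / 5"
  have \<theta>: "0 < \<theta>" "2 * \<theta> \<le> 1 / 7" using t by (simp_all add: \<theta>_def)
  have up: "prob {\<omega>\<in>space M. 1 + t \<le> T \<omega>} \<le> exp (- 21 / 100 * t\<^sup>2 * k)"
  proof -
    have "prob {\<omega>\<in>space M. \<theta> * k * (1 + t) \<le> \<theta> * k * T \<omega>} \<le> (1 / sqrt (1 - 2 * \<theta>)) ^ k * exp (- (\<theta> * k * (1 + t)))"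
      using \<theta> unfolding T_def
      by (intro markov_exp gaussian_mgf[OF k _ indep normal R Z] borel_measurable_times borel_measurable_const Tm[unfolded T_def]) auto
    also have "{\<omega>\<in>space M. \<theta> * k * (1 + t) \<le> \<theta> * k * T \<omega>} = {\<omega>\<in>space M. 1 + t \<le> T \<omega>}"
      using \<theta> k by simp
    also have "(1 / sqrt (1 - 2 * \<theta>)) ^ k * exp (- (\<theta> * k * (1 + t))) = exp (k * (- ln (1 - 2 * \<theta>) / 2 - \<theta> * (1 + t)))"
      using \<theta> by (simp add: inverse_sqrt_power_exp algebra_simps flip: exp_add)
    also have "\<dots> \<le> exp (k * (- 21 / 100 * t\<^sup>2))"
    proof -
      have "\<theta>\<^sup>2 / (1 - 2 * \<theta>) \<le> \<theta>\<^sup>2 / (6 / 7)" using \<theta> by (intro divide_left_mono) auto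
      also have "\<dots> = 14 / 75 * t\<^sup>2" by (simp add: \<theta>_def power2_eq_square)
      finally have "\<theta>\<^sup>2 / (1 - 2 * \<theta>) \<le> 14 / 75 * t\<^sup>2" .
      moreover have "- ln (1 - 2 * \<theta>) / 2 \<le> \<theta> + \<theta>\<^sup>2 / (1 - 2 * \<theta>)" using \<theta> by (intro half_ln_upper) auto
      moreover have "\<theta> * (1 + t) = \<theta> + 2 / 5 * t\<^sup>2" by (simp add: \<theta>_def power2_eq_square algebra_simps)
      ultimately have "- ln (1 - 2 * \<theta>) / 2 - \<theta> * (1 + t) \<le> - 21 / 100 * t\<^sup>2"
        using zero_le_power2[of t] by linarith
      thus ?thesis by (intro iffD2[OF exp_le_cancel_iff] mult_left_mono) auto
    qed
    finally show ?thesis by (simp add: mult_ac)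
  qed
  have lo: "prob {\<omega>\<in>space M. T \<omega> \<le> 1 - t} \<le> exp (- 21 / 100 * t\<^sup>2 * k)"
  proof -
    have "prob {\<omega>\<in>space M. - \<theta> * k * (1 - t) \<le> - \<theta> * k * T \<omega>} \<le> (1 / sqrt (1 - 2 * (- \<theta>))) ^ k * exp (- (- \<theta> * k * (1 - t)))"
      using \<theta> unfolding T_def
      by (intro markov_exp gaussian_mgf[OF k _ indep normal R Z] borel_measurable_times borel_measurable_const Tm[unfolded T_def]) auto
    also have "{\<omega>\<in>space M. - \<theta> * k * (1 - t) \<le> - \<theta> * k * T \<omega>} = {\<omega>\<in>space M. T \<omega> \<le> 1 - t}"
      using \<theta> k by simp
    also have "(1 / sqrt (1 - 2 * (- \<theta>))) ^ k * exp (- (- \<theta> * k * (1 - t))) = exp (k * (- ln (1 + 2 * \<theta>) / 2 + \<theta> * (1 - t)))"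
      using \<theta> by (simp add: inverse_sqrt_power_exp algebra_simps flip: exp_add)
    also have "\<dots> \<le> exp (k * (- 21 / 100 * t\<^sup>2))"
    proof -
      have "\<theta>\<^sup>2 = 4 / 25 * t\<^sup>2" by (simp add: \<theta>_def power2_eq_square)
      moreover have "- ln (1 + 2 * \<theta>) / 2 \<le> - \<theta> + \<theta>\<^sup>2" using \<theta> by (intro half_ln_lower) auto
      moreover have "\<theta> * (1 - t) = \<theta> - 2 / 5 * t\<^sup>2" by (simp add: \<theta>_def power2_eq_square field_simps)
      ultimately have "- ln (1 + 2 * \<theta>) / 2 + \<theta> * (1 - t) \<le> - 21 / 100 * t\<^sup>2"
        using zero_le_power2[of t] by linarith
      thus ?thesis by (intro iffD2[OF exp_le_cancel_iff] mult_left_mono) auto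
    qed
    finally show ?thesis by (simp add: mult_ac)
  qed
  have "{\<omega>\<in>space M. t \<le> \<bar>T \<omega> - 1\<bar>} = {\<omega>\<in>space M. 1 + t \<le> T \<omega>} \<union> {\<omega>\<in>space M. T \<omega> \<le> 1 - t}"
    by auto
  moreover have "prob ({\<omega>\<in>space M. 1 + t \<le> T \<omega>} \<union> {\<omega>\<in>space M. T \<omega> \<le> 1 - t})
     \<le> prob {\<omega>\<in>space M. 1 + t \<le> T \<omega>} + prob {\<omega>\<in>space M. T \<omega> \<le> 1 - t}"
    by (intro measure_Un_le) measurable
  ultimately show ?thesis using up lo unfolding T_def by simp
qed

end

text \<open>Integer points in an \<open>\<ell>\<^sub>1\<close> ball. The bound on the single coordinates is implied by the bound on the sum and
makes finiteness immediate.\<close>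

definition int_net :: "nat \<Rightarrow> nat \<Rightarrow> (nat \<Rightarrow> int) set" where
  "int_net N m = {z \<in> PiE {..<N} (\<lambda>_. {- int m..int m}). (\<Sum>a<N. \<bar>z a\<bar>) \<le> int m}"

lemma finite_int_net: "finite (int_net N m)"
  unfolding int_net_def by (auto intro!: finite_PiE)

lemma sum_half_powers: "(\<Sum>v\<in>{- int m..int m}. (1 / 2 :: real) ^ nat \<bar>v\<bar>) \<le> 3 - 2 * (1 / 2) ^ m"
proof (induction m)
  case (Suc m)
  have "{- int (Suc m)..int (Suc m)} = insert (- int (Suc m)) (insert (int (Suc m)) {- int m..int m})" by auto
  hence "(\<Sum>v\<in>{- int (Suc m)..int (Suc m)}. (1 / 2 :: real) ^ nat \<bar>v\<bar>)
     = (1 / 2) ^ Suc m + (1 / 2) ^ Suc m + (\<Sum>v\<in>{- int m..int m}. (1 / 2 :: real) ^ nat \<bar>v\<bar>)"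
    by (simp add: nat_add_distrib)
  thus ?case using Suc by simp
qed simp

text \<open>Each point of the net has weight \<open>2 powr (- \<parallel>z\<parallel>\<^sub>1)\<close> at least \<open>1 / 2 ^ m\<close>, and the total weight of all integer points
is the product of the geometric sums \<open>\<Sum>\<^sub>v 2 powr (- \<bar>v\<bar>) = 3\<close>.\<close>

lemma card_int_net: "real (card (int_net N m)) \<le> 2 ^ m * 3 ^ N"
proof -
  let ?B = "PiE {..<N} (\<lambda>_. {- int m..int m})"
  have "(1 / 2) ^ m * real (card (int_net N m)) = (\<Sum>z\<in>int_net N m. (1 / 2 :: real) ^ m)" by simp
  also have "\<dots> \<le> (\<Sum>z\<in>int_net N m. \<Prod>a<N. (1 / 2) ^ nat \<bar>z a\<bar>)"
  proof (intro sum_mono)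
    fix z assume z: "z \<in> int_net N m"
    have "int (\<Sum>a<N. nat \<bar>z a\<bar>) = (\<Sum>a<N. \<bar>z a\<bar>)" by simp
    also have "\<dots> \<le> int m" using z by (simp add: int_net_def)
    finally have "(\<Sum>a<N. nat \<bar>z a\<bar>) \<le> m" by (simp only: of_nat_le_iff)
    thus "(1 / 2 :: real) ^ m \<le> (\<Prod>a<N. (1 / 2) ^ nat \<bar>z a\<bar>)"
      by (simp add: power_sum[symmetric] power_decreasing)
  qed
  also have "\<dots> \<le> (\<Sum>z\<in>?B. \<Prod>a<N. (1 / 2) ^ nat \<bar>z a\<bar>)"
  proof (rule sum_mono2)
    show "finite ?B" by (intro finite_PiE) auto
    show "int_net N m \<subseteq> ?B" unfolding int_net_def by blast
    show "0 \<le> (\<Prod>a<N. (1 / 2 :: real) ^ nat \<bar>z a\<bar>)" for z by (intro prod_nonneg) simp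
  qed
  also have "\<dots> = (\<Prod>a<N. \<Sum>v\<in>{- int m..int m}. (1 / 2) ^ nat \<bar>v\<bar>)"
    using prod_sum_PiE[of "{..<N}" "\<lambda>_. {- int m..int m}" "\<lambda>_ v. (1 / 2 :: real) ^ nat \<bar>v\<bar>"] by simp
  also have "\<dots> \<le> (\<Prod>a<N. 3)"
  proof (intro prod_mono conjI)
    show "(\<Sum>v\<in>{- int m..int m}. (1 / 2 :: real) ^ nat \<bar>v\<bar>) \<le> 3"
      by (rule order.trans[OF sum_half_powers]) simp
  qed (simp add: sum_nonneg)
  finally have "(1 / 2) ^ m * real (card (int_net N m)) \<le> 3 ^ N" by simp
  hence "2 ^ m * ((1 / 2) ^ m * real (card (int_net N m))) \<le> 2 ^ m * 3 ^ N" by (rule mult_left_mono) simp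
  thus ?thesis by (simp add: power_divide)
qed

text \<open>Rounding towards zero does not increase absolute values, so that rounded vectors stay in the unit ball.\<close>

definition round_to_zero :: "real \<Rightarrow> int" where "round_to_zero x = (if 0 \<le> x then \<lfloor>x\<rfloor> else \<lceil>x\<rceil>)"

lemma round_to_zero: "\<bar>x - of_int (round_to_zero x)\<bar> \<le> 1" "\<bar>of_int (round_to_zero x)\<bar> \<le> \<bar>x\<bar>"
proof -
  show "\<bar>x - of_int (round_to_zero x)\<bar> \<le> 1"
  proof (cases "0 \<le> x")
    case True
    hence e: "round_to_zero x = \<lfloor>x\<rfloor>" by (simp add: round_to_zero_def)
    show ?thesis unfolding e by linarith
  next
    case False
    hence e: "round_to_zero x = \<lceil>x\<rceil>" by (simp add: round_to_zero_def)
    show ?thesis unfolding e by linarith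
  qed
  show "\<bar>of_int (round_to_zero x)\<bar> \<le> \<bar>x\<bar>"
  proof (cases "0 \<le> x")
    case True thus ?thesis unfolding round_to_zero_def by simp
  next
    case False 
    hence "\<lceil>x\<rceil> \<le> 0" by simp
    thus ?thesis using False unfolding round_to_zero_def by simp
  qed
qed

text \<open>Polarization with the scaled vectors \<open>14 x\<close> and \<open>y\<close>: the factor \<open>14 = 2 / (1 / 7)\<close> balances the bounds on
the norms of \<open>x\<close> and \<open>y\<close>.\<close>

lemma bilinear_bound:
  fixes T :: "nat \<Rightarrow> nat \<Rightarrow> real"
  assumes sym: "\<And>a b. T a b = T b a"
    and K: "\<And>c. \<bar>\<Sum>a<N. \<Sum>b<N. T a b * c a * c b\<bar> \<le> K * (\<Sum>a<N. (c a)\<^sup>2)"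
    and x: "(\<Sum>a<N. (x a)\<^sup>2) \<le> (1 / 7)\<^sup>2" and y: "(\<Sum>a<N. (y a)\<^sup>2) \<le> 4" and K0: "0 \<le> K"
  shows "\<bar>\<Sum>a<N. \<Sum>b<N. T a b * x a * y b\<bar> \<le> 2 / 7 * K"
proof -
  define q where "q c = (\<Sum>a<N. \<Sum>b<N. T a b * c a * c b)" for c
  define B where "B = (\<Sum>a<N. \<Sum>b<N. T a b * x a * y b)"
  have B': "(\<Sum>a<N. \<Sum>b<N. T a b * y a * x b) = B"
    unfolding B_def by (subst sum.swap, intro sum.cong refl, subst sym) (simp only: mult_ac)
  have q: "q (\<lambda>a. 14 * x a + \<sigma> * y a) = 196 * q x + 28 * \<sigma> * B + \<sigma>\<^sup>2 * q y" for \<sigma>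
  proof -
    have "q (\<lambda>a. 14 * x a + \<sigma> * y a) = (\<Sum>a<N. \<Sum>b<N. 196 * (T a b * x a * x b) + 14 * \<sigma> * (T a b * x a * y b) + 14 * \<sigma> * (T a b * y a * x b) + \<sigma>\<^sup>2 * (T a b * y a * y b))"
      unfolding q_def by (intro sum.cong refl) (simp add: algebra_simps power2_eq_square)
    also have "\<dots> = 196 * q x + 14 * \<sigma> * B + 14 * \<sigma> * (\<Sum>a<N. \<Sum>b<N. T a b * y a * x b) + \<sigma>\<^sup>2 * q y"
      unfolding q_def B_def by (simp only: sum.distrib sum_distrib_left)
    finally show ?thesis unfolding B' by simp
  qed
  have n: "(\<Sum>a<N. (14 * x a + \<sigma> * y a)\<^sup>2) = 196 * (\<Sum>a<N. (x a)\<^sup>2) + 28 * \<sigma> * (\<Sum>a<N. x a * y a) + \<sigma>\<^sup>2 * (\<Sum>a<N. (y a)\<^sup>2)" for \<sigma>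
  proof -
    have "(\<Sum>a<N. (14 * x a + \<sigma> * y a)\<^sup>2) = (\<Sum>a<N. 196 * (x a)\<^sup>2 + 28 * \<sigma> * (x a * y a) + \<sigma>\<^sup>2 * (y a)\<^sup>2)"
      by (intro sum.cong refl) (simp add: algebra_simps power2_eq_square)
    thus ?thesis by (simp only: sum.distrib sum_distrib_left)
  qed
  let ?X = "\<Sum>a<N. (x a)\<^sup>2" and ?Y = "\<Sum>a<N. (y a)\<^sup>2" and ?XY = "\<Sum>a<N. x a * y a"
  have "\<bar>196 * q x + 28 * B + q y\<bar> \<le> K * (196 * ?X + 28 * ?XY + ?Y)"
    using K[of "\<lambda>a. 14 * x a + 1 * y a"] q[of 1] n[of 1] unfolding q_def[symmetric] by simp
  moreover have "\<bar>196 * q x - 28 * B + q y\<bar> \<le> K * (196 * ?X - 28 * ?XY + ?Y)"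
    using K[of "\<lambda>a. 14 * x a + (- 1) * y a"] q[of "-1"] n[of "-1"] unfolding q_def[symmetric] by simp
  ultimately have "\<bar>56 * B\<bar> \<le> K * (196 * ?X + 28 * ?XY + ?Y) + K * (196 * ?X - 28 * ?XY + ?Y)"
    by linarith
  also have "\<dots> = K * (2 * (196 * ?X + ?Y))" by (simp add: algebra_simps)
  also have "\<dots> \<le> K * (2 * (196 * (1 / 7)\<^sup>2 + 4))" using x y K0 by (intro mult_left_mono) auto
  finally have "56 * \<bar>B\<bar> \<le> 16 * K" by (simp add: power2_eq_square abs_mult)
  thus ?thesis unfolding B_def[symmetric] by linarith
qed

text \<open>Let \<open>K\<close> be the supremum of the form on the unit ball. For \<open>c\<close> in the ball and its rounding \<open>c'\<close> in the net,
\<open>q c - q c'\<close> is the bilinear form at \<open>c - c'\<close> and \<open>c + c'\<close>, whose norms are at most \<open>1 / 7\<close> and \<open>2\<close>.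
Hence \<open>K \<le> t + 2 K / 7\<close>, which is \<open>K \<le> 7 t / 5\<close>.\<close>

lemma quadratic_form_net:
  fixes T :: "nat \<Rightarrow> nat \<Rightarrow> real"
  assumes sym: "\<And>a b. T a b = T b a" and N: "0 < N" and t: "0 \<le> t"
    and net: "\<And>z c. z \<in> int_net N (7 * N) \<Longrightarrow> (\<And>a. c a = of_int (z a) / (7 * sqrt N)) \<Longrightarrow>
       \<bar>\<Sum>a<N. \<Sum>b<N. T a b * c a * c b\<bar> \<le> t * (\<Sum>a<N. (c a)\<^sup>2)"
  shows "\<bar>\<Sum>a<N. \<Sum>b<N. T a b * c a * c b\<bar> \<le> 7 / 5 * t * (\<Sum>a<N. (c a)\<^sup>2)"
proof -
  define q where "q c = (\<Sum>a<N. \<Sum>b<N. T a b * c a * c b)" for c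
  define n2 where "n2 c = (\<Sum>a<N. (c a)\<^sup>2)" for c :: "nat \<Rightarrow> real"
  have n20: "0 \<le> n2 c" for c by (simp add: n2_def sum_nonneg)
  define S where "S = {\<bar>q c\<bar> |c. n2 c \<le> 1}"
  define K where "K = Sup S"
  have c1: "\<bar>c a\<bar> \<le> 1" if "n2 c \<le> 1" "a < N" for c a
  proof -
    have "(c a)\<^sup>2 \<le> n2 c" unfolding n2_def using that by (intro member_le_sum) auto
    hence "(c a)\<^sup>2 \<le> 1" using that by linarith
    thus ?thesis by (simp only: abs_square_le_1)
  qed
  have bdd: "bdd_above S"
  proof (rule bdd_aboveI)
    fix y assume "y \<in> S"
    then obtain c where c: "y = \<bar>q c\<bar>" "n2 c \<le> 1" by (auto simp: S_def)
    have "\<bar>q c\<bar> \<le> (\<Sum>a<N. \<Sum>b<N. \<bar>T a b * c a * c b\<bar>)" unfolding q_def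
      by (rule order.trans[OF sum_abs]) (intro sum_mono sum_abs)
    also have "\<dots> \<le> (\<Sum>a<N. \<Sum>b<N. \<bar>T a b\<bar>)"
    proof (intro sum_mono)
      fix a b assume "a \<in> {..<N}" "b \<in> {..<N}"
      hence "\<bar>c a\<bar> * \<bar>c b\<bar> \<le> 1" using c1[OF c(2)] by (intro mult_le_one) auto
      hence "\<bar>T a b\<bar> * (\<bar>c a\<bar> * \<bar>c b\<bar>) \<le> \<bar>T a b\<bar> * 1" by (intro mult_left_mono) auto
      thus "\<bar>T a b * c a * c b\<bar> \<le> \<bar>T a b\<bar>" by (simp add: abs_mult mult.assoc)
    qed
    finally show "y \<le> (\<Sum>a<N. \<Sum>b<N. \<bar>T a b\<bar>)" using c by simp
  qed
  have "0 \<in> S" unfolding S_def by (rule CollectI, rule exI[of _ "\<lambda>_. 0"]) (simp add: q_def n2_def)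
  hence K0: "0 \<le> K" unfolding K_def using bdd by (rule cSup_upper)
  have Kq: "\<bar>q c\<bar> \<le> K * n2 c" for c
  proof (cases "n2 c = 0")
    case True
    hence "c a = 0" if "a < N" for a using that by (simp add: n2_def sum_nonneg_eq_0_iff)
    hence "q c = 0" by (simp add: q_def)
    thus ?thesis using True by simp
  next
    case False
    define s where "s = sqrt (n2 c)"
    have s: "s > 0" "s\<^sup>2 = n2 c" using False n20[of c] by (auto simp: s_def less_le)
    have "n2 (\<lambda>a. c a / s) = n2 c / s\<^sup>2" by (simp add: n2_def power_divide sum_divide_distrib)
    hence "n2 (\<lambda>a. c a / s) = 1" using s False by simp
    hence "\<bar>q (\<lambda>a. c a / s)\<bar> \<le> K" unfolding K_def by (intro cSup_upper bdd) (auto simp: S_def)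
    moreover have "q (\<lambda>a. c a / s) = q c / s\<^sup>2" by (simp add: q_def sum_divide_distrib power2_eq_square)
    ultimately have "\<bar>q c\<bar> / s\<^sup>2 \<le> K" by simp
    thus ?thesis using s(1) unfolding s(2)[symmetric] by (simp add: pos_divide_le_eq)
  qed
  have step: "\<bar>q c\<bar> \<le> t + 2 / 7 * K" if c: "n2 c \<le> 1" for c
  proof -
    \<comment> \<open>The mesh \<open>1 / h\<close> makes the rounding error at most \<open>\<surd>N / h = 1 / 7\<close> in norm.\<close>
    define h where "h = 7 * sqrt N"
    have h: "h > 0" "h\<^sup>2 = 49 * N" using N by (simp_all add: h_def power_mult_distrib)
    define z where "z = (\<lambda>a\<in>{..<N}. round_to_zero (h * c a))"
    define c' where "c' a = of_int (z a) / h" for a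
    have c'1: "\<bar>c' a\<bar> \<le> \<bar>c a\<bar>" and c'2: "\<bar>c a - c' a\<bar> \<le> 1 / h" if "a < N" for a
    proof -
      have "\<bar>c' a\<bar> = \<bar>of_int (round_to_zero (h * c a))\<bar> / h" using h that by (simp add: c'_def z_def)
      also have "\<dots> \<le> \<bar>h * c a\<bar> / h" using h by (intro divide_right_mono round_to_zero) auto
      finally show "\<bar>c' a\<bar> \<le> \<bar>c a\<bar>" using h by (simp add: abs_mult)
      have "c a - c' a = (h * c a - of_int (round_to_zero (h * c a))) / h" using h that by (simp add: c'_def z_def field_simps)
      also have "\<bar>\<dots>\<bar> = \<bar>h * c a - of_int (round_to_zero (h * c a))\<bar> / h" using h by simp
      also have "\<dots> \<le> 1 / h" using h by (intro divide_right_mono round_to_zero) auto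
      finally show "\<bar>c a - c' a\<bar> \<le> 1 / h" .
    qed
    have n2c': "n2 c' \<le> 1"
    proof -
      have "n2 c' \<le> n2 c" unfolding n2_def
        by (intro sum_mono iffD1[OF abs_le_square_iff] c'1) simp
      thus ?thesis using c by simp
    qed
    have nd: "n2 (\<lambda>a. c a - c' a) \<le> (1 / 7)\<^sup>2"
    proof -
      have "n2 (\<lambda>a. c a - c' a) \<le> (\<Sum>a<N. (1 / h)\<^sup>2)"
        unfolding n2_def
      proof (intro sum_mono)
        fix a assume "a \<in> {..<N}"
        hence "\<bar>c a - c' a\<bar> \<le> \<bar>1 / h\<bar>" using c'2[of a] h by simp
        thus "(c a - c' a)\<^sup>2 \<le> (1 / h)\<^sup>2" by (simp only: abs_le_square_iff)
      qed
      also have "\<dots> = (1 / 7)\<^sup>2" using N h(2) by (simp add: power_divide)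
      finally show ?thesis .
    qed
    have ns: "n2 (\<lambda>a. c a + c' a) \<le> 4"
    proof -
      have "n2 (\<lambda>a. c a + c' a) \<le> (\<Sum>a<N. 4 * (c a)\<^sup>2)"
        unfolding n2_def
      proof (intro sum_mono)
        fix a assume "a \<in> {..<N}"
        hence "\<bar>c a + c' a\<bar> \<le> \<bar>2 * c a\<bar>" using c'1[of a] by auto
        hence "(c a + c' a)\<^sup>2 \<le> (2 * c a)\<^sup>2" by (simp only: abs_le_square_iff)
        thus "(c a + c' a)\<^sup>2 \<le> 4 * (c a)\<^sup>2" by (simp add: power_mult_distrib)
      qed
      also have "\<dots> = 4 * n2 c" by (simp add: n2_def sum_distrib_left)
      finally show ?thesis using c by simp
    qed
    have "z \<in> int_net N (7 * N)"
    proof -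
      have "(\<Sum>a<N. \<bar>c a\<bar>)\<^sup>2 \<le> (\<Sum>a<N. (\<bar>c a\<bar>)\<^sup>2) * (\<Sum>a<N. 1\<^sup>2)"
        using Cauchy_Schwarz_ineq_sum[of "\<lambda>a. \<bar>c a\<bar>" "\<lambda>_. 1" "{..<N}"] by simp
      also have "\<dots> \<le> N" using c unfolding n2_def by (simp add: mult_left_le_one_le sum_nonneg)
      finally have l1: "(\<Sum>a<N. \<bar>c a\<bar>) \<le> sqrt N" by (rule real_le_rsqrt)
      have "real_of_int (\<Sum>a<N. \<bar>z a\<bar>) = (\<Sum>a<N. \<bar>real_of_int (round_to_zero (h * c a))\<bar>)" by (simp add: z_def)
      also have "\<dots> \<le> (\<Sum>a<N. \<bar>h * c a\<bar>)" by (intro sum_mono round_to_zero)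
      also have "\<dots> = h * (\<Sum>a<N. \<bar>c a\<bar>)" using h by (simp add: abs_mult sum_distrib_left)
      also have "\<dots> \<le> h * sqrt N" using l1 h by (intro mult_left_mono) auto
      also have "\<dots> = real_of_int (int (7 * N))" by (simp add: h_def)
      finally have s: "(\<Sum>a<N. \<bar>z a\<bar>) \<le> int (7 * N)" by (simp only: of_int_le_iff)
      have "\<bar>z a\<bar> \<le> int (7 * N)" if "a < N" for a
      proof -
        have "\<bar>z a\<bar> \<le> (\<Sum>a<N. \<bar>z a\<bar>)" using that by (intro member_le_sum) auto
        thus ?thesis using s by linarith
      qed
      hence "z a \<in> {- int (7 * N)..int (7 * N)}" if "a < N" for a
        using that unfolding atLeastAtMost_iff abs_le_iff by (metis minus_le_iff)
      thus ?thesis using s unfolding int_net_def by (auto simp: z_def PiE_def Pi_def extensional_def)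
    qed
    hence "\<bar>q c'\<bar> \<le> t * n2 c'" unfolding q_def n2_def
      by (rule net) (simp add: c'_def h_def)
    also have "\<dots> \<le> t" using n2c' t by (simp add: mult_left_le)
    finally have qc': "\<bar>q c'\<bar> \<le> t" .
    have "q c - q c' = (\<Sum>a<N. \<Sum>b<N. T a b * (c a - c' a) * (c b + c' b))"
    proof -
      have "(\<Sum>a<N. \<Sum>b<N. T a b * c' a * c b) = (\<Sum>a<N. \<Sum>b<N. T a b * c a * c' b)"
        by (subst sum.swap, intro sum.cong refl, subst sym) (simp only: mult_ac)
      moreover have "(\<Sum>a<N. \<Sum>b<N. T a b * (c a - c' a) * (c b + c' b))
         = (\<Sum>a<N. \<Sum>b<N. T a b * c a * c b - T a b * c' a * c' b + (T a b * c a * c' b - T a b * c' a * c b))"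
        by (intro sum.cong refl) (simp add: algebra_simps)
      ultimately show ?thesis unfolding q_def by (simp only: sum.distrib sum_subtractf)
    qed
    moreover have "\<bar>\<Sum>a<N. \<Sum>b<N. T a b * (c a - c' a) * (c b + c' b)\<bar> \<le> 2 / 7 * K"
      by (rule bilinear_bound[OF sym _ nd[unfolded n2_def] ns[unfolded n2_def] K0])
        (rule Kq[unfolded q_def n2_def])
    ultimately show ?thesis using qc' by linarith
  qed
  have "Sup S \<le> t + 2 / 7 * K"
  proof (rule cSup_least)
    fix y assume "y \<in> S"
    then obtain c where "y = \<bar>q c\<bar>" "n2 c \<le> 1" by (auto simp: S_def)
    thus "y \<le> t + 2 / 7 * K" using step by simp
  qed (use \<open>0 \<in> S\<close> in auto)
  hence "K \<le> t + 2 / 7 * K" by (simp only: K_def)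
  hence "K \<le> 7 / 5 * t" by linarith
  hence "K * n2 c \<le> 7 / 5 * t * n2 c" by (rule mult_right_mono) (rule n20)
  thus ?thesis using Kq[of c] unfolding q_def n2_def by linarith
qed

text \<open>The number \<open>384 = 2 ^ 7 * 3\<close> is the bound of \<open>card_int_net\<close> for \<open>m = 7 N\<close>, per dimension. This is where the constant
\<open>6.9\<close> comes from.\<close>

lemma exp_net_constant: "384 \<le> exp (6.9 :: real)"
proof -
  have "1 + 0.69 + 0.69\<^sup>2 / 2 \<le> exp (0.69 :: real)" by (rule exp_lower_Taylor_quadratic) simp
  hence "1.9 \<le> exp (0.69 :: real)" by (simp add: power2_eq_square)
  have "384 \<le> (1.9 :: real) ^ 10" by (simp add: power_divide)
  also have "\<dots> \<le> exp (0.69 :: real) ^ 10" using \<open>1.9 \<le> exp 0.69\<close> by (intro power_mono) auto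
  also have "\<dots> = exp (6.9 :: real)" by (simp flip: exp_of_nat_mult)
  finally show ?thesis by simp
qed

lemma sum_square_expand:
  fixes f :: "nat \<Rightarrow> 'r \<Rightarrow> 'i \<Rightarrow> real"
  shows "(\<Sum>r\<in>R. \<Sum>i\<in>J. (\<Sum>a<m. c a * f a r i)\<^sup>2)
     = (\<Sum>a<m. \<Sum>b<m. c a * c b * (\<Sum>r\<in>R. \<Sum>i\<in>J. f a r i * f b r i))"
proof -
  let ?g = "\<lambda>a b r i. c a * c b * (f a r i * f b r i)"
  have "(\<Sum>r\<in>R. \<Sum>i\<in>J. (\<Sum>a<m. c a * f a r i)\<^sup>2) = (\<Sum>r\<in>R. \<Sum>i\<in>J. \<Sum>a<m. \<Sum>b<m. ?g a b r i)"
    unfolding power2_eq_square sum_product by (intro sum.cong refl) (simp only: mult_ac)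
  also have "\<dots> = (\<Sum>r\<in>R. \<Sum>a<m. \<Sum>i\<in>J. \<Sum>b<m. ?g a b r i)"
    by (intro sum.cong refl sum.swap)
  also have "\<dots> = (\<Sum>r\<in>R. \<Sum>a<m. \<Sum>b<m. \<Sum>i\<in>J. ?g a b r i)"
    by (intro sum.cong refl sum.swap)
  also have "\<dots> = (\<Sum>a<m. \<Sum>r\<in>R. \<Sum>b<m. \<Sum>i\<in>J. ?g a b r i)"
    by (rule sum.swap)
  also have "\<dots> = (\<Sum>a<m. \<Sum>b<m. \<Sum>r\<in>R. \<Sum>i\<in>J. ?g a b r i)"
    by (intro sum.cong refl sum.swap)
  finally show ?thesis by (simp only: sum_distrib_left)
qed

lemma gram_schmidt_real:
  fixes x :: "nat \<Rightarrow> 'r \<Rightarrow> nat \<Rightarrow> real"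
  assumes R: "finite R"
  shows "\<exists>m w. m \<le> N \<and>
     (\<forall>a<m. \<forall>b<m. (\<Sum>r\<in>R. \<Sum>j<p. w a r j * w b r j) = of_bool (a = b)) \<and>
     (\<forall>c. \<exists>c'. \<forall>r\<in>R. \<forall>j<p. (\<Sum>a<N. c a * x a r j) = (\<Sum>a<m. c' a * w a r j))"
proof -
  let ?I = "R \<times> {..<p}"
  define X where "X a rj = complex_of_real (x a (fst rj) (snd rj))" for a and rj :: "'r \<times> nat"
  have fI: "finite ?I" using R by simp
  have F: "\<real> = UNIV \<or> \<real> = (\<real> :: complex set)" by simp
  have XF: "X a rj \<in> \<real>" for a rj by (simp add: X_def)
  obtain m v where mv: "m \<le> N" "orthonormal ?I m v" "\<And>a i. a < m \<Longrightarrow> i \<in> ?I \<Longrightarrow> v a i \<in> \<real>"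
      "\<And>j i. j < N \<Longrightarrow> i \<in> ?I \<Longrightarrow> X j i = (\<Sum>a<m. cip ?I (v a) (X j) * v a i)"
    using gram_schmidt_subfield[OF fI F, of N X] XF by blast
  define w where "w a r j = Re (v a (r, j))" for a r j
  have vw: "v a (r, j) = of_real (w a r j)" if "a < m" "r \<in> R" "j < p" for a r j
    using mv(3)[of a "(r, j)"] that unfolding w_def by (simp add: complex_is_Real_iff complex_eq_iff)
  have cipw: "cip ?I (v a) f = (\<Sum>r\<in>R. \<Sum>j<p. of_real (w a r j) * f (r, j))" if "a < m" for a f
    unfolding cip_def sum.cartesian_product using that by (intro sum.cong refl) (auto simp: vw)
  have orth: "(\<Sum>r\<in>R. \<Sum>j<p. w a r j * w b r j) = of_bool (a = b)" if "a < m" "b < m" for a b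
  proof -
    have "complex_of_real (\<Sum>r\<in>R. \<Sum>j<p. w a r j * w b r j) = cip ?I (v a) (v b)"
      unfolding cipw[OF that(1)] using that(2) by (simp add: vw)
    also have "\<dots> = of_real (of_bool (a = b))" using mv(2) that by (simp add: orthonormal_def)
    finally show ?thesis using of_real_eq_iff by blast
  qed
  define C where "C a n = (\<Sum>r\<in>R. \<Sum>j<p. w a r j * x n r j)" for a n
  have xw: "x n r j = (\<Sum>a<m. C a n * w a r j)" if "n < N" "r \<in> R" "j < p" for n r j
  proof -
    have "complex_of_real (x n r j) = X n (r, j)" by (simp add: X_def)
    also have "\<dots> = (\<Sum>a<m. cip ?I (v a) (X n) * v a (r, j))" using mv(4)[of n "(r, j)"] that by simp
    also have "\<dots> = (\<Sum>a<m. of_real (C a n) * of_real (w a r j))"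
      using that by (intro sum.cong refl) (simp add: cipw vw C_def X_def)
    finally have "complex_of_real (x n r j) = of_real (\<Sum>a<m. C a n * w a r j)" by simp
    thus ?thesis using of_real_eq_iff by blast
  qed
  have "(\<Sum>n<N. c n * x n r j) = (\<Sum>a<m. (\<Sum>n<N. c n * C a n) * w a r j)" if "r \<in> R" "j < p" for c r j
  proof -
    have "(\<Sum>n<N. c n * x n r j) = (\<Sum>n<N. \<Sum>a<m. c n * C a n * w a r j)"
      using that by (intro sum.cong refl) (simp add: xw sum_distrib_left mult.assoc)
    also have "\<dots> = (\<Sum>a<m. \<Sum>n<N. c n * C a n * w a r j)" by (rule sum.swap)
    finally show ?thesis by (simp add: sum_distrib_right)
  qed
  thus ?thesis using mv(1) orth
    by (intro exI[of _ m] exI[of _ w] conjI allI impI) (auto intro!: exI)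
qed

context prob_space
begin

text \<open>The index set \<open>R\<close> numbers the rows to which the Gaussian matrix is applied from the right. After passing to an
orthonormal basis of the span of \<open>x\<close>, the error is a quadratic form in the coefficients, which is bounded on the
net by a union bound with \<open>t = 5 e / 7\<close> and everywhere by \<open>quadratic_form_net\<close>. As \<open>0.21 t\<^sup>2 \<ge> 2 e\<^sup>2 / 21\<close>, the
exponent is at least \<open>6.9 N + ln (2 / \<delta>)\<close>.\<close>

theorem gaussian_embedding:
  fixes A :: "nat \<times> nat \<Rightarrow> 'a \<Rightarrow> real" and x :: "nat \<Rightarrow> 'r \<Rightarrow> nat \<Rightarrow> real"
  assumes k0: "0 < k"
    and indep: "indep_vars (\<lambda>_. borel) A ({..<k} \<times> {..<p})"
    and normal: "\<And>ij. ij \<in> {..<k} \<times> {..<p} \<Longrightarrow> distributed M lborel (A ij) (normal_density 0 (1 / sqrt k))"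
    and R: "finite R" and e: "0 < e" "e \<le> 1 / 4" and \<delta>: "0 < \<delta>" "\<delta> \<le> 1"
    and k: "21 / 2 / e\<^sup>2 * (6.9 * N + ln (2 / \<delta>)) \<le> k"
  shows "\<exists>B\<in>sets M. prob B \<le> \<delta> \<and> (\<forall>\<omega>\<in>space M - B. \<forall>c.
     \<bar>(\<Sum>r\<in>R. \<Sum>i<k. (\<Sum>j<p. (\<Sum>a<N. c a * x a r j) * A (i, j) \<omega>)\<^sup>2) - (\<Sum>r\<in>R. \<Sum>j<p. (\<Sum>a<N. c a * x a r j)\<^sup>2)\<bar>
       \<le> e * (\<Sum>r\<in>R. \<Sum>j<p. (\<Sum>a<N. c a * x a r j)\<^sup>2))"
proof -
  have Am: "A ij \<in> borel_measurable M" if "ij \<in> {..<k} \<times> {..<p}" for ij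
    using indep that by (auto simp: indep_vars_def)
  obtain m w where m: "m \<le> N"
    and orth: "\<And>a b. a < m \<Longrightarrow> b < m \<Longrightarrow> (\<Sum>r\<in>R. \<Sum>j<p. w a r j * w b r j) = of_bool (a = b)"
    and span: "\<And>c. \<exists>c'. \<forall>r\<in>R. \<forall>j<p. (\<Sum>a<N. c a * x a r j) = (\<Sum>a<m. c' a * w a r j)"
    using gram_schmidt_real[OF R, of N p x] by blast
  define Z where "Z c r j = (\<Sum>a<m. c a * w a r j)" for c r j
  define V where "V z \<omega> = (\<Sum>r\<in>R. \<Sum>i<k. (\<Sum>j<p. z r j * A (i, j) \<omega>)\<^sup>2)" for z \<omega>
  define n2 where "n2 z = (\<Sum>r\<in>R. \<Sum>j<p. (z r j)\<^sup>2)" for z :: "'r \<Rightarrow> nat \<Rightarrow> real"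
  have Vm [measurable]: "V z \<in> borel_measurable M" for z
    unfolding V_def by (intro borel_measurable_sum borel_measurable_power borel_measurable_times Am) auto
  have n2Z: "n2 (Z c) = (\<Sum>a<m. (c a)\<^sup>2)" for c
  proof -
    have "n2 (Z c) = (\<Sum>a<m. \<Sum>b<m. c a * c b * (\<Sum>r\<in>R. \<Sum>j<p. w a r j * w b r j))"
      unfolding n2_def Z_def by (rule sum_square_expand)
    also have "\<dots> = (\<Sum>a<m. \<Sum>b<m. if a = b then c a * c b else 0)"
      by (intro sum.cong refl) (simp add: orth)
    finally show ?thesis by (simp add: power2_eq_square)
  qed
  have reduce: "\<exists>B\<in>sets M. prob B \<le> \<delta> \<and> (\<forall>\<omega>\<in>space M - B. \<forall>c. \<bar>V (Z c) \<omega> - n2 (Z c)\<bar> \<le> e * n2 (Z c))"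
  proof (cases "m = 0")
    case True
    hence "V (Z c) \<omega> = 0" "n2 (Z c) = 0" for c \<omega> by (simp_all add: V_def n2_def Z_def)
    thus ?thesis using \<delta> by (intro bexI[of _ "{}"]) auto
  next
    case False
    hence m0: "0 < m" by simp
    define t where "t = 5 / 7 * e"
    have t: "0 < t" "t \<le> 5 / 28" using e by (simp_all add: t_def)
    define u where "u z a = of_int (z a) / (7 * sqrt m)" for z :: "nat \<Rightarrow> int" and a :: nat
    define E where "E z = {\<omega>\<in>space M. t * n2 (Z (u z)) < \<bar>V (Z (u z)) \<omega> - n2 (Z (u z))\<bar>}" for z
    have Em: "E z \<in> sets M" for z unfolding E_def by measurable
    have EP: "prob (E z) \<le> 2 * exp (- 21 / 100 * t\<^sup>2 * k)" for z
    proof (cases "n2 (Z (u z)) = 0")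
      case True
      hence z0: "Z (u z) r j = 0" if "r \<in> R" "j < p" for r j
        using that R unfolding n2_def by (simp add: sum_nonneg_eq_0_iff sum_nonneg)
      have "V (Z (u z)) \<omega> = 0" for \<omega> unfolding V_def by (intro sum.neutral ballI) (simp add: z0)
      hence "E z = {}" using True by (simp add: E_def)
      thus ?thesis by simp
    next
      case False
      define s where "s = sqrt (n2 (Z (u z)))"
      have n0: "0 \<le> n2 (Z (u z))" by (simp add: n2_def sum_nonneg)
      have s: "s > 0" "s\<^sup>2 = n2 (Z (u z))" using False n0 by (auto simp: s_def less_le)
      define z' where "z' r j = Z (u z) r j / s" for r j
      have 1: "(\<Sum>r\<in>R. \<Sum>j<p. (z' r j)\<^sup>2) = 1"
      proof -
        have "(\<Sum>r\<in>R. \<Sum>j<p. (z' r j)\<^sup>2) = n2 (Z (u z)) / s\<^sup>2"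
          by (simp add: z'_def power_divide n2_def sum_divide_distrib)
        thus ?thesis using s False by simp
      qed
      have 2: "V z' \<omega> = V (Z (u z)) \<omega> / s\<^sup>2" for \<omega>
        by (simp add: V_def z'_def power_divide sum_divide_distrib flip: sum_divide_distrib)
      have "E z \<subseteq> {\<omega>\<in>space M. t \<le> \<bar>V z' \<omega> - 1\<bar>}"
      proof
        fix \<omega> assume "\<omega> \<in> E z"
        hence \<omega>: "\<omega> \<in> space M" "t * s\<^sup>2 < \<bar>V (Z (u z)) \<omega> - s\<^sup>2\<bar>" by (auto simp: E_def s(2))
        have "V z' \<omega> - 1 = (V (Z (u z)) \<omega> - s\<^sup>2) / s\<^sup>2" using s(1) by (simp add: 2 diff_divide_distrib)
        hence "\<bar>V z' \<omega> - 1\<bar> = \<bar>V (Z (u z)) \<omega> - s\<^sup>2\<bar> / s\<^sup>2" by simp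
        thus "\<omega> \<in> {\<omega>\<in>space M. t \<le> \<bar>V z' \<omega> - 1\<bar>}" using \<omega> s(1) by (simp add: pos_le_divide_eq)
      qed
      hence "prob (E z) \<le> prob {\<omega>\<in>space M. t \<le> \<bar>V z' \<omega> - 1\<bar>}"
        by (intro finite_measure_mono) measurable
      also have "\<dots> \<le> 2 * exp (- 21 / 100 * t\<^sup>2 * k)"
        unfolding V_def by (rule gaussian_deviation[OF k0 t indep normal R 1])
      finally show ?thesis .
    qed
    define B where "B = (\<Union>z\<in>int_net m (7 * m). E z)"
    have Bm: "B \<in> sets M" unfolding B_def using finite_int_net Em by (intro sets.finite_UN) auto
    have "prob B \<le> (\<Sum>z\<in>int_net m (7 * m). prob (E z))"
      unfolding B_def using finite_int_net Em by (intro finite_measure_subadditive_finite) auto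
    also have "\<dots> \<le> (\<Sum>z\<in>int_net m (7 * m). 2 * exp (- 21 / 100 * t\<^sup>2 * k))"
      by (intro sum_mono EP)
    also have "\<dots> = real (card (int_net m (7 * m))) * (2 * exp (- 21 / 100 * t\<^sup>2 * k))" by simp
    also have "\<dots> \<le> (2 ^ (7 * m) * 3 ^ m) * (2 * exp (- (6.9 * N + ln (2 / \<delta>))))"
    proof (rule mult_mono[OF card_int_net])
      define L where "L = 6.9 * N + ln (2 / \<delta>)"
      have L: "0 \<le> L" using \<delta> by (simp add: L_def)
      have "21 / 2 * L \<le> e\<^sup>2 * k" using k e unfolding L_def[symmetric] by (simp add: field_simps)
      moreover have "21 / 100 * t\<^sup>2 * k = 3 / 28 * (e\<^sup>2 * k)" by (simp add: t_def power2_eq_square)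
      ultimately have "L \<le> 21 / 100 * t\<^sup>2 * k" using L by linarith
      hence "- 21 / 100 * t\<^sup>2 * k \<le> - (6.9 * N + ln (2 / \<delta>))" unfolding L_def by linarith
      thus "2 * exp (- 21 / 100 * t\<^sup>2 * k) \<le> 2 * exp (- (6.9 * N + ln (2 / \<delta>)))"
        by (intro mult_left_mono iffD2[OF exp_le_cancel_iff]) auto
    qed auto
    also have "\<dots> = 384 ^ m * exp (- 6.9 * N) * \<delta>"
    proof -
      have "exp (- (6.9 * N + ln (2 / \<delta>))) = exp (- 6.9 * N) * exp (- ln (2 / \<delta>))"
        by (simp flip: exp_add)
      also have "exp (- ln (2 / \<delta>)) = \<delta> / 2" using \<delta> by (simp add: exp_minus)
      finally have 1: "exp (- (6.9 * N + ln (2 / \<delta>))) = exp (- 6.9 * N) * (\<delta> / 2)" .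
      have 2: "(2 :: real) ^ (7 * m) * 3 ^ m = 384 ^ m" by (simp add: power_mult flip: power_mult_distrib)
      show ?thesis unfolding 1 2 by simp
    qed
    also have "\<dots> \<le> 1 * \<delta>"
    proof (intro mult_right_mono)
      have "(384 :: real) ^ m \<le> 384 ^ N" using m by (intro power_increasing) auto
      also have "\<dots> \<le> exp 6.9 ^ N" by (intro power_mono exp_net_constant) simp
      also have "\<dots> = exp (6.9 * N)" by (simp add: mult.commute flip: exp_of_nat_mult)
      finally show "384 ^ m * exp (- 6.9 * N) \<le> 1" by (simp add: exp_minus field_simps)
    qed (use \<delta> in auto)
    finally have PB: "prob B \<le> \<delta>" by simp
    have "\<bar>V (Z c) \<omega> - n2 (Z c)\<bar> \<le> e * n2 (Z c)" if \<omega>: "\<omega> \<in> space M - B" for \<omega> c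
    proof -
      define g where "g a r i = (\<Sum>j<p. w a r j * A (i, j) \<omega>)" for a r i
      define T where "T a b = (\<Sum>r\<in>R. \<Sum>i<k. g a r i * g b r i) - of_bool (a = b)" for a b
      have sym: "T a b = T b a" for a b
        by (cases "a = b") (simp_all add: T_def mult.commute)
      have VT: "V (Z c) \<omega> - n2 (Z c) = (\<Sum>a<m. \<Sum>b<m. T a b * c a * c b)" for c
      proof -
        have gz: "(\<Sum>j<p. Z c r j * A (i, j) \<omega>) = (\<Sum>a<m. c a * g a r i)" for r i
        proof -
          have "(\<Sum>j<p. Z c r j * A (i, j) \<omega>) = (\<Sum>j<p. \<Sum>a<m. c a * (w a r j * A (i, j) \<omega>))"
            by (simp add: Z_def sum_distrib_right mult.assoc)
          also have "\<dots> = (\<Sum>a<m. \<Sum>j<p. c a * (w a r j * A (i, j) \<omega>))" by (rule sum.swap)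
          finally show ?thesis by (simp add: g_def sum_distrib_left)
        qed
        have 1: "V (Z c) \<omega> = (\<Sum>a<m. \<Sum>b<m. c a * c b * (\<Sum>r\<in>R. \<Sum>i<k. g a r i * g b r i))"
          unfolding V_def gz by (rule sum_square_expand)
        have "n2 (Z c) = (\<Sum>a<m. \<Sum>b<m. if a = b then c a * c b else 0)"
          by (simp add: n2Z power2_eq_square)
        also have "\<dots> = (\<Sum>a<m. \<Sum>b<m. c a * c b * of_bool (a = b))" by (intro sum.cong refl) simp
        finally have 2: "n2 (Z c) = (\<Sum>a<m. \<Sum>b<m. c a * c b * of_bool (a = b))" .
        show ?thesis unfolding 1 2 sum_subtractf[symmetric] T_def
          by (intro sum.cong refl) (simp only: right_diff_distrib left_diff_distrib mult_ac)
      qed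
      have "\<bar>\<Sum>a<m. \<Sum>b<m. T a b * c a * c b\<bar> \<le> 7 / 5 * t * (\<Sum>a<m. (c a)\<^sup>2)"
      proof (rule quadratic_form_net[OF sym m0])
        fix z c assume z: "z \<in> int_net m (7 * m)" and "\<And>a. c a = real_of_int (z a) / (7 * sqrt m)"
        hence c: "c = u z" by (auto simp: u_def)
        have "\<omega> \<notin> E z" using \<omega> z by (auto simp: B_def)
        hence "\<bar>V (Z c) \<omega> - n2 (Z c)\<bar> \<le> t * n2 (Z c)" using \<omega> by (simp add: E_def c not_less)
        hence "\<bar>\<Sum>a<m. \<Sum>b<m. T a b * c a * c b\<bar> \<le> t * n2 (Z c)" by (simp only: VT)
        thus "\<bar>\<Sum>a<m. \<Sum>b<m. T a b * c a * c b\<bar> \<le> t * (\<Sum>a<m. (c a)\<^sup>2)" by (simp only: n2Z)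
      qed (use t in simp)
      also have "7 / 5 * t = e" by (simp add: t_def)
      finally show ?thesis unfolding VT unfolding n2Z .
    qed
    thus ?thesis using Bm PB by blast
  qed
  then obtain B where B: "B \<in> sets M" "prob B \<le> \<delta>"
     "\<And>\<omega> c. \<omega> \<in> space M - B \<Longrightarrow> \<bar>V (Z c) \<omega> - n2 (Z c)\<bar> \<le> e * n2 (Z c)" by blast
  have "\<bar>(\<Sum>r\<in>R. \<Sum>i<k. (\<Sum>j<p. (\<Sum>a<N. c a * x a r j) * A (i, j) \<omega>)\<^sup>2) - (\<Sum>r\<in>R. \<Sum>j<p. (\<Sum>a<N. c a * x a r j)\<^sup>2)\<bar>
       \<le> e * (\<Sum>r\<in>R. \<Sum>j<p. (\<Sum>a<N. c a * x a r j)\<^sup>2)" if \<omega>: "\<omega> \<in> space M - B" for \<omega> c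
  proof -
    obtain c' where c': "\<And>r j. r \<in> R \<Longrightarrow> j < p \<Longrightarrow> (\<Sum>a<N. c a * x a r j) = Z c' r j"
      using span[of c] unfolding Z_def by blast
    have "(\<Sum>r\<in>R. \<Sum>i<k. (\<Sum>j<p. (\<Sum>a<N. c a * x a r j) * A (i, j) \<omega>)\<^sup>2) = V (Z c') \<omega>"
      unfolding V_def by (intro sum.cong refl arg_cong[of _ _ "\<lambda>y. y\<^sup>2"]) (simp add: c')
    moreover have "(\<Sum>r\<in>R. \<Sum>j<p. (\<Sum>a<N. c a * x a r j)\<^sup>2) = n2 (Z c')"
      unfolding n2_def by (intro sum.cong refl) (simp add: c')
    ultimately show ?thesis using B(3)[OF \<omega>, of c'] by simp
  qed
  thus ?thesis using B(1,2) by blast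
qed

end

section \<open>Composing the three random maps\<close>

lemma space_borel_mat: "space (borel_mat k n) = carrier_mat k n"
  by (simp add: borel_mat_def)

lemma borel_mat_entry:
  assumes "i < k" "j < n"
  shows "(\<lambda>A. A $$ (i, j)) \<in> borel_measurable (borel_mat k n)"
proof -
  let ?I = "{..<k} \<times> {..<n}"
  have "(\<lambda>A. \<lambda>ij\<in>?I. A $$ ij) \<in> borel_mat k n \<rightarrow>\<^sub>M PiM ?I (\<lambda>_. borel)"
    unfolding borel_mat_def by (rule measurable_vimage_algebra1) (auto simp: space_PiM)
  moreover have "(\<lambda>f. f (i, j)) \<in> PiM ?I (\<lambda>_. borel :: real measure) \<rightarrow>\<^sub>M borel"
    by (rule measurable_component_singleton) (use assms in auto)
  ultimately have "(\<lambda>f. f (i, j)) \<circ> (\<lambda>A. \<lambda>ij\<in>?I. A $$ ij) \<in> borel_mat k n \<rightarrow>\<^sub>M borel"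
    by (rule measurable_comp)
  thus ?thesis using assms by (simp add: comp_def)
qed

lemma entry_measurable:
  assumes "A \<in> N \<rightarrow>\<^sub>M borel_mat k n" "i < k" "j < n"
  shows "(\<lambda>x. A x $$ (i, j)) \<in> borel_measurable N"
  using measurable_comp[OF assms(1) borel_mat_entry[OF assms(2,3)]] by (simp add: comp_def)

text \<open>By continuity the condition for all \<open>c\<close> follows from the condition on a countable dense set. This makes the
events that quantify over a whole subspace measurable.\<close>

lemma sets_Collect_all_continuous:
  fixes f :: "'x \<Rightarrow> 'c :: second_countable_topology \<Rightarrow> real"
  assumes cont: "\<And>x. x \<in> space N \<Longrightarrow> continuous_on UNIV (f x)"
    and meas: "\<And>c. (\<lambda>x. f x c) \<in> borel_measurable N"
  shows "{x\<in>space N. \<forall>c. f x c \<le> 0} \<in> sets N"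
proof -
  obtain D :: "'c set" where D: "countable D" "\<And>U. open U \<Longrightarrow> U \<noteq> {} \<Longrightarrow> \<exists>c\<in>D. c \<in> U"
    using countable_dense_exists by blast
  have "(\<forall>c. f x c \<le> 0) \<longleftrightarrow> (\<forall>c\<in>D. f x c \<le> 0)" if x: "x \<in> space N" for x
  proof
    assume all: "\<forall>c\<in>D. f x c \<le> 0"
    show "\<forall>c. f x c \<le> 0"
    proof (rule ccontr)
      assume "\<not> (\<forall>c. f x c \<le> 0)"
      hence "{c. 0 < f x c} \<noteq> {}" by (auto simp: not_le)
      moreover have "open {c. 0 < f x c}"
        using cont[OF x] by (intro open_Collect_less continuous_on_const)
      ultimately obtain c where "c \<in> D" "0 < f x c" using D(2) by blast
      thus False using all by force
    qed
  qed blast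
  moreover have "D \<noteq> {}" using D(2)[OF open_UNIV] by blast
  ultimately have "{x\<in>space N. \<forall>c. f x c \<le> 0} = (\<Inter>c\<in>D. {x\<in>space N. f x c \<le> 0})" by blast
  also have "\<dots> \<in> sets N"
  proof (rule sets.countable_INT'[OF D(1) \<open>D \<noteq> {}\<close>])
    have "{x\<in>space N. f x c \<le> 0} \<in> sets N" for c using meas[of c] by measurable
    thus "(\<lambda>c. {x\<in>space N. f x c \<le> 0}) ` D \<subseteq> sets N" by blast
  qed
  finally show ?thesis .
qed

lemma preserves_all_measurable:
  fixes d :: nat and z :: "'x \<Rightarrow> nat \<Rightarrow> nat \<Rightarrow> complex"
  assumes A: "\<And>i j. i < k \<Longrightarrow> j < n \<Longrightarrow> (\<lambda>x. A x $$ (i, j)) \<in> borel_measurable N"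
    and z: "\<And>a j. a < d \<Longrightarrow> j < n \<Longrightarrow> (\<lambda>x. z x a j) \<in> borel_measurable N"
  shows "{x\<in>space N. \<forall>c. preserves e k n (A x) (\<lambda>j. \<Sum>a<d. c a * z x a j)} \<in> sets N"
proof -
  let ?f = "\<lambda>x c. \<bar>sqn {..<k} (mat_apply n (A x) (\<lambda>j. \<Sum>a<d. c a * z x a j)) - sqn {..<n} (\<lambda>j. \<Sum>a<d. c a * z x a j)\<bar>
      - e * sqn {..<n} (\<lambda>j. \<Sum>a<d. c a * z x a j)"
  have cc: "continuous_on UNIV (\<lambda>c :: nat \<Rightarrow> complex. c i)" for i
    by (rule continuous_on_product_coordinates)
  have m1: "(\<lambda>x. \<Sum>a<d. c a * z x a j) \<in> borel_measurable N" if "j < n" for c j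
    using that by (intro borel_measurable_sum borel_measurable_times borel_measurable_const z) auto
  have m2: "(\<lambda>x. mat_apply n (A x) (\<lambda>j. \<Sum>a<d. c a * z x a j) i) \<in> borel_measurable N" if "i < k" for c i
    unfolding mat_apply_def
  proof (intro borel_measurable_sum borel_measurable_times[OF _ m1])
    fix j assume "j \<in> {..<n}"
    hence "(\<lambda>x. A x $$ (i, j)) \<in> borel_measurable N" using A that by simp
    thus "(\<lambda>x. complex_of_real (A x $$ (i, j))) \<in> borel_measurable N" by measurable
    show "j < n" using \<open>j \<in> {..<n}\<close> by simp
  qed
  have nm: "(\<lambda>x. cmod (g x)) \<in> borel_measurable N" if "g \<in> borel_measurable N" for g
    using that by measurable
  have "{x\<in>space N. \<forall>c. ?f x c \<le> 0} \<in> sets N"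
  proof (rule sets_Collect_all_continuous)
    show "continuous_on UNIV (?f x)" for x
      unfolding sqn_def mat_apply_def by (intro continuous_intros cc)
    show "(\<lambda>x. ?f x c) \<in> borel_measurable N" for c
      unfolding sqn_def
      by (intro borel_measurable_diff borel_measurable_times borel_measurable_const borel_measurable_abs
          borel_measurable_sum borel_measurable_power nm m1 m2) auto
  qed
  thus ?thesis unfolding preserves_def by simp
qed

text \<open>The bound for the explicit model carries over to every random matrix with the same law.\<close>

lemma psrht_law_embedding:
  fixes d :: nat and z :: "nat \<Rightarrow> nat \<Rightarrow> complex"
  assumes G: "psrht M k n G" and n: "0 < n" and k0: "0 < k"
    and e: "0 < e" "e < 1" and \<delta>: "0 < \<delta>" "\<delta> < 1" and d: "0 < d"
    and k: "2 * ((sqrt d + sqrt (8 * ln (6 * real n / \<delta>)))\<^sup>2 / (e\<^sup>2 - e ^ 3 / 3)) * ln (3 * real d / \<delta>) \<le> k"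
    and B: "B \<in> sets (borel_mat k n)"
      "\<And>A. A \<in> B \<Longrightarrow> \<not> (\<forall>c. preserves e k n A (\<lambda>j. \<Sum>a<d. c a * z a j))"
  shows "measure (distr M (borel_mat k n) G) B \<le> \<delta>"
proof -
  obtain m where m: "n \<le> 2 ^ m" "2 ^ m < 2 * n" "k \<le> 2 ^ m"
    and law: "distr M (borel_mat k n) G = distr (measure_pmf (psrht_pmf m)) (borel_mat k n) (\<lambda>(\<pi>, \<sigma>). psrht_mat k n m \<pi> \<sigma>)"
    using G unfolding psrht_def psrht_pmf_def by blast
  have meas: "(\<lambda>(\<pi>, \<sigma>). psrht_mat k n m \<pi> \<sigma>) \<in> measure_pmf (psrht_pmf m) \<rightarrow>\<^sub>M borel_mat k n"
    by (auto simp: space_borel_mat psrht_mat_carrier)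
  have "measure (distr M (borel_mat k n) G) B
     = measure_pmf.prob (psrht_pmf m) ((\<lambda>(\<pi>, \<sigma>). psrht_mat k n m \<pi> \<sigma>) -` B)"
    unfolding law by (subst measure_distr[OF meas B(1)]) simp
  also have "\<dots> \<le> measure_pmf.prob (psrht_pmf m)
     {(\<pi>, \<sigma>). \<not> (\<forall>c. preserves e k n (psrht_mat k n m \<pi> \<sigma>) (\<lambda>j. \<Sum>a<d. c a * z a j))}"
  proof (rule measure_pmf.finite_measure_mono)
    show "(\<lambda>(\<pi>, \<sigma>). psrht_mat k n m \<pi> \<sigma>) -` B \<subseteq>
      {(\<pi>, \<sigma>). \<not> (\<forall>c. preserves e k n (psrht_mat k n m \<pi> \<sigma>) (\<lambda>j. \<Sum>a<d. c a * z a j))}"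
      using B(2) by auto
  qed simp
  also have "\<dots> \<le> \<delta>" by (rule psrht_pmf_embedding[OF m(1,2) k0 m(3) e \<delta> d k])
  finally show ?thesis .
qed

context prob_space
begin

text \<open>Fubini's theorem: if every section of an event has small probability under the law of \<open>Y\<close>, so has the event under
the joint law of independent \<open>X\<close> and \<open>Y\<close>.\<close>

lemma prob_indep_section_le:
  assumes ind: "indep_var N1 X N2 Y" and B: "B \<in> sets (N1 \<Otimes>\<^sub>M N2)"
    and le: "\<And>x. x \<in> space N1 \<Longrightarrow> measure (distr M N2 Y) (Pair x -` B) \<le> c" and c: "0 \<le> c"
  shows "prob {\<omega>\<in>space M. (X \<omega>, Y \<omega>) \<in> B} \<le> c"
proof -
  have rv: "X \<in> M \<rightarrow>\<^sub>M N1" "Y \<in> M \<rightarrow>\<^sub>M N2"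
    and eq: "distr M N1 X \<Otimes>\<^sub>M distr M N2 Y = distr M (N1 \<Otimes>\<^sub>M N2) (\<lambda>\<omega>. (X \<omega>, Y \<omega>))"
    using ind unfolding indep_var_distribution_eq by auto
  interpret P1: prob_space "distr M N1 X" by (rule prob_space_distr[OF rv(1)])
  interpret P2: prob_space "distr M N2 Y" by (rule prob_space_distr[OF rv(2)])
  have XY: "(\<lambda>\<omega>. (X \<omega>, Y \<omega>)) \<in> M \<rightarrow>\<^sub>M N1 \<Otimes>\<^sub>M N2" using rv by (rule measurable_Pair)
  have B': "B \<in> sets (distr M N1 X \<Otimes>\<^sub>M distr M N2 Y)" using B unfolding eq by simp
  have "emeasure M {\<omega>\<in>space M. (X \<omega>, Y \<omega>) \<in> B} = emeasure (distr M (N1 \<Otimes>\<^sub>M N2) (\<lambda>\<omega>. (X \<omega>, Y \<omega>))) B"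
    by (subst emeasure_distr[OF XY B]) (auto intro!: arg_cong[of _ _ "emeasure M"])
  also have "\<dots> = (\<integral>\<^sup>+x. emeasure (distr M N2 Y) (Pair x -` B) \<partial>distr M N1 X)"
    unfolding eq[symmetric] by (rule P2.emeasure_pair_measure_alt[OF B'])
  also have "\<dots> \<le> (\<integral>\<^sup>+x. ennreal c \<partial>distr M N1 X)"
    by (intro nn_integral_mono) (simp add: P2.emeasure_eq_measure le ennreal_leI)
  also have "\<dots> = ennreal c" using P1.emeasure_space_1 by simp
  finally show ?thesis using c by (simp add: emeasure_eq_measure)
qed

text \<open>The family \<open>z\<close> that is embedded may depend on the matrices with indices in \<open>A\<close>, which are independent of the SRHT
matrix with index \<open>b\<close>. Conditionally on the former it is fixed.\<close>

lemma psrht_stage: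
  fixes d :: nat and z :: "('i \<Rightarrow> real mat) \<Rightarrow> nat \<Rightarrow> nat \<Rightarrow> complex" and F :: "'i \<Rightarrow> 'a \<Rightarrow> real mat"
  assumes ind: "indep_vars M' F J" and J: "A \<subseteq> J" "b \<in> J" "b \<notin> A" and Mb: "M' b = borel_mat k n"
    and G: "psrht M k n (F b)" and n: "0 < n" and k0: "0 < k"
    and e: "0 < e" "e < 1" and \<delta>: "0 < \<delta>" "\<delta> < 1" and d: "0 < d"
    and k: "2 * ((sqrt d + sqrt (8 * ln (6 * real n / \<delta>)))\<^sup>2 / (e\<^sup>2 - e ^ 3 / 3)) * ln (3 * real d / \<delta>) \<le> k"
    and z: "\<And>a j. a < d \<Longrightarrow> j < n \<Longrightarrow> (\<lambda>x. z x a j) \<in> borel_measurable (PiM A M')"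
  shows "\<exists>B\<in>sets M. prob B \<le> \<delta> \<and>
    (\<forall>\<omega>\<in>space M - B. \<forall>c. preserves e k n (F b \<omega>) (\<lambda>j. \<Sum>a<d. c a * z (\<lambda>i\<in>A. F i \<omega>) a j))"
proof -
  define X where "X \<omega> = (\<lambda>i\<in>A. F i \<omega>)" for \<omega>
  define Y where "Y \<omega> = (\<lambda>i\<in>{b}. F i \<omega>)" for \<omega>
  define N where "N = PiM A M'"
  define N2 where "N2 = PiM {b} M'"
  have XY: "indep_var N X N2 Y"
    unfolding N_def X_def[abs_def] N2_def Y_def[abs_def] by (rule indep_var_restrict[OF ind]) (use J in auto)
  have rv: "X \<in> M \<rightarrow>\<^sub>M N" "Y \<in> M \<rightarrow>\<^sub>M N2"
    using XY unfolding indep_var_distribution_eq by auto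
  have Yb: "Y \<omega> b = F b \<omega>" for \<omega> by (simp add: Y_def)
  have comp: "(\<lambda>f. f b) \<in> N2 \<rightarrow>\<^sub>M borel_mat k n"
    unfolding N2_def Mb[symmetric] by (rule measurable_component_singleton) simp
  have rF: "F b \<in> M \<rightarrow>\<^sub>M borel_mat k n"
    using measurable_comp[OF rv(2) comp] by (simp add: comp_def Yb)
  define Q where "Q = {y\<in>space (N \<Otimes>\<^sub>M N2). \<forall>c. preserves e k n (snd y b) (\<lambda>j. \<Sum>a<d. c a * z (fst y) a j)}"
  have Q: "Q \<in> sets (N \<Otimes>\<^sub>M N2)" unfolding Q_def
  proof (rule preserves_all_measurable)
    show "(\<lambda>y. snd y b $$ (i, j)) \<in> borel_measurable (N \<Otimes>\<^sub>M N2)" if "i < k" "j < n" for i j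
      using measurable_comp[OF measurable_comp[OF measurable_snd comp] borel_mat_entry[OF that]] by (simp add: comp_def)
    show "(\<lambda>y. z (fst y) a j) \<in> borel_measurable (N \<Otimes>\<^sub>M N2)" if "a < d" "j < n" for a j
      using measurable_comp[OF measurable_fst z[OF that, folded N_def]] by (simp add: comp_def)
  qed
  \<comment> \<open>the pairs for which the current matrix fails on the family produced by the previous ones\<close>
  define C where "C = space (N \<Otimes>\<^sub>M N2) - Q"
  have C: "C \<in> sets (N \<Otimes>\<^sub>M N2)" unfolding C_def using Q by auto
  define B where "B = {\<omega>\<in>space M. (X \<omega>, Y \<omega>) \<in> C}"
  have pair: "(\<lambda>\<omega>. (X \<omega>, Y \<omega>)) \<in> M \<rightarrow>\<^sub>M N \<Otimes>\<^sub>M N2" using rv by (rule measurable_Pair)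
  have "B = (\<lambda>\<omega>. (X \<omega>, Y \<omega>)) -` C \<inter> space M" by (auto simp: B_def)
  hence "B \<in> sets M" using measurable_sets[OF pair C] by simp
  moreover have "prob B \<le> \<delta>" unfolding B_def
  proof (rule prob_indep_section_le[OF XY C])
    fix x assume x: "x \<in> space N"
    define D where "D = {A\<in>space (borel_mat k n). \<not> (\<forall>c. preserves e k n A (\<lambda>j. \<Sum>a<d. c a * z x a j))}"
    have D: "D \<in> sets (borel_mat k n)"
    proof -
      have "{A\<in>space (borel_mat k n). \<forall>c. preserves e k n A (\<lambda>j. \<Sum>a<d. c a * z x a j)} \<in> sets (borel_mat k n)"
        by (rule preserves_all_measurable[OF borel_mat_entry borel_measurable_const])
      moreover have "D = space (borel_mat k n) - {A\<in>space (borel_mat k n). \<forall>c. preserves e k n A (\<lambda>j. \<Sum>a<d. c a * z x a j)}"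
        by (auto simp: D_def)
      ultimately show ?thesis by auto
    qed
    have S: "Pair x -` C \<in> sets N2" by (rule sets_Pair1[OF C])
    have "measure (distr M N2 Y) (Pair x -` C) = prob (Y -` (Pair x -` C) \<inter> space M)"
      by (rule measure_distr[OF rv(2) S])
    also have "Y -` (Pair x -` C) \<inter> space M = F b -` D \<inter> space M"
      using x measurable_space[OF rv(2)] measurable_space[OF rF]
      by (auto simp: C_def Q_def D_def space_pair_measure Yb)
    also have "prob \<dots> = measure (distr M (borel_mat k n) (F b)) D"
      by (rule measure_distr[OF rF D, symmetric])
    also have "\<dots> \<le> \<delta>"
      by (rule psrht_law_embedding[OF G n k0 e \<delta> d k D, of "z x"]) (simp add: D_def)
    finally show "measure (distr M N2 Y) (Pair x -` C) \<le> \<delta>" .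
  qed (use \<delta> in simp)
  moreover have "preserves e k n (F b \<omega>) (\<lambda>j. \<Sum>a<d. c a * z (\<lambda>i\<in>A. F i \<omega>) a j)" if "\<omega> \<in> space M - B" for \<omega> c
  proof -
    have "(X \<omega>, Y \<omega>) \<in> space (N \<Otimes>\<^sub>M N2)" using measurable_space[OF pair] that by auto
    hence "(X \<omega>, Y \<omega>) \<in> Q" using that by (auto simp: B_def C_def)
    thus ?thesis by (auto simp: Q_def Yb X_def)
  qed
  ultimately show ?thesis by blast
qed

end

text \<open>Matrices with complex entries are functions on pairs of indices, and \<open>\<Omega> Y\<close> is produced directly in vectorized form:
position \<open>t\<close> of the vector is row \<open>t mod kO\<close> of column \<open>t div kO\<close>.\<close>

definition right_mult :: "nat \<Rightarrow> real mat \<Rightarrow> (nat \<times> nat \<Rightarrow> complex) \<Rightarrow> nat \<times> nat \<Rightarrow> complex" where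
  "right_mult p S X = (\<lambda>(r, l). \<Sum>j<p. X (r, j) * of_real (S $$ (l, j)))"

definition left_mult_vec :: "nat \<Rightarrow> nat \<Rightarrow> real mat \<Rightarrow> (nat \<times> nat \<Rightarrow> complex) \<Rightarrow> nat \<Rightarrow> complex" where
  "left_mult_vec q kO Om Y t = mat_apply q Om (\<lambda>r. Y (r, t div kO)) (t mod kO)"

definition upsilon :: "nat \<Rightarrow> nat \<Rightarrow> nat \<Rightarrow> nat \<Rightarrow> real mat \<Rightarrow> real mat \<Rightarrow> real mat \<Rightarrow> (nat \<times> nat \<Rightarrow> complex) \<Rightarrow> nat \<Rightarrow> complex" where
  "upsilon q p kO kS G Om S X = mat_apply (kS * kO) G (left_mult_vec q kO Om (right_mult p S X))"

lemma mat_apply_sum: "mat_apply n A (\<lambda>j. \<Sum>a<d. c a * f a j) i = (\<Sum>a<d. c a * mat_apply n A (f a) i)"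
  unfolding mat_apply_def sum_distrib_left by (subst sum.swap) (simp add: mult_ac)

lemma right_mult_sum: "right_mult p S (\<lambda>i. \<Sum>a<d. c a * X a i) = (\<lambda>i. \<Sum>a<d. c a * right_mult p S (X a) i)"
proof
  fix i :: "nat \<times> nat"
  show "right_mult p S (\<lambda>i. \<Sum>a<d. c a * X a i) i = (\<Sum>a<d. c a * right_mult p S (X a) i)"
    unfolding right_mult_def sum_distrib_left sum_distrib_right case_prod_beta
    by (subst sum.swap) (simp add: mult_ac)
qed

lemma left_mult_vec_sum:
  "left_mult_vec q kO Om (\<lambda>i. \<Sum>a<d. c a * Y a i) = (\<lambda>t. \<Sum>a<d. c a * left_mult_vec q kO Om (Y a) t)"
  unfolding left_mult_vec_def mat_apply_sum ..

lemma upsilon_sum: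
  "upsilon q p kO kS G Om S (\<lambda>i. \<Sum>a<d. c a * X a i) = (\<lambda>t. \<Sum>a<d. c a * upsilon q p kO kS G Om S (X a) t)"
  unfolding upsilon_def right_mult_sum left_mult_vec_sum mat_apply_sum ..

lemma sqn_grid: "sqn ({..<q} \<times> {..<k}) Y = (\<Sum>l<k. sqn {..<q} (\<lambda>r. Y (r, l)))"
  unfolding sqn_def by (subst sum.swap) (simp add: sum.cartesian_product)

lemma sqn_left_mult_vec:
  "sqn {..<kS * kO} (left_mult_vec q kO Om Y) = (\<Sum>l<kS. sqn {..<kO} (mat_apply q Om (\<lambda>r. Y (r, l))))"
proof -
  let ?f = "\<lambda>t. (cmod (left_mult_vec q kO Om Y t))\<^sup>2"
  have "sqn {..<kS * kO} (left_mult_vec q kO Om Y) = (\<Sum>l<kS. sum ?f {l * kO..<l * kO + kO})"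
    unfolding sqn_def by (rule sum.nat_group[symmetric])
  also have "\<dots> = (\<Sum>l<kS. \<Sum>i<kO. (cmod (mat_apply q Om (\<lambda>r. Y (r, l)) i))\<^sup>2)"
  proof (rule sum.cong[OF refl])
    fix l :: nat
    have "sum ?f {l * kO..<l * kO + kO} = (\<Sum>i<kO. ?f (l * kO + i))"
      using sum.shift_bounds_nat_ivl[of ?f 0 "l * kO" kO] by (simp add: atLeast0LessThan add.commute)
    also have "\<dots> = (\<Sum>i<kO. (cmod (mat_apply q Om (\<lambda>r. Y (r, l)) i))\<^sup>2)"
      by (intro sum.cong refl) (simp add: left_mult_vec_def)
    finally show "sum ?f {l * kO..<l * kO + kO} = (\<Sum>i<kO. (cmod (mat_apply q Om (\<lambda>r. Y (r, l)) i))\<^sup>2)" .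
  qed
  finally show ?thesis by (simp add: sqn_def)
qed

text \<open>The errors of the stages are at most \<open>\<epsilon>/4\<close> times \<open>n0\<close>, \<open>5/4 n0\<close> and \<open>25/16 n0\<close>, and
\<open>1 + 5/4 + 25/16 \<le> 4\<close>.\<close>

lemma three_stage_error:
  fixes \<epsilon> :: real
  assumes \<epsilon>: "0 < \<epsilon>" "\<epsilon> < 1" and "0 \<le> n0" "0 \<le> n1" "0 \<le> n2"
    and "\<bar>n1 - n0\<bar> \<le> \<epsilon> / 4 * n0" "\<bar>n2 - n1\<bar> \<le> \<epsilon> / 4 * n1" "\<bar>n3 - n2\<bar> \<le> \<epsilon> / 4 * n2"
  shows "\<bar>n3 - n0\<bar> \<le> \<epsilon> * n0"
proof -
  have a: "n1 \<le> 5 / 4 * n0"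
  proof -
    have "\<epsilon> / 4 * n0 \<le> 1 / 4 * n0" using assms by (intro mult_right_mono) auto
    thus ?thesis using assms by linarith
  qed
  have b: "n2 \<le> 5 / 4 * n1"
  proof -
    have "\<epsilon> / 4 * n1 \<le> 1 / 4 * n1" using assms by (intro mult_right_mono) auto
    thus ?thesis using assms by linarith
  qed
  have "\<bar>n3 - n0\<bar> \<le> \<epsilon> / 4 * (n0 + n1 + n2)" 
  proof -
    have "\<bar>n3 - n0\<bar> \<le> \<bar>n1 - n0\<bar> + \<bar>n2 - n1\<bar> + \<bar>n3 - n2\<bar>" by linarith
    also have "\<dots> \<le> \<epsilon> / 4 * n0 + \<epsilon> / 4 * n1 + \<epsilon> / 4 * n2" using assms by linarith
    finally show ?thesis by (simp add: algebra_simps)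
  qed
  also have "\<dots> \<le> \<epsilon> / 4 * (4 * n0)" using a b assms by (intro mult_left_mono) auto
  finally show ?thesis by simp
qed

context prob_space
begin

text \<open>A complex combination of \<open>d\<close> matrices is a real combination of the \<open>2 d\<close> matrices \<open>X\<^sub>a\<close> and \<open>\<i> X\<^sub>a\<close>, and a complex matrix is a
pair of real ones on which the real Gaussian matrix acts separately. The boolean in the row index selects the
real or the imaginary part.\<close>

lemma gaussian_stage:
  fixes X :: "nat \<Rightarrow> nat \<times> nat \<Rightarrow> complex" and K :: "complex set" and \<eta> :: nat
  assumes k0: "0 < k" and S: "rescaled_gaussian M k p S"
    and K: "K = \<real> \<and> \<eta> = 1 \<or> K = UNIV \<and> \<eta> = 2"
    and e: "0 < e" "e \<le> 1 / 4" and \<delta>: "0 < \<delta>" "\<delta> \<le> 1"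
    and k: "21 / 2 / e\<^sup>2 * (6.9 * real (\<eta> * d) + ln (2 / \<delta>)) \<le> k"
  shows "\<exists>B\<in>sets M. prob B \<le> \<delta> \<and> (\<forall>\<omega>\<in>space M - B. \<forall>c. (\<forall>a. c a \<in> K) \<longrightarrow>
     \<bar>sqn ({..<q} \<times> {..<k}) (right_mult p (S \<omega>) (\<lambda>i. \<Sum>a<d. c a * X a i)) - sqn ({..<q} \<times> {..<p}) (\<lambda>i. \<Sum>a<d. c a * X a i)\<bar>
       \<le> e * sqn ({..<q} \<times> {..<p}) (\<lambda>i. \<Sum>a<d. c a * X a i))"
proof -
  let ?N = "\<eta> * d"
  let ?R = "{..<q} \<times> (UNIV :: bool set)"
  define A where "A ij \<omega> = S \<omega> $$ ij" for ij \<omega>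
  have ind: "indep_vars (\<lambda>_. borel) A ({..<k} \<times> {..<p})"
    and nor: "\<And>ij. ij \<in> {..<k} \<times> {..<p} \<Longrightarrow> distributed M lborel (A ij) (normal_density 0 (1 / sqrt k))"
    using S unfolding rescaled_gaussian_def A_def by auto
  define part where "part b z = (if b then Im z else Re z)" for b and z :: complex
  define x where "x n = (\<lambda>(r, b) j. part b (if n < d then X n (r, j) else \<i> * X (n - d) (r, j)))" for n
  define Z where "Z c i = (\<Sum>a<d. c a * X a i)" for c and i :: "nat \<times> nat"
  have part_sum: "part b (\<Sum>a\<in>T. f a) = (\<Sum>a\<in>T. part b (f a))" for b T and f :: "nat \<Rightarrow> complex"
    by (simp add: part_def)
  have part_scale: "part b (z * of_real t) = part b z * t" "part b (of_real t * z) = t * part b z" for b z t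
    by (simp_all add: part_def)
  have cmod_part: "(cmod z)\<^sup>2 = (\<Sum>b\<in>UNIV. (part b z)\<^sup>2)" for z
    by (simp add: UNIV_bool part_def cmod_power2)
  \<comment> \<open>Coefficients in \<open>K\<close> are real coefficients for the family \<open>x\<close>, which has \<open>\<eta> d\<close> members.\<close>
  have real_comb: "\<exists>c'. \<forall>r b j. (\<Sum>n<?N. c' n * x n (r, b) j) = part b (Z c (r, j))" if c: "\<And>a. c a \<in> K" for c
  proof (cases "K = \<real>")
    case True
    moreover have "\<i> \<notin> (\<real> :: complex set)" by (simp add: complex_is_Real_iff)
    hence "(\<real> :: complex set) \<noteq> UNIV" by blast
    ultimately have \<eta>: "?N = d" using K by auto
    have "(\<Sum>n<d. Re (c n) * x n (r, b) j) = part b (Z c (r, j))" for r b j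
    proof -
      have "c n = of_real (Re (c n))" for n using c[of n] True by (simp add: complex_is_Real_iff complex_eq_iff)
      hence "part b (c n * X n (r, j)) = Re (c n) * part b (X n (r, j))" for n using part_scale(2) by metis
      thus ?thesis by (simp add: Z_def part_sum x_def)
    qed
    thus ?thesis unfolding \<eta> by (intro exI[of _ "\<lambda>n. Re (c n)"] allI)
  next
    case False
    hence \<eta>: "?N = 2 * d" using K by auto
    define c' where "c' n = (if n < d then Re (c n) else Im (c (n - d)))" for n
    have "(\<Sum>n<2 * d. c' n * x n (r, b) j) = part b (Z c (r, j))" for r b j
    proof -
      have "(\<Sum>n<2 * d. c' n * x n (r, b) j) = (\<Sum>n<d. Re (c n) * part b (X n (r, j)) + Im (c n) * part b (\<i> * X n (r, j)))"
        unfolding sum_double by (intro sum.cong refl) (simp add: c'_def x_def)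
      also have "\<dots> = (\<Sum>n<d. part b (c n * X n (r, j)))"
        by (intro sum.cong refl) (simp add: part_def)
      finally show ?thesis by (simp add: Z_def part_sum)
    qed
    thus ?thesis unfolding \<eta> by blast
  qed
  obtain B where B: "B \<in> sets M" "prob B \<le> \<delta>" and good: "\<And>\<omega> c. \<omega> \<in> space M - B \<Longrightarrow>
     \<bar>(\<Sum>r\<in>?R. \<Sum>i<k. (\<Sum>j<p. (\<Sum>a<?N. c a * x a r j) * A (i, j) \<omega>)\<^sup>2) - (\<Sum>r\<in>?R. \<Sum>j<p. (\<Sum>a<?N. c a * x a r j)\<^sup>2)\<bar>
       \<le> e * (\<Sum>r\<in>?R. \<Sum>j<p. (\<Sum>a<?N. c a * x a r j)\<^sup>2)"
    using gaussian_embedding[OF k0 ind nor _ e \<delta> k, of ?R x] by auto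
  have "\<bar>sqn ({..<q} \<times> {..<k}) (right_mult p (S \<omega>) (Z c)) - sqn ({..<q} \<times> {..<p}) (Z c)\<bar>
       \<le> e * sqn ({..<q} \<times> {..<p}) (Z c)" if \<omega>: "\<omega> \<in> space M - B" and c: "\<And>a. c a \<in> K" for \<omega> c
  proof -
    obtain c' where c': "\<And>r b j. (\<Sum>n<?N. c' n * x n (r, b) j) = part b (Z c (r, j))"
      using real_comb[of c] c by blast
    have 1: "(\<Sum>r\<in>?R. \<Sum>j<p. (\<Sum>a<?N. c' a * x a r j)\<^sup>2) = sqn ({..<q} \<times> {..<p}) (Z c)"
    proof -
      have "(\<Sum>r\<in>?R. \<Sum>j<p. (\<Sum>a<?N. c' a * x a r j)\<^sup>2) = (\<Sum>(r, b)\<in>?R. \<Sum>j<p. (part b (Z c (r, j)))\<^sup>2)"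
        by (intro sum.cong refl) (auto simp: c')
      also have "\<dots> = (\<Sum>r<q. \<Sum>b\<in>UNIV. \<Sum>j<p. (part b (Z c (r, j)))\<^sup>2)"
        by (rule sum.cartesian_product[symmetric])
      also have "\<dots> = (\<Sum>r<q. \<Sum>j<p. (cmod (Z c (r, j)))\<^sup>2)"
        unfolding cmod_part by (intro sum.cong refl sum.swap)
      finally show ?thesis by (simp add: sqn_def sum.cartesian_product case_prod_beta)
    qed
    have 2: "(\<Sum>r\<in>?R. \<Sum>i<k. (\<Sum>j<p. (\<Sum>a<?N. c' a * x a r j) * A (i, j) \<omega>)\<^sup>2) = sqn ({..<q} \<times> {..<k}) (right_mult p (S \<omega>) (Z c))"
    proof -
      have pr: "(\<Sum>j<p. part b (Z c (r, j)) * A (i, j) \<omega>) = part b (right_mult p (S \<omega>) (Z c) (r, i))" for r b i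
        by (simp add: right_mult_def part_sum part_scale A_def)
      have "(\<Sum>r\<in>?R. \<Sum>i<k. (\<Sum>j<p. (\<Sum>a<?N. c' a * x a r j) * A (i, j) \<omega>)\<^sup>2)
         = (\<Sum>(r, b)\<in>?R. \<Sum>i<k. (part b (right_mult p (S \<omega>) (Z c) (r, i)))\<^sup>2)"
        by (intro sum.cong refl) (auto simp: c' pr)
      also have "\<dots> = (\<Sum>r<q. \<Sum>b\<in>UNIV. \<Sum>i<k. (part b (right_mult p (S \<omega>) (Z c) (r, i)))\<^sup>2)"
        by (rule sum.cartesian_product[symmetric])
      also have "\<dots> = (\<Sum>r<q. \<Sum>i<k. (cmod (right_mult p (S \<omega>) (Z c) (r, i)))\<^sup>2)"
        unfolding cmod_part by (intro sum.cong refl sum.swap)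
      finally show ?thesis by (simp add: sqn_def sum.cartesian_product case_prod_beta)
    qed
    show ?thesis using good[OF \<omega>, of c'] unfolding 1 2 .
  qed
  thus ?thesis using B unfolding Z_def by blast
qed

text \<open>The three exceptional sets are those of the Gaussian stage, of the \<open>kS\<close> applications of \<open>\<Omega>\<close> to single columns, and of the
last SRHT. With \<open>e = \<epsilon>/4\<close>, the requirements of the stages are literally the assumed lower bounds:
\<open>21/2 / e\<^sup>2 = 168 / \<epsilon>\<^sup>2\<close> and \<open>2 / (e\<^sup>2 - e\<^sup>3/3) = 32 / (\<epsilon>\<^sup>2 - \<epsilon>\<^sup>3/12)\<close>. The coefficients are restricted to \<open>K\<close>
for the sake of the Gaussian stage, whose number \<open>\<eta> d\<close> of real parameters distinguishes real from complex subspaces.\<close>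

theorem upsilon_quadratic_form:
  fixes X :: "nat \<Rightarrow> nat \<times> nat \<Rightarrow> complex" and K :: "complex set" and \<eta> :: nat
    and S Om G :: "'a \<Rightarrow> real mat"
  assumes pos: "0 < q" "0 < d" "0 < kS" "0 < kO" "0 < k"
    and \<epsilon>: "0 < \<epsilon>" "\<epsilon> < 1" and \<delta>: "0 < \<delta>" "\<delta> < 1"
    and S: "rescaled_gaussian M kS p S" and Om: "psrht M kO q Om" and G: "psrht M k (kS * kO) G"
    and ind: "indep_vars (\<lambda>i. [borel_mat kS p, borel_mat kO q, borel_mat k (kS * kO)] ! i)
           (\<lambda>i. [S, Om, G] ! i) {0, 1, 2}"
    and K: "K = \<real> \<and> \<eta> = 1 \<or> K = UNIV \<and> \<eta> = 2"
    and kS: "real kS \<ge> 168 / \<epsilon>\<^sup>2 * (6.9 * real \<eta> * real d + ln (6 / \<delta>))"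
    and kO: "real kO \<ge> 32 * ((sqrt (real d) + sqrt (8 * ln (18 * real q * real kS / \<delta>)))\<^sup>2
           / (\<epsilon>\<^sup>2 - \<epsilon> ^ 3 / 12)) * ln (9 * real d * real kS / \<delta>)"
    and k: "real k \<ge> 32 * ((sqrt (real d) + sqrt (8 * ln (18 * real kO * real kS / \<delta>)))\<^sup>2
           / (\<epsilon>\<^sup>2 - \<epsilon> ^ 3 / 12)) * ln (9 * real d / \<delta>)"
  shows "\<exists>B\<in>sets M. prob B \<le> \<delta> \<and> (\<forall>\<omega>\<in>space M - B. \<forall>c. (\<forall>a. c a \<in> K) \<longrightarrow>
     \<bar>sqn {..<k} (upsilon q p kO kS (G \<omega>) (Om \<omega>) (S \<omega>) (\<lambda>i. \<Sum>a<d. c a * X a i)) - sqn ({..<q} \<times> {..<p}) (\<lambda>i. \<Sum>a<d. c a * X a i)\<bar>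
       \<le> \<epsilon> * sqn ({..<q} \<times> {..<p}) (\<lambda>i. \<Sum>a<d. c a * X a i))"
proof -
  define e where "e = \<epsilon> / 4"
  have e: "0 < e" "e \<le> 1 / 4" "e < 1" using \<epsilon> by (simp_all add: e_def)
  have e2: "2 * (y / (e\<^sup>2 - e ^ 3 / 3)) = 32 * (y / (\<epsilon>\<^sup>2 - \<epsilon> ^ 3 / 12))" for y
  proof -
    have "e\<^sup>2 - e ^ 3 / 3 = (\<epsilon>\<^sup>2 - \<epsilon> ^ 3 / 12) / 16" by (simp add: e_def power_divide)
    thus ?thesis by (simp only:) simp
  qed
  let ?M = "\<lambda>i. [borel_mat kS p, borel_mat kO q, borel_mat k (kS * kO)] ! i"
  let ?F = "\<lambda>i. [S, Om, G] ! i"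
  have xm: "(\<lambda>x. x i) \<in> PiM A ?M \<rightarrow>\<^sub>M ?M i" if "i \<in> A" for A i
    by (rule measurable_component_singleton[OF that])
  have xe0: "(\<lambda>x. complex_of_real (x 0 $$ (i, j))) \<in> borel_measurable (PiM A ?M)" if "0 \<in> A" "i < kS" "j < p" for A i j
  proof -
    have "(\<lambda>x. x 0) \<in> PiM A ?M \<rightarrow>\<^sub>M borel_mat kS p" using xm[OF that(1)] by simp
    from entry_measurable[OF this that(2,3)] show ?thesis by measurable
  qed
  have xe1: "(\<lambda>x. complex_of_real (x 1 $$ (i, j))) \<in> borel_measurable (PiM A ?M)" if "1 \<in> A" "i < kO" "j < q" for A i j
  proof -
    have "(\<lambda>x. x 1) \<in> PiM A ?M \<rightarrow>\<^sub>M borel_mat kO q" using xm[OF that(1)] by simp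
    from entry_measurable[OF this that(2,3)] show ?thesis by measurable
  qed
  have rm: "(\<lambda>x. right_mult p (x 0) Y (r, l)) \<in> borel_measurable (PiM A ?M)" if "0 \<in> A" "l < kS" for A Y r l
    unfolding right_mult_def case_prod_conv
    by (intro borel_measurable_sum borel_measurable_times borel_measurable_const xe0) (use that in auto)
  have "\<exists>B\<in>sets M. prob B \<le> \<delta> / 3 \<and> (\<forall>\<omega>\<in>space M - B. \<forall>c. (\<forall>a. c a \<in> K) \<longrightarrow>
     \<bar>sqn ({..<q} \<times> {..<kS}) (right_mult p (S \<omega>) (\<lambda>i. \<Sum>a<d. c a * X a i)) - sqn ({..<q} \<times> {..<p}) (\<lambda>i. \<Sum>a<d. c a * X a i)\<bar>
       \<le> e * sqn ({..<q} \<times> {..<p}) (\<lambda>i. \<Sum>a<d. c a * X a i))"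
  proof (rule gaussian_stage[OF pos(3) S K e(1,2)])
    show "21 / 2 / e\<^sup>2 * (6.9 * real (\<eta> * d) + ln (2 / (\<delta> / 3))) \<le> kS"
      using kS by (simp add: e_def power_divide mult.assoc)
  qed (use \<delta> in auto)
  then obtain B1 where B1: "B1 \<in> sets M" "prob B1 \<le> \<delta> / 3" and good1: "\<And>\<omega> c. \<omega> \<in> space M - B1 \<Longrightarrow> (\<And>a. c a \<in> K) \<Longrightarrow>
     \<bar>sqn ({..<q} \<times> {..<kS}) (right_mult p (S \<omega>) (\<lambda>i. \<Sum>a<d. c a * X a i)) - sqn ({..<q} \<times> {..<p}) (\<lambda>i. \<Sum>a<d. c a * X a i)\<bar>
       \<le> e * sqn ({..<q} \<times> {..<p}) (\<lambda>i. \<Sum>a<d. c a * X a i)" by blast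
  have stage2: "\<exists>B\<in>sets M. prob B \<le> \<delta> / (3 * kS) \<and> (\<forall>\<omega>\<in>space M - B. \<forall>c.
      preserves e kO q (?F 1 \<omega>) (\<lambda>j. \<Sum>a<d. c a * right_mult p ((\<lambda>i\<in>{0}. ?F i \<omega>) 0) (X a) (j, l)))" if l: "l < kS" for l
  proof (rule psrht_stage[OF ind, of "{0}" 1])
    have "1 \<le> real kS" using pos by simp
    hence "\<delta> < 3 * real kS" using \<delta> by linarith
    thus "\<delta> / (3 * kS) < 1" using pos by simp
    show "0 < \<delta> / (3 * kS)" using \<delta> pos by simp
    have 1: "6 * real q / (\<delta> / (3 * kS)) = 18 * real q * real kS / \<delta>"
      and 2: "3 * real d / (\<delta> / (3 * kS)) = 9 * real d * real kS / \<delta>" by simp_all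
    show "2 * ((sqrt d + sqrt (8 * ln (6 * real q / (\<delta> / (3 * kS)))))\<^sup>2 / (e\<^sup>2 - e ^ 3 / 3)) * ln (3 * real d / (\<delta> / (3 * kS))) \<le> kO"
      unfolding 1 2 e2 by (rule kO)
    show "(\<lambda>x. right_mult p (x 0) (X a) (j, l)) \<in> borel_measurable (PiM {0} ?M)" for a j
      by (rule rm) (use l in auto)
  qed (use pos e Om in auto)
  have "\<forall>l. \<exists>B. l < kS \<longrightarrow> B \<in> sets M \<and> prob B \<le> \<delta> / (3 * kS) \<and> (\<forall>\<omega>\<in>space M - B. \<forall>c.
      preserves e kO q (Om \<omega>) (\<lambda>j. \<Sum>a<d. c a * right_mult p (S \<omega>) (X a) (j, l)))"
  proof
    fix l
    show "\<exists>B. l < kS \<longrightarrow> B \<in> sets M \<and> prob B \<le> \<delta> / (3 * kS) \<and> (\<forall>\<omega>\<in>space M - B. \<forall>c.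
      preserves e kO q (Om \<omega>) (\<lambda>j. \<Sum>a<d. c a * right_mult p (S \<omega>) (X a) (j, l)))"
      using stage2[of l] by (cases "l < kS") auto
  qed
  from choice[OF this] obtain B2 where B2: "\<And>l. l < kS \<Longrightarrow> B2 l \<in> sets M" "\<And>l. l < kS \<Longrightarrow> prob (B2 l) \<le> \<delta> / (3 * kS)"
    and good2: "\<And>l \<omega> c. l < kS \<Longrightarrow> \<omega> \<in> space M - B2 l \<Longrightarrow>
      preserves e kO q (Om \<omega>) (\<lambda>j. \<Sum>a<d. c a * right_mult p (S \<omega>) (X a) (j, l))"
    by blast
  have "\<exists>B\<in>sets M. prob B \<le> \<delta> / 3 \<and> (\<forall>\<omega>\<in>space M - B. \<forall>c.
      preserves e k (kS * kO) (?F 2 \<omega>) (\<lambda>j. \<Sum>a<d. c a *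
        left_mult_vec q kO ((\<lambda>i\<in>{0, 1}. ?F i \<omega>) 1) (right_mult p ((\<lambda>i\<in>{0, 1}. ?F i \<omega>) 0) (X a)) j))"
  proof (rule psrht_stage[OF ind, of "{0, 1}" 2])
    have 1: "6 * real (kS * kO) / (\<delta> / 3) = 18 * real kO * real kS / \<delta>"
      and 2: "3 * real d / (\<delta> / 3) = 9 * real d / \<delta>" by simp_all
    show "2 * ((sqrt d + sqrt (8 * ln (6 * real (kS * kO) / (\<delta> / 3))))\<^sup>2 / (e\<^sup>2 - e ^ 3 / 3)) * ln (3 * real d / (\<delta> / 3)) \<le> k"
      unfolding 1 2 e2 by (rule k)
    show "(\<lambda>x. left_mult_vec q kO (x 1) (right_mult p (x 0) (X a)) j) \<in> borel_measurable (PiM {0, 1} ?M)"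
      if "j < kS * kO" for a j
    proof -
      have "j mod kO < kO" "j div kO < kS" using that pos by (auto simp: less_mult_imp_div_less)
      thus ?thesis unfolding left_mult_vec_def mat_apply_def
        by (intro borel_measurable_sum borel_measurable_times xe1 rm) auto
    qed
  qed (use pos e G \<delta> in auto)
  then obtain B3 where B3: "B3 \<in> sets M" "prob B3 \<le> \<delta> / 3"
    and good3: "\<And>\<omega> c. \<omega> \<in> space M - B3 \<Longrightarrow>
      preserves e k (kS * kO) (G \<omega>) (\<lambda>j. \<Sum>a<d. c a * left_mult_vec q kO (Om \<omega>) (right_mult p (S \<omega>) (X a)) j)"
    by auto
  \<comment> \<open>The columns treated by \<open>\<Omega>\<close> share the budget \<open>\<delta> / 3\<close>.\<close>
  define BB where "BB = (\<Union>l\<in>{..<kS}. B2 l)"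
  have BB: "BB \<in> sets M" unfolding BB_def using B2 by (intro sets.finite_UN) auto
  have PBB: "prob BB \<le> \<delta> / 3"
  proof -
    have "prob BB \<le> (\<Sum>l<kS. prob (B2 l))"
      unfolding BB_def using B2 by (intro finite_measure_subadditive_finite) auto
    also have "\<dots> \<le> (\<Sum>l<kS. \<delta> / (3 * kS))" using B2 by (intro sum_mono) auto
    also have "\<dots> = \<delta> / 3" using pos by simp
    finally show ?thesis .
  qed
  define B where "B = B1 \<union> BB \<union> B3"
  have "prob B \<le> prob B1 + prob BB + prob B3"
    unfolding B_def using B1 BB B3
    by (intro order.trans[OF measure_Un_le] add_mono measure_Un_le) auto
  hence "prob B \<le> \<delta>" using B1 PBB B3 by simp
  moreover have "B \<in> sets M" unfolding B_def using B1 BB B3 by auto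
  moreover have "\<bar>sqn {..<k} (upsilon q p kO kS (G \<omega>) (Om \<omega>) (S \<omega>) (\<lambda>i. \<Sum>a<d. c a * X a i)) - sqn ({..<q} \<times> {..<p}) (\<lambda>i. \<Sum>a<d. c a * X a i)\<bar>
       \<le> \<epsilon> * sqn ({..<q} \<times> {..<p}) (\<lambda>i. \<Sum>a<d. c a * X a i)" if \<omega>: "\<omega> \<in> space M - B" and c: "\<And>a. c a \<in> K" for \<omega> c
  proof -
    define Z where "Z = (\<lambda>i. \<Sum>a<d. c a * X a i)"
    define Y where "Y = right_mult p (S \<omega>) Z"
    define V where "V = left_mult_vec q kO (Om \<omega>) Y"
    have Y: "Y = (\<lambda>i. \<Sum>a<d. c a * right_mult p (S \<omega>) (X a) i)"
      unfolding Y_def Z_def right_mult_sum ..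
    have V: "V = (\<lambda>t. \<Sum>a<d. c a * left_mult_vec q kO (Om \<omega>) (right_mult p (S \<omega>) (X a)) t)"
      unfolding V_def Y left_mult_vec_sum ..
    have 1: "\<bar>sqn ({..<q} \<times> {..<kS}) Y - sqn ({..<q} \<times> {..<p}) Z\<bar> \<le> e * sqn ({..<q} \<times> {..<p}) Z"
      unfolding Y_def Z_def using \<omega> c by (intro good1) (auto simp: B_def)
    have 2: "\<bar>sqn {..<kS * kO} V - sqn ({..<q} \<times> {..<kS}) Y\<bar> \<le> e * sqn ({..<q} \<times> {..<kS}) Y"
    proof -
      have "\<bar>sqn {..<kS * kO} V - sqn ({..<q} \<times> {..<kS}) Y\<bar>
         \<le> (\<Sum>l<kS. \<bar>sqn {..<kO} (mat_apply q (Om \<omega>) (\<lambda>r. Y (r, l))) - sqn {..<q} (\<lambda>r. Y (r, l))\<bar>)"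
        unfolding V_def sqn_left_mult_vec sqn_grid sum_subtractf[symmetric] by (rule sum_abs)
      also have "\<dots> \<le> (\<Sum>l<kS. e * sqn {..<q} (\<lambda>r. Y (r, l)))"
      proof (intro sum_mono)
        fix l assume "l \<in> {..<kS}"
        hence "preserves e kO q (Om \<omega>) (\<lambda>r. Y (r, l))"
          unfolding Y using \<omega> by (intro good2) (auto simp: B_def BB_def)
        thus "\<bar>sqn {..<kO} (mat_apply q (Om \<omega>) (\<lambda>r. Y (r, l))) - sqn {..<q} (\<lambda>r. Y (r, l))\<bar> \<le> e * sqn {..<q} (\<lambda>r. Y (r, l))"
          by (simp add: preserves_def)
      qed
      finally show ?thesis by (simp add: sqn_grid sum_distrib_left)
    qed
    have "preserves e k (kS * kO) (G \<omega>) V"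
      unfolding V using \<omega> by (intro good3) (auto simp: B_def)
    hence 3: "\<bar>sqn {..<k} (upsilon q p kO kS (G \<omega>) (Om \<omega>) (S \<omega>) Z) - sqn {..<kS * kO} V\<bar> \<le> e * sqn {..<kS * kO} V"
      unfolding preserves_def upsilon_def V_def Y_def .
    show ?thesis
      unfolding Z_def[symmetric] by (rule three_stage_error[OF \<epsilon> _ _ _ 1[unfolded e_def] 2[unfolded e_def] 3[unfolded e_def]]) simp_all
  qed
  ultimately show ?thesis by blast
qed

end

section \<open>Real and complex scalars\<close>

lemma upsilon_cong:
  assumes "\<And>r j. r < q \<Longrightarrow> j < p \<Longrightarrow> X (r, j) = Y (r, j)"
  shows "upsilon q p kO kS G Om S X = upsilon q p kO kS G Om S Y"
proof -
  have "right_mult p S X (r, l) = right_mult p S Y (r, l)" if "r < q" for r l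
    unfolding right_mult_def case_prod_conv using assms[OF that] by (intro sum.cong) simp_all
  hence "left_mult_vec q kO Om (right_mult p S X) = left_mult_vec q kO Om (right_mult p S Y)"
    unfolding left_mult_vec_def mat_apply_def fun_eq_iff by (intro allI sum.cong) simp_all
  thus ?thesis by (simp only: upsilon_def)
qed

text \<open>The scalars are the reals or the complex numbers, regarded as the subfield \<open>K\<close> of the complex numbers. The left
inverse \<open>ret\<close> transports measurability back along the embedding.\<close>

locale scalar_embedding =
  fixes emb :: "'a :: {conjugatable_field, real_normed_field, second_countable_topology} \<Rightarrow> complex"
    and ret :: "complex \<Rightarrow> 'a" and K :: "complex set"
  assumes emb_add: "emb (x + y) = emb x + emb y"
    and emb_mult: "emb (x * y) = emb x * emb y"
    and emb_conjugate: "emb (conjugate x) = cnj (emb x)"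
    and emb_norm: "cmod (emb x) = norm x"
    and emb_of_real: "emb (of_real t) = of_real t"
    and emb_continuous: "continuous_on UNIV emb"
    and ret_emb: "ret (emb x) = x"
    and ret_measurable: "ret \<in> borel_measurable borel"
    and range_emb: "range emb = K"
begin

lemma emb_eq_iff: "emb x = emb y \<longleftrightarrow> x = y"
  by (metis ret_emb)

lemma emb_0 [simp]: "emb 0 = 0" using emb_of_real[of 0] by simp

lemma emb_diff: "emb (x - y) = emb x - emb y"
  using emb_add[of "x - y" y] by (simp add: algebra_simps)

lemma emb_sum: "emb (\<Sum>a\<in>A. f a) = (\<Sum>a\<in>A. emb (f a))"
  by (induction A rule: infinite_finite_induct) (simp_all add: emb_add)

lemma conjugate_of_real: "conjugate (of_real t) = (of_real t :: 'a)"
  unfolding emb_eq_iff[symmetric] by (simp add: emb_conjugate emb_of_real)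

definition mat_entries :: "'a mat \<Rightarrow> nat \<times> nat \<Rightarrow> complex" where
  "mat_entries X ij = emb (X $$ ij)"

lemma mat_adjoint_index:
  assumes "A \<in> carrier_mat nr nc" "i < nc" "j < nr"
  shows "mat_adjoint A $$ (i, j) = conjugate (A $$ (j, i) :: 'a)"
  using assms by (simp add: mat_adjoint_def mat_of_rows_def)

lemma mat_adjoint_carrier: "A \<in> carrier_mat nr nc \<Longrightarrow> mat_adjoint (A :: 'a mat) \<in> carrier_mat nc nr"
  by (auto simp: mat_adjoint_def)

lemma mat_mult_index:
  assumes "A \<in> carrier_mat nr n" "B \<in> carrier_mat n nc" "i < nr" "j < nc"
  shows "(A * B) $$ (i, j) = (\<Sum>r<n. A $$ (i, r) * (B $$ (r, j) :: 'a))"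
  using assms by (simp add: scalar_prod_def atLeast0LessThan)

lemma emb_frobenius_inner:
  assumes X: "X \<in> carrier_mat q p" and Y: "Y \<in> carrier_mat q p"
  shows "emb (frobenius_inner X Y) = cip ({..<q} \<times> {..<p}) (mat_entries X) (mat_entries Y)"
proof -
  have A: "mat_adjoint X \<in> carrier_mat p q" by (rule mat_adjoint_carrier[OF X])
  have "frobenius_inner X Y = (\<Sum>j<p. \<Sum>r<q. conjugate (X $$ (r, j)) * Y $$ (r, j))"
    unfolding frobenius_inner_def mat_trace_def using A X Y
    by (intro sum.cong) (simp_all add: scalar_prod_def atLeast0LessThan mat_adjoint_index[OF X])
  hence "emb (frobenius_inner X Y) = (\<Sum>j<p. \<Sum>r<q. cnj (mat_entries X (r, j)) * mat_entries Y (r, j))"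
    by (simp add: emb_sum emb_mult emb_conjugate mat_entries_def)
  also have "\<dots> = (\<Sum>r<q. \<Sum>j<p. cnj (mat_entries X (r, j)) * mat_entries Y (r, j))" by (rule sum.swap)
  finally show ?thesis by (simp add: cip_def sum.cartesian_product case_prod_beta)
qed

lemma ip_norm_frobenius:
  assumes X: "X \<in> carrier_mat q p"
  shows "ip_norm frobenius_inner X = sqrt (sqn ({..<q} \<times> {..<p}) (mat_entries X))"
proof -
  have "norm (frobenius_inner X X) = cmod (of_real (sqn ({..<q} \<times> {..<p}) (mat_entries X)))"
    unfolding emb_norm[symmetric] emb_frobenius_inner[OF X X] sqn_cip ..
  thus ?thesis by (simp add: ip_norm_def)
qed

context
  fixes q p kO kS k :: nat and G Om S :: "real mat"
  assumes G: "G \<in> carrier_mat k (kS * kO)" and Om: "Om \<in> carrier_mat kO q" and S: "S \<in> carrier_mat kS p"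
begin

lemma Upsilon_map_carrier: "Upsilon_map G Om S (X :: 'a mat) \<in> carrier_vec k"
  unfolding Upsilon_map_def
  by (rule carrier_vecI) (simp only: dim_mult_mat_vec index_map_mat carrier_matD[OF G])

lemma emb_Upsilon_map:
  assumes X: "X \<in> carrier_mat q p" and i: "i < k"
  shows "emb (Upsilon_map G Om S X $ i) = upsilon q p kO kS G Om S (mat_entries X) i"
proof -
  let ?S = "map_mat of_real S :: 'a mat" and ?Om = "map_mat of_real Om :: 'a mat" and ?G = "map_mat of_real G :: 'a mat"
  define Y where "Y = ?Om * X * mat_adjoint ?S"
  have S': "?S \<in> carrier_mat kS p" using S by simp
  have A: "mat_adjoint ?S \<in> carrier_mat p kS" by (rule mat_adjoint_carrier[OF S'])
  have OX: "?Om * X \<in> carrier_mat kO p" using Om X by simp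
  have Yc: "Y \<in> carrier_mat kO kS" unfolding Y_def using OX A by simp
  have Yent: "emb (Y $$ (a, l)) = mat_apply q Om (\<lambda>r. right_mult p S (mat_entries X) (r, l)) a" if a: "a < kO" and l: "l < kS" for a l
  proof -
    have "Y $$ (a, l) = (\<Sum>j<p. (?Om * X) $$ (a, j) * mat_adjoint ?S $$ (j, l))"
      unfolding Y_def by (rule mat_mult_index[OF OX A a l])
    also have "\<dots> = (\<Sum>j<p. (\<Sum>r<q. of_real (Om $$ (a, r)) * X $$ (r, j)) * of_real (S $$ (l, j)))"
    proof (rule sum.cong[OF refl])
      fix j assume "j \<in> {..<p}"
      hence j: "j < p" by simp
      have "mat_adjoint ?S $$ (j, l) = of_real (S $$ (l, j))"
        unfolding mat_adjoint_index[OF S' j l] using S j l by (simp add: conjugate_of_real)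
      moreover have "(?Om * X) $$ (a, j) = (\<Sum>r<q. of_real (Om $$ (a, r)) * X $$ (r, j))"
        using mat_mult_index[of ?Om kO q X p a j] Om X a j by simp
      ultimately show "(?Om * X) $$ (a, j) * mat_adjoint ?S $$ (j, l)
         = (\<Sum>r<q. of_real (Om $$ (a, r)) * X $$ (r, j)) * of_real (S $$ (l, j))" by simp
    qed
    finally have "emb (Y $$ (a, l)) = (\<Sum>j<p. \<Sum>r<q. of_real (Om $$ (a, r)) * mat_entries X (r, j) * of_real (S $$ (l, j)))"
      by (simp add: emb_sum emb_mult emb_of_real mat_entries_def sum_distrib_right)
    also have "\<dots> = (\<Sum>r<q. \<Sum>j<p. of_real (Om $$ (a, r)) * mat_entries X (r, j) * of_real (S $$ (l, j)))"
      by (rule sum.swap)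
    finally show ?thesis by (simp add: mat_apply_def right_mult_def sum_distrib_left mult.assoc)
  qed
  have vec: "emb (vectorize Y $ t) = left_mult_vec q kO Om (right_mult p S (mat_entries X)) t" if t: "t < kS * kO" for t
  proof -
    have "0 < kO" using t by (cases kO) auto
    hence "t mod kO < kO" "t div kO < kS" using t by (auto simp: less_mult_imp_div_less)
    thus ?thesis using Yc t Yent by (simp add: vectorize_def left_mult_vec_def mult.commute)
  qed
  have dv: "dim_vec (vectorize Y) = kS * kO" using Yc by (simp add: vectorize_def)
  have "Upsilon_map G Om S X $ i = (\<Sum>t<kS * kO. of_real (G $$ (i, t)) * vectorize Y $ t)"
    unfolding Upsilon_map_def Y_def[symmetric] using G i dv by (simp add: scalar_prod_def atLeast0LessThan)
  thus ?thesis using vec by (simp add: emb_sum emb_mult emb_of_real upsilon_def mat_apply_def)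
qed

lemma emb_cscalar_Upsilon:
  assumes X: "X \<in> carrier_mat q p" and Y: "Y \<in> carrier_mat q p"
  shows "emb (Upsilon_map G Om S Y \<bullet>c Upsilon_map G Om S X)
     = cip {..<k} (upsilon q p kO kS G Om S (mat_entries X)) (upsilon q p kO kS G Om S (mat_entries Y))"
proof -
  have d: "dim_vec (Upsilon_map G Om S X) = k" using Upsilon_map_carrier[of X] by simp
  have "emb (Upsilon_map G Om S Y \<bullet>c Upsilon_map G Om S X)
     = (\<Sum>i<k. emb (Upsilon_map G Om S Y $ i) * cnj (emb (Upsilon_map G Om S X $ i)))"
    using d by (simp add: scalar_prod_def atLeast0LessThan emb_sum emb_mult emb_conjugate)
  thus ?thesis using emb_Upsilon_map[OF X] emb_Upsilon_map[OF Y] by (simp add: cip_def mult.commute)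
qed

lemma Upsilon_map_linear:
  "VectorSpace.linear_map class_ring (module_mat TYPE('a) q p) (module_vec TYPE('a) k) (Upsilon_map G Om S)"
proof -
  let ?U = "upsilon q p kO kS G Om S"
  have add: "Upsilon_map G Om S (X + Y) = Upsilon_map G Om S X + Upsilon_map G Om S Y"
    if X: "X \<in> carrier_mat q p" and Y: "(Y :: 'a mat) \<in> carrier_mat q p" for X Y
  proof (rule eq_vecI)
    show "dim_vec (Upsilon_map G Om S (X + Y)) = dim_vec (Upsilon_map G Om S X + Upsilon_map G Om S Y)"
      using Upsilon_map_carrier[of "X + Y"] Upsilon_map_carrier[of X] Upsilon_map_carrier[of Y] by simp
    fix i assume "i < dim_vec (Upsilon_map G Om S X + Upsilon_map G Om S Y)"
    hence i: "i < k" using Upsilon_map_carrier[of Y] by simp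
    have f: "mat_entries (X + Y) ij = (\<Sum>a<2::nat. 1 * (if a = 0 then mat_entries X else mat_entries Y) ij)" if "ij \<in> {..<q} \<times> {..<p}" for ij
      using that X Y by (auto simp: mat_entries_def emb_add numeral_2_eq_2)
    have "?U (mat_entries (X + Y)) i = ?U (\<lambda>ij. \<Sum>a<2::nat. 1 * (if a = 0 then mat_entries X else mat_entries Y) ij) i"
      by (rule fun_cong[OF upsilon_cong]) (rule f, simp)
    also have "\<dots> = ?U (mat_entries X) i + ?U (mat_entries Y) i"
      unfolding upsilon_sum by (simp add: numeral_2_eq_2)
    finally have "emb (Upsilon_map G Om S (X + Y) $ i) = emb ((Upsilon_map G Om S X + Upsilon_map G Om S Y) $ i)"
      using i X Y Upsilon_map_carrier[of Y] by (simp add: emb_Upsilon_map emb_add)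
    thus "Upsilon_map G Om S (X + Y) $ i = (Upsilon_map G Om S X + Upsilon_map G Om S Y) $ i" by (simp only: emb_eq_iff)
  qed
  have smult: "Upsilon_map G Om S (c \<cdot>\<^sub>m X) = c \<cdot>\<^sub>v Upsilon_map G Om S X"
    if X: "X \<in> carrier_mat q p" for c and X :: "'a mat"
  proof (rule eq_vecI)
    show "dim_vec (Upsilon_map G Om S (c \<cdot>\<^sub>m X)) = dim_vec (c \<cdot>\<^sub>v Upsilon_map G Om S X)"
      using Upsilon_map_carrier[of "c \<cdot>\<^sub>m X"] Upsilon_map_carrier[of X] by simp
    fix i assume "i < dim_vec (c \<cdot>\<^sub>v Upsilon_map G Om S X)"
    hence i: "i < k" using Upsilon_map_carrier[of X] by simp
    have f: "mat_entries (c \<cdot>\<^sub>m X) ij = (\<Sum>a<1::nat. emb c * mat_entries X ij)" if "ij \<in> {..<q} \<times> {..<p}" for ij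
      using that X by (auto simp: mat_entries_def emb_mult)
    have "?U (mat_entries (c \<cdot>\<^sub>m X)) i = ?U (\<lambda>ij. \<Sum>a<1::nat. emb c * mat_entries X ij) i"
      by (rule fun_cong[OF upsilon_cong]) (rule f, simp)
    also have "\<dots> = emb c * ?U (mat_entries X) i" unfolding upsilon_sum by simp
    finally have "emb (Upsilon_map G Om S (c \<cdot>\<^sub>m X) $ i) = emb ((c \<cdot>\<^sub>v Upsilon_map G Om S X) $ i)"
      using i X Upsilon_map_carrier[of X] by (simp add: emb_Upsilon_map emb_mult)
    thus "Upsilon_map G Om S (c \<cdot>\<^sub>m X) $ i = (c \<cdot>\<^sub>v Upsilon_map G Om S X) $ i" by (simp only: emb_eq_iff)
  qed
  interpret V: vectorspace class_ring "module_mat TYPE('a) q p" by (rule matrix_vs)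
  interpret W: vectorspace class_ring "module_vec TYPE('a) k" by (rule vec_vs)
  show ?thesis
    by unfold_locales
      (auto simp: module_hom_def module_mat_simps module_vec_simps add smult Upsilon_map_carrier)
qed

end

text \<open>With \<open>b\<close> the error of the inner product, multiply \<open>y\<close> by the phase \<open>\<alpha>\<close> that makes it real, and scale \<open>x\<close> and \<open>y\<close>
to equal norms. The hypothesis for the sum and the difference of the scaled vectors bounds the error by \<open>\<epsilon>\<close> times the
mean of their squared norms, by the parallelogram law, which is \<open>\<epsilon>\<close> times the product of the norms. In the real case
the phase is a sign, so the combinations stay over \<open>K\<close>.\<close>

lemma polarization:
  assumes K: "K = \<real> \<or> K = UNIV" and finI: "finite I" "finite J"
    and B: "cip I x y - cip J u v \<in> K" and \<epsilon>: "0 < \<epsilon>"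
    and quad: "\<And>s \<alpha>. \<alpha> \<in> K \<Longrightarrow> \<bar>sqn J (\<lambda>i. of_real s * u i + \<alpha> * v i) - sqn I (\<lambda>i. of_real s * x i + \<alpha> * y i)\<bar>
        \<le> \<epsilon> * sqn I (\<lambda>i. of_real s * x i + \<alpha> * y i)"
  shows "cmod (cip I x y - cip J u v) \<le> \<epsilon> * sqrt (sqn I x) * sqrt (sqn I y)"
proof -
  define b where "b = cip I x y - cip J u v"
  have zero: "b = 0" if "sqn I x = 0 \<or> sqn I y = 0"
    using that
  proof
    assume 0: "sqn I x = 0"
    have "0 \<in> K" using K by auto
    hence "sqn J u \<le> 0" using quad[of 0 1] 0 by (simp add: abs_le_iff)
    hence "sqn J u = 0" using sqn_nonneg[of J u] by linarith
    thus ?thesis using 0 finI by (simp add: b_def cip_def sqn_eq_0_iff)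
  next
    assume 0: "sqn I y = 0"
    have "1 \<in> K" using K by auto
    hence "sqn J v \<le> 0" using quad[of 1 0] 0 by (simp add: abs_le_iff)
    hence "sqn J v = 0" using sqn_nonneg[of J v] by linarith
    thus ?thesis using 0 finI by (simp add: b_def cip_def sqn_eq_0_iff)
  qed
  show ?thesis
  proof (cases "b = 0")
    case True thus ?thesis unfolding b_def[symmetric] using \<epsilon> by simp
  next
    case False
    define X Y where "X = sqrt (sqn I x)" and "Y = sqrt (sqn I y)"
    have XY: "X > 0" "Y > 0" "X\<^sup>2 = sqn I x" "Y\<^sup>2 = sqn I y"
      using False zero sqn_nonneg[of I x] sqn_nonneg[of I y] by (auto simp: X_def Y_def less_le)
    define \<alpha> where "\<alpha> = cnj b / of_real (cmod b)"
    have \<alpha>K: "of_real t * \<alpha> \<in> K" for t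
    proof (cases "K = UNIV")
      case False
      hence R: "K = \<real>" using K by simp
      hence "b \<in> \<real>" using B unfolding b_def by simp
      hence "cnj b \<in> \<real>" by (simp add: Reals_cnj_iff)
      thus ?thesis unfolding R \<alpha>_def by (intro Reals_mult Reals_divide Reals_of_real)
    qed simp
    have \<alpha>1: "cmod \<alpha> = 1" using False by (simp add: \<alpha>_def norm_divide)
    have \<alpha>b: "\<alpha> * b = of_real (cmod b)"
    proof -
      have "cnj b * b = of_real ((cmod b)\<^sup>2)" by (simp only: of_real_cmod_sq)
      thus ?thesis using False by (simp add: \<alpha>_def power2_eq_square)
    qed
    have expand: "sqn T (\<lambda>i. of_real s * f i + (of_real t * \<alpha>) * g i) = s\<^sup>2 * sqn T f + t\<^sup>2 * sqn T g + 2 * s * t * Re (\<alpha> * cip T f g)"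
      for T :: "'z set" and f g s t
    proof -
      have e1: "Re (cip T (\<lambda>i. of_real s * f i + (of_real t * \<alpha>) * g i) (\<lambda>i. of_real s * f i + (of_real t * \<alpha>) * g i))
        = s\<^sup>2 * sqn T f + Re (of_real (s * t) * (\<alpha> * cip T f g)) + Re (of_real (s * t) * (cnj \<alpha> * cip T g f)) + Re ((cnj \<alpha> * \<alpha>) * (of_real (t\<^sup>2) * cip T g g))"
        unfolding cip_add_left cip_add_right cip_scale_left cip_scale_right sqn_eq_Re_cip
        by (simp add: power2_eq_square algebra_simps)
      have e2: "cnj \<alpha> * \<alpha> = 1" using \<alpha>1 of_real_cmod_sq[of \<alpha>] by simp
      have e3: "Re (cnj \<alpha> * cip T g f) = Re (\<alpha> * cip T f g)"
      proof -
        have e: "cnj \<alpha> * cip T g f = cnj (\<alpha> * cip T f g)" by (simp add: cip_cnj)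
        show ?thesis unfolding e by (simp only: cnj.simps)
      qed
      have R: "Re (of_real r * z) = r * Re z" for r z by simp
      show ?thesis
        unfolding sqn_eq_Re_cip e1[unfolded sqn_eq_Re_cip] by (simp only: R e2 e3 mult_1_left) algebra
    qed
    have q: "\<bar>(Y\<^sup>2 * sqn J u + t\<^sup>2 * sqn J v + 2 * Y * t * Re (\<alpha> * cip J u v)) - (Y\<^sup>2 * sqn I x + t\<^sup>2 * sqn I y + 2 * Y * t * Re (\<alpha> * cip I x y))\<bar>
       \<le> \<epsilon> * (Y\<^sup>2 * sqn I x + t\<^sup>2 * sqn I y + 2 * Y * t * Re (\<alpha> * cip I x y))" for t
      using quad[OF \<alpha>K, of Y t] unfolding expand .
    have Rb: "Re (\<alpha> * cip I x y) - Re (\<alpha> * cip J u v) = cmod b"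
      using arg_cong[OF \<alpha>b, of Re] by (simp add: b_def algebra_simps)
    define A A' N N' where "A = Y * X * Re (\<alpha> * cip I x y)" and "A' = Y * X * Re (\<alpha> * cip J u v)"
      and "N = Y\<^sup>2 * sqn I x + X\<^sup>2 * sqn I y" and "N' = Y\<^sup>2 * sqn J u + X\<^sup>2 * sqn J v"
    have AA: "A - A' = Y * X * cmod b"
      unfolding A_def A'_def Rb[symmetric] by (rule right_diff_distrib[symmetric])
    have gen: "4 * (a - a') \<le> r + r'"
      if "\<bar>(n' + 2 * a') - (n + 2 * a)\<bar> \<le> r" "\<bar>(n' - 2 * a') - (n - 2 * a)\<bar> \<le> r'" for n n' a a' r r' :: real
      using add_mono[OF abs_le_D2[OF that(1)] abs_le_D1[OF that(2)]] by (simp add: algebra_simps)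
    have "\<bar>(N' + 2 * A') - (N + 2 * A)\<bar> \<le> \<epsilon> * (N + 2 * A)"
      using q[of X] by (simp only: N_def N'_def A_def A'_def mult.assoc)
    moreover have "\<bar>(N' - 2 * A') - (N - 2 * A)\<bar> \<le> \<epsilon> * (N - 2 * A)"
      using q[of "- X"] by (simp only: N_def N'_def A_def A'_def mult.assoc power2_minus
          mult_minus_left mult_minus_right add_uminus_conv_diff)
    ultimately have "4 * (A - A') \<le> \<epsilon> * (N + 2 * A) + \<epsilon> * (N - 2 * A)" by (rule gen)
    also have "\<dots> = 2 * (\<epsilon> * N)" by (simp add: algebra_simps)
    finally have "4 * (Y * X * cmod b) \<le> 2 * (\<epsilon> * (2 * (X * X * (Y * Y))))"
      unfolding AA N_def XY(3,4)[symmetric] by (simp add: power2_eq_square mult_ac)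
    hence "(Y * X) * cmod b \<le> (Y * X) * (\<epsilon> * X * Y)" by (simp add: mult_ac)
    hence "cmod b \<le> \<epsilon> * X * Y" using mult_le_cancel_left_pos[OF mult_pos_pos[OF XY(2,1)]] by blast
    thus ?thesis unfolding b_def X_def Y_def .
  qed
qed

end

section \<open>Subspaces of matrices as families of combinations\<close>

text \<open>A linearly independent subset of \<open>W\<close> of maximal size spans \<open>W\<close>, so \<open>W\<close> has finite generating sets, and the
minimum in the definition of the dimension is attained.\<close>

lemma (in vectorspace) subspace_spanned_by_dim:
  assumes W: "VectorSpace.subspace K W V" and fin: fin_dim
  obtains A where "finite A" "card A = vectorspace.dim K (vs W)" "A \<subseteq> W" "span A = W"
proof -
  have sub: "submodule K W V" using W by (rule is_module)
  have WV: "W \<subseteq> carrier V" using sub by (simp add: submodule_def)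
  interpret W: vectorspace K "vs W" by (rule subspace_is_vs[OF W])
  have spanW: "W.span S = span S" if "S \<subseteq> W" for S
    by (rule span_li_not_depend(1)[OF that sub])
  define P where "P S \<longleftrightarrow> finite S \<and> S \<subseteq> W \<and> lin_indpt S" for S
  have le: "card S \<le> dim" if "P S" for S
    using li_le_dim(2)[OF fin] that WV unfolding P_def by blast
  have P0: "P {}" unfolding P_def lin_dep_def by auto
  obtain S where S: "P S" and max: "\<And>T. P T \<Longrightarrow> card T \<le> card S"
    using ex_has_greatest_nat[of P "{}" card "Suc dim", OF P0] le le_imp_less_Suc by blast
  have "W \<subseteq> span S"
  proof
    fix w assume w: "w \<in> W"
    show "w \<in> span S"
    proof (rule ccontr)
      assume n: "w \<notin> span S"
      have SV: "S \<subseteq> carrier V" using S WV by (auto simp: P_def)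
      have wS: "w \<notin> S" using n in_own_span[OF SV] by blast
      have "lin_indpt (S \<union> {w})"
        using lin_dep_iff_in_span[OF SV _ _ wS] S n w WV by (auto simp: P_def)
      hence "P (S \<union> {w})" using S w by (simp add: P_def)
      from max[OF this] show False using wS S by (simp add: P_def)
    qed
  qed
  moreover have "span S \<subseteq> W" using S span_is_subset[OF _ sub] by (simp add: P_def)
  ultimately have "W.span S = carrier (vs W)" using spanW S by (simp add: P_def)
  hence "\<exists>n A. finite A \<and> card A = n \<and> A \<subseteq> carrier (vs W) \<and> W.span A = carrier (vs W)"
    using S by (auto simp: P_def)
  hence "\<exists>A. finite A \<and> card A = W.dim \<and> A \<subseteq> carrier (vs W) \<and> W.span A = carrier (vs W)"
    unfolding W.dim_def by (rule LeastI_ex)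
  thus ?thesis using that spanW by auto
qed

text \<open>Linear combinations are written entrywise, which avoids the finite sums of the module structure.\<close>

definition mat_combination :: "nat \<Rightarrow> nat \<Rightarrow> 'b set \<Rightarrow> ('b \<Rightarrow> 'a :: field mat) \<Rightarrow> ('b \<Rightarrow> 'a) \<Rightarrow> 'a mat" where
  "mat_combination q p A B c = mat q p (\<lambda>ij. \<Sum>a\<in>A. c a * B a $$ ij)"

lemma mat_combination_in_submodule:
  assumes W: "submodule class_ring W (module_mat TYPE('a :: field) q p)" and B: "\<And>a. a \<in> A \<Longrightarrow> B a \<in> W"
  shows "mat_combination q p A B c \<in> W"
  using B
proof (induction A rule: infinite_finite_induct)
  case (insert a A)
  interpret W: submodule class_ring W "module_mat TYPE('a) q p" by (rule W)
  have Ba: "B a \<in> W" using insert.prems by simp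
  hence Bc: "B a \<in> carrier_mat q p" using W.subset by (auto simp: module_mat_simps)
  have "c a \<cdot>\<^sub>m B a \<in> W" using W.smult_closed[of "c a" "B a"] Ba by (simp add: module_mat_simps class_ring_simps)
  hence "c a \<cdot>\<^sub>m B a + mat_combination q p A B c \<in> W"
    using W.m_closed insert by (simp add: module_mat_simps)
  also have "c a \<cdot>\<^sub>m B a + mat_combination q p A B c = mat_combination q p (insert a A) B c"
    using insert.hyps Bc by (intro eq_matI) (simp_all add: mat_combination_def)
  finally show ?case .
qed (use W in \<open>simp_all add: submodule_def module_mat_simps mat_combination_def zero_mat_def\<close>)

lemma submodule_mat_combinations:
  assumes B: "\<And>a. a \<in> A \<Longrightarrow> B a \<in> carrier_mat q p"
  shows "submodule class_ring (range (mat_combination q p A B)) (module_mat TYPE('a :: field) q p)"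
proof (rule submodule.intro)
  show "module class_ring (module_mat TYPE('a) q p)" by (rule vectorspace.axioms(1)[OF matrix_vs])
  show "range (mat_combination q p A B) \<subseteq> carrier (module_mat TYPE('a) q p)"
    by (auto simp: module_mat_simps mat_combination_def)
  have "0\<^sub>m q p = mat_combination q p A B (\<lambda>_. 0)" by (simp add: mat_combination_def zero_mat_def)
  thus "zero (module_mat TYPE('a) q p) \<in> range (mat_combination q p A B)" by (simp add: module_mat_simps)
next
  fix v w assume "v \<in> range (mat_combination q p A B)" "w \<in> range (mat_combination q p A B)"
  then obtain c c' where "v = mat_combination q p A B c" "w = mat_combination q p A B c'" by auto
  hence "v + w = mat_combination q p A B (\<lambda>a. c a + c' a)"
    by (intro eq_matI) (simp_all add: mat_combination_def sum.distrib distrib_right)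
  thus "add (module_mat TYPE('a) q p) v w \<in> range (mat_combination q p A B)" by (simp add: module_mat_simps)
next
  fix s :: 'a and v assume "v \<in> range (mat_combination q p A B)"
  then obtain c where "v = mat_combination q p A B c" by auto
  hence "s \<cdot>\<^sub>m v = mat_combination q p A B (\<lambda>a. s * c a)"
    by (intro eq_matI) (simp_all add: mat_combination_def sum_distrib_left mult.assoc)
  thus "smult (module_mat TYPE('a) q p) s v \<in> range (mat_combination q p A B)" by (simp add: module_mat_simps)
qed

lemma mat_fin_dim: "vectorspace.fin_dim class_ring (module_mat TYPE('a :: field) q p)"
proof -
  interpret V: vectorspace class_ring "module_mat TYPE('a) q p" by (rule matrix_vs)
  define E :: "nat \<times> nat \<Rightarrow> 'a mat" where "E kl = mat q p (\<lambda>ij. of_bool (ij = kl))" for kl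
  let ?A = "E ` ({..<q} \<times> {..<p})"
  have A: "?A \<subseteq> carrier (module_mat TYPE('a) q p)" by (auto simp: E_def module_mat_simps)
  have "X \<in> V.span ?A" if X: "X \<in> carrier_mat q p" for X
  proof -
    have "(\<Sum>kl\<in>{..<q} \<times> {..<p}. X $$ kl * E kl $$ ij) = X $$ ij" if ij: "ij \<in> {..<q} \<times> {..<p}" for ij
    proof -
      have "(\<Sum>kl\<in>{..<q} \<times> {..<p}. X $$ kl * E kl $$ ij) = (\<Sum>kl\<in>{..<q} \<times> {..<p}. if kl = ij then X $$ kl else 0)"
        using ij by (intro sum.cong) (auto simp: E_def)
      thus ?thesis using ij by simp
    qed
    hence "X = mat_combination q p ({..<q} \<times> {..<p}) E (\<lambda>kl. X $$ kl)"
      using X by (intro eq_matI) (auto simp: mat_combination_def)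
    also have "\<dots> \<in> V.span ?A"
      by (rule mat_combination_in_submodule[OF V.span_is_submodule[OF A]]) (use V.in_own_span[OF A] in blast)
    finally show ?thesis .
  qed
  hence "V.span ?A = carrier (module_mat TYPE('a) q p)"
    using V.span_is_subset2[OF A] by (auto simp: module_mat_simps)
  thus ?thesis unfolding V.fin_dim_def using A by (intro exI[of _ ?A]) simp
qed

lemma subspace_eq_mat_combinations:
  assumes W: "VectorSpace.subspace class_ring W (module_mat TYPE('a :: field) q p)"
    and dim: "vectorspace.dim class_ring ((module_mat TYPE('a) q p)\<lparr>carrier := W\<rparr>) = d"
  obtains B :: "nat \<Rightarrow> 'a :: field mat" where "W = range (mat_combination q p {..<d} B)"
proof -
  interpret V: vectorspace class_ring "module_mat TYPE('a) q p" by (rule matrix_vs)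
  have sub: "submodule class_ring W (module_mat TYPE('a) q p)" using W by (rule V.is_module)
  obtain A where A: "finite A" "card A = d" "A \<subseteq> W" "V.span A = W"
    using V.subspace_spanned_by_dim[OF W mat_fin_dim] dim by blast
  obtain B where B: "bij_betw B {..<d} A"
    using ex_bij_betw_nat_finite[OF A(1)] A(2) by (auto simp: atLeast0LessThan)
  have BW: "B a \<in> W" if "a < d" for a using bij_betwE[OF B] that A(3) by auto
  have Bc: "B a \<in> carrier_mat q p" if "a < d" for a
    using BW[OF that] sub by (auto simp: submodule_def module_mat_simps)
  have "A \<subseteq> range (mat_combination q p {..<d} B)"
  proof
    fix X assume "X \<in> A"
    then obtain a where a: "a < d" "X = B a" using B by (auto simp: bij_betw_def)
    have "(\<Sum>b<d. of_bool (b = a) * B b $$ ij) = B a $$ ij" for ij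
    proof -
      have "(\<Sum>b<d. of_bool (b = a) * B b $$ ij) = (\<Sum>b<d. if b = a then B b $$ ij else 0)"
        by (intro sum.cong) auto
      thus ?thesis using a by simp
    qed
    hence "X = mat_combination q p {..<d} B (\<lambda>b. of_bool (b = a))"
      using Bc[OF a(1)] a(2) by (intro eq_matI) (auto simp: mat_combination_def)
    thus "X \<in> range (mat_combination q p {..<d} B)" by blast
  qed
  hence "W \<subseteq> range (mat_combination q p {..<d} B)"
    unfolding A(4)[symmetric] by (intro V.span_is_subset submodule_mat_combinations) (use Bc in auto)
  moreover have "mat_combination q p {..<d} B c \<in> W" for c
    by (rule mat_combination_in_submodule[OF sub]) (use BW in simp)
  ultimately have "W = range (mat_combination q p {..<d} B)" by auto
  thus ?thesis by (rule that)
qed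

section \<open>The embedding property\<close>

lemma upsilon_measurable:
  assumes G: "G \<in> M \<rightarrow>\<^sub>M borel_mat k (kS * kO)" and Om: "Om \<in> M \<rightarrow>\<^sub>M borel_mat kO q"
    and S: "S \<in> M \<rightarrow>\<^sub>M borel_mat kS p" and i: "i < k"
  shows "(\<lambda>\<omega>. upsilon q p kO kS (G \<omega>) (Om \<omega>) (S \<omega>) X i) \<in> borel_measurable M"
proof -
  have e: "(\<lambda>\<omega>. complex_of_real (A \<omega> $$ (a, b))) \<in> borel_measurable M"
    if "A \<in> M \<rightarrow>\<^sub>M borel_mat m n" "a < m" "b < n" for A m n a b
    using entry_measurable[OF that] by measurable
  have "t mod kO < kO" "t div kO < kS" if "t < kS * kO" for t
    using that by (cases "kO = 0"; auto simp: less_mult_imp_div_less)+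
  thus ?thesis
    unfolding upsilon_def mat_apply_def left_mult_vec_def right_mult_def case_prod_conv
    by (intro borel_measurable_sum borel_measurable_times borel_measurable_const e[OF G] e[OF Om] e[OF S])
      (use i in auto)
qed

lemma sqn_cong: "(\<And>i. i \<in> I \<Longrightarrow> x i = y i) \<Longrightarrow> sqn I x = sqn I y"
  unfolding sqn_def by (intro sum.cong) simp_all

lemma cip_cong: "(\<And>i. i \<in> I \<Longrightarrow> x i = x' i) \<Longrightarrow> (\<And>i. i \<in> I \<Longrightarrow> y i = y' i) \<Longrightarrow> cip I x y = cip I x' y'"
  unfolding cip_def by (intro sum.cong) simp_all

context scalar_embedding
begin

text \<open>The embedding property on the subspace is equivalent to a condition on the coefficient vector that is continuous in
it, which provides measurability as well as the link to the quadratic form.\<close>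

lemma embedding_event_iff:
  fixes q p kO kS k d :: nat and B :: "nat \<Rightarrow> 'a mat"
  defines "W \<equiv> range (mat_combination q p {..<d} B)"
    and "Z \<equiv> \<lambda>c ij. \<Sum>a<d. emb (c a) * mat_entries (B a) ij"
  assumes G: "G \<in> carrier_mat k (kS * kO)" and Om: "Om \<in> carrier_mat kO q" and S: "S \<in> carrier_mat kS p"
    and K: "K = \<real> \<or> K = UNIV" and \<epsilon>: "0 < \<epsilon>"
  shows "(\<forall>x\<in>W. \<forall>y\<in>W. norm (frobenius_inner x y - Upsilon_map G Om S y \<bullet>c Upsilon_map G Om S x)
        \<le> \<epsilon> * ip_norm frobenius_inner x * ip_norm frobenius_inner y)
     \<longleftrightarrow> (\<forall>c. \<bar>sqn {..<k} (upsilon q p kO kS G Om S (Z c)) - sqn ({..<q} \<times> {..<p}) (Z c)\<bar> - \<epsilon> * sqn ({..<q} \<times> {..<p}) (Z c) \<le> 0)"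
    (is "?emb \<longleftrightarrow> ?quad")
proof -
  let ?I = "{..<q} \<times> {..<p}" and ?U = "upsilon q p kO kS G Om S" and ?C = "mat_combination q p {..<d} B"
  have C: "?C c \<in> carrier_mat q p" for c by (simp add: mat_combination_def)
  have flatC: "mat_entries (?C c) ij = Z c ij" if "ij \<in> ?I" for c ij
    using that by (auto simp: mat_entries_def mat_combination_def Z_def emb_sum emb_mult)
  have UC: "?U (mat_entries (?C c)) = ?U (Z c)" for c by (rule upsilon_cong) (simp add: flatC)
  have nrm: "ip_norm frobenius_inner (?C c) = sqrt (sqn ?I (Z c))" for c
    unfolding ip_norm_frobenius[OF C] by (intro arg_cong[of _ _ sqrt] sqn_cong flatC)
  have emb_diff_C: "emb (frobenius_inner (?C c) (?C c') - Upsilon_map G Om S (?C c') \<bullet>c Upsilon_map G Om S (?C c))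
     = cip ?I (Z c) (Z c') - cip {..<k} (?U (Z c)) (?U (Z c'))" for c c'
  proof -
    have "cip ?I (mat_entries (?C c)) (mat_entries (?C c')) = cip ?I (Z c) (Z c')" by (intro cip_cong flatC)
    thus ?thesis unfolding emb_diff emb_frobenius_inner[OF C C] emb_cscalar_Upsilon[OF G Om S C C] UC by simp
  qed
  have base: "norm (frobenius_inner (?C c) (?C c') - Upsilon_map G Om S (?C c') \<bullet>c Upsilon_map G Om S (?C c))
     = cmod (cip ?I (Z c) (Z c') - cip {..<k} (?U (Z c)) (?U (Z c')))" for c c'
    unfolding emb_norm[symmetric] emb_diff_C ..
  have "?emb \<longleftrightarrow> (\<forall>c c'. norm (frobenius_inner (?C c) (?C c') - Upsilon_map G Om S (?C c') \<bullet>c Upsilon_map G Om S (?C c))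
        \<le> \<epsilon> * ip_norm frobenius_inner (?C c) * ip_norm frobenius_inner (?C c'))"
    unfolding W_def by simp
  hence emb_iff: "?emb \<longleftrightarrow> (\<forall>c c'. cmod (cip ?I (Z c) (Z c') - cip {..<k} (?U (Z c)) (?U (Z c')))
      \<le> \<epsilon> * sqrt (sqn ?I (Z c)) * sqrt (sqn ?I (Z c')))"
    unfolding base nrm .
  show ?thesis unfolding emb_iff
  proof (intro iffI allI)
    fix c assume *: "\<forall>c c'. cmod (cip ?I (Z c) (Z c') - cip {..<k} (?U (Z c)) (?U (Z c')))
      \<le> \<epsilon> * sqrt (sqn ?I (Z c)) * sqrt (sqn ?I (Z c'))"
    have "cip ?I (Z c) (Z c) - cip {..<k} (?U (Z c)) (?U (Z c)) = of_real (sqn ?I (Z c) - sqn {..<k} (?U (Z c)))"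
      unfolding of_real_diff sqn_cip ..
    hence "\<bar>sqn ?I (Z c) - sqn {..<k} (?U (Z c))\<bar> \<le> \<epsilon> * sqrt (sqn ?I (Z c)) * sqrt (sqn ?I (Z c))"
      using *[rule_format, of c c] by (simp only: norm_of_real)
    also have "\<dots> = \<epsilon> * sqn ?I (Z c)" by simp
    finally show "\<bar>sqn {..<k} (?U (Z c)) - sqn ?I (Z c)\<bar> - \<epsilon> * sqn ?I (Z c) \<le> 0"
      unfolding abs_minus_commute[of "sqn ?I (Z c)"] by simp
  next
    fix c c' assume quad: ?quad
    have comb: "(\<lambda>i. of_real s * Z c i + emb \<beta> * Z c' i) = Z (\<lambda>a. of_real s * c a + \<beta> * c' a)" for s \<beta>
      by (simp add: Z_def fun_eq_iff emb_add emb_mult emb_of_real sum_distrib_left sum.distrib distrib_right mult.assoc)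
    have combU: "(\<lambda>i. of_real s * ?U (Z c) i + emb \<beta> * ?U (Z c') i) = ?U (Z (\<lambda>a. of_real s * c a + \<beta> * c' a))" for s \<beta>
      unfolding Z_def upsilon_sum
      by (simp add: fun_eq_iff emb_add emb_mult emb_of_real sum_distrib_left sum.distrib distrib_right mult.assoc)
    show "cmod (cip ?I (Z c) (Z c') - cip {..<k} (?U (Z c)) (?U (Z c'))) \<le> \<epsilon> * sqrt (sqn ?I (Z c)) * sqrt (sqn ?I (Z c'))"
    proof (rule polarization[OF K _ _ _ \<epsilon>])
      show "cip ?I (Z c) (Z c') - cip {..<k} (?U (Z c)) (?U (Z c')) \<in> K"
        unfolding emb_diff_C[symmetric] range_emb[symmetric] by (rule rangeI)
      fix s \<alpha> assume "\<alpha> \<in> K"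
      then obtain \<beta> where \<alpha>: "\<alpha> = emb \<beta>" unfolding range_emb[symmetric] by auto
      show "\<bar>sqn {..<k} (\<lambda>i. of_real s * ?U (Z c) i + \<alpha> * ?U (Z c') i) - sqn ?I (\<lambda>i. of_real s * Z c i + \<alpha> * Z c' i)\<bar>
        \<le> \<epsilon> * sqn ?I (\<lambda>i. of_real s * Z c i + \<alpha> * Z c' i)"
        unfolding \<alpha> comb combU using quad by simp
    qed auto
  qed
qed

text \<open>The event is measurable by \<open>sets_Collect_all_continuous\<close> and contains the complement of the exceptional set of
\<open>upsilon_quadratic_form\<close>.\<close>

theorem upsilon_oblivious_embedding:
  fixes M :: "'w measure" and \<eta> :: nat
  assumes M: "prob_space M" and pos: "0 < q" "0 < d" "0 < kS" "0 < kO" "0 < k"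
    and \<epsilon>: "0 < \<epsilon>" "\<epsilon> < 1" and \<delta>: "0 < \<delta>" "\<delta> < 1"
    and S: "rescaled_gaussian M kS p S" and Om: "psrht M kO q Om" and G: "psrht M k (kS * kO) G"
    and ind: "prob_space.indep_vars M (\<lambda>i. [borel_mat kS p, borel_mat kO q, borel_mat k (kS * kO)] ! i)
           (\<lambda>i. [S, Om, G] ! i) {0, 1, 2}"
    and K: "K = \<real> \<and> \<eta> = 1 \<or> K = UNIV \<and> \<eta> = 2"
    and kS: "real kS \<ge> 168 / \<epsilon>\<^sup>2 * (6.9 * real \<eta> * real d + ln (6 / \<delta>))"
    and kO: "real kO \<ge> 32 * ((sqrt (real d) + sqrt (8 * ln (18 * real q * real kS / \<delta>)))\<^sup>2
           / (\<epsilon>\<^sup>2 - \<epsilon> ^ 3 / 12)) * ln (9 * real d * real kS / \<delta>)"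
    and k: "real k \<ge> 32 * ((sqrt (real d) + sqrt (8 * ln (18 * real kO * real kS / \<delta>)))\<^sup>2
           / (\<epsilon>\<^sup>2 - \<epsilon> ^ 3 / 12)) * ln (9 * real d / \<delta>)"
  shows "oblivious_subspace_embedding M (module_mat TYPE('a) q p) frobenius_inner k \<epsilon> \<delta> d
              (\<lambda>\<omega>. Upsilon_map (G \<omega>) (Om \<omega>) (S \<omega>))"
proof -
  interpret P: prob_space M by (rule M)
  have K': "K = \<real> \<or> K = UNIV" using K by blast
  have meas: "G \<in> M \<rightarrow>\<^sub>M borel_mat k (kS * kO)" "Om \<in> M \<rightarrow>\<^sub>M borel_mat kO q" "S \<in> M \<rightarrow>\<^sub>M borel_mat kS p"
    using S Om G by (simp_all add: psrht_def rescaled_gaussian_def)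
  have car: "G \<omega> \<in> carrier_mat k (kS * kO)" "Om \<omega> \<in> carrier_mat kO q" "S \<omega> \<in> carrier_mat kS p" if "\<omega> \<in> space M" for \<omega>
    using meas[THEN measurable_space, OF that] by (simp_all only: space_borel_mat)
  show ?thesis unfolding oblivious_subspace_embedding_def
  proof (intro conjI ballI allI impI)
    fix \<omega> assume "\<omega> \<in> space M"
    from Upsilon_map_linear[OF car[OF this]]
    show "VectorSpace.linear_map class_ring (module_mat TYPE('a) q p) (module_vec TYPE('a) k) (Upsilon_map (G \<omega>) (Om \<omega>) (S \<omega>))" .
  next
    fix z i assume "z \<in> carrier (module_mat TYPE('a) q p)" and i: "i < k"
    hence z: "z \<in> carrier_mat q p" by (simp add: module_mat_simps)
    have "(\<lambda>\<omega>. ret (upsilon q p kO kS (G \<omega>) (Om \<omega>) (S \<omega>) (mat_entries z) i)) \<in> borel_measurable M"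
      by (rule measurable_compose[OF upsilon_measurable[OF meas i] ret_measurable])
    moreover have "ret (upsilon q p kO kS (G \<omega>) (Om \<omega>) (S \<omega>) (mat_entries z) i) = Upsilon_map (G \<omega>) (Om \<omega>) (S \<omega>) z $ i" if "\<omega> \<in> space M" for \<omega>
      unfolding emb_Upsilon_map[OF car[OF that] z i, symmetric] by (rule ret_emb)
    ultimately show "(\<lambda>\<omega>. Upsilon_map (G \<omega>) (Om \<omega>) (S \<omega>) z $ i) \<in> borel_measurable M"
      by (subst measurable_cong) auto
  next
    fix W assume W: "VectorSpace.subspace class_ring W (module_mat TYPE('a) q p)"
      and dim: "vectorspace.dim class_ring ((module_mat TYPE('a) q p)\<lparr>carrier := W\<rparr>) = d"
    obtain B :: "nat \<Rightarrow> 'a mat" where B: "W = range (mat_combination q p {..<d} B)"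
      by (rule subspace_eq_mat_combinations[OF W dim])
    define Z where "Z = (\<lambda>c ij. \<Sum>a<d. emb (c a) * mat_entries (B a) ij)"
    define f where "f = (\<lambda>\<omega> c. \<bar>sqn {..<k} (upsilon q p kO kS (G \<omega>) (Om \<omega>) (S \<omega>) (Z c)) - sqn ({..<q} \<times> {..<p}) (Z c)\<bar>
        - \<epsilon> * sqn ({..<q} \<times> {..<p}) (Z c))"
    let ?E = "{\<omega> \<in> space M. \<forall>x\<in>W. \<forall>y\<in>W.
          norm (frobenius_inner x y - Upsilon_map (G \<omega>) (Om \<omega>) (S \<omega>) y \<bullet>c Upsilon_map (G \<omega>) (Om \<omega>) (S \<omega>) x)
            \<le> \<epsilon> * ip_norm frobenius_inner x * ip_norm frobenius_inner y}"
    have E: "?E = {\<omega> \<in> space M. \<forall>c. f \<omega> c \<le> 0}"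
    proof (rule Collect_cong, rule conj_cong[OF refl])
      fix \<omega> assume "\<omega> \<in> space M"
      show "(\<forall>x\<in>W. \<forall>y\<in>W. norm (frobenius_inner x y - Upsilon_map (G \<omega>) (Om \<omega>) (S \<omega>) y \<bullet>c Upsilon_map (G \<omega>) (Om \<omega>) (S \<omega>) x)
            \<le> \<epsilon> * ip_norm frobenius_inner x * ip_norm frobenius_inner y) \<longleftrightarrow> (\<forall>c. f \<omega> c \<le> 0)"
        unfolding f_def Z_def B by (rule embedding_event_iff[OF car[OF \<open>\<omega> \<in> space M\<close>] K' \<epsilon>(1)])
    qed
    have cemb: "continuous_on UNIV (\<lambda>c :: nat \<Rightarrow> 'a. emb (c a))" for a
      by (rule continuous_on_compose2[OF emb_continuous continuous_on_product_coordinates]) auto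
    have meas_E: "?E \<in> sets M" unfolding E
    proof (rule sets_Collect_all_continuous)
      show "continuous_on UNIV (f \<omega>)" for \<omega>
        unfolding f_def Z_def upsilon_sum sqn_def by (intro continuous_intros cemb)
      have nm: "(\<lambda>\<omega>. cmod (upsilon q p kO kS (G \<omega>) (Om \<omega>) (S \<omega>) (Z c) i)) \<in> borel_measurable M" if "i < k" for c i
        using upsilon_measurable[OF meas that] by measurable
      show "(\<lambda>\<omega>. f \<omega> c) \<in> borel_measurable M" for c
        unfolding f_def sqn_def
        by (intro borel_measurable_diff borel_measurable_times borel_measurable_const borel_measurable_abs
          borel_measurable_sum borel_measurable_power nm) auto
    qed
    obtain N where N: "N \<in> sets M" and N': "P.prob N \<le> \<delta> \<and> (\<forall>\<omega>\<in>space M - N. \<forall>c. (\<forall>a. c a \<in> K) \<longrightarrow>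
     \<bar>sqn {..<k} (upsilon q p kO kS (G \<omega>) (Om \<omega>) (S \<omega>) (\<lambda>i. \<Sum>a<d. c a * mat_entries (B a) i)) - sqn ({..<q} \<times> {..<p}) (\<lambda>i. \<Sum>a<d. c a * mat_entries (B a) i)\<bar>
       \<le> \<epsilon> * sqn ({..<q} \<times> {..<p}) (\<lambda>i. \<Sum>a<d. c a * mat_entries (B a) i))"
      using P.upsilon_quadratic_form[OF pos \<epsilon> \<delta> S Om G ind K kS kO k, of "\<lambda>a. mat_entries (B a)"] by (rule bexE)
    have "space M - N \<subseteq> ?E" unfolding E
    proof (intro subsetI CollectI conjI allI)
      fix \<omega> and c :: "nat \<Rightarrow> 'a" assume \<omega>: "\<omega> \<in> space M - N"
      thus "\<omega> \<in> space M" by simp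
      have "emb (c a) \<in> K" for a unfolding range_emb[symmetric] by (rule rangeI)
      hence "\<forall>a. emb (c a) \<in> K" by blast
      from N'[THEN conjunct2, rule_format, OF \<omega>, OF this[rule_format]] show "f \<omega> c \<le> 0" unfolding f_def Z_def by simp
    qed
    hence "P.prob (space M - N) \<le> P.prob ?E" using meas_E by (rule P.finite_measure_mono)
    thus "1 - \<delta> \<le> P.prob ?E" using P.prob_compl[OF N] N'[THEN conjunct1] by linarith
  qed
qed

end

lemma real_scalar_embedding: "scalar_embedding (of_real :: real \<Rightarrow> complex) Re \<real>"
  by unfold_locales (auto simp: Reals_def intro!: continuous_intros)

lemma complex_scalar_embedding: "scalar_embedding (\<lambda>z :: complex. z) (\<lambda>z. z) UNIV"
  by unfold_locales (auto simp: conjugate_complex_def)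

theorem proposition3p8:
  fixes M :: "'w measure"
    and S Om G :: "'w \<Rightarrow> real mat"
    and p q d kS kO k :: nat
    and \<epsilon> \<delta> \<eta> :: real
  assumes "prob_space M"
    and "0 < p" "0 < q" "0 < d" "0 < kS" "0 < kO" "0 < k"
    and "0 < \<epsilon>" "\<epsilon> < 1" "0 < \<delta>" "\<delta> < 1"
    and "rescaled_gaussian M kS p S"
    and "psrht M kO q Om"
    and "psrht M k (kS * kO) G"
    and "prob_space.indep_vars M
           (\<lambda>i. [borel_mat kS p, borel_mat kO q, borel_mat k (kS * kO)] ! i)
           (\<lambda>i. [S, Om, G] ! i) {0, 1, 2}"
    and "real kS \<ge> 168 / \<epsilon>\<^sup>2 * (6.9 * \<eta> * real d + ln (6 / \<delta>))"
    and "real kO \<ge> 32 * ((sqrt (real d) + sqrt (8 * ln (18 * real q * real kS / \<delta>)))\<^sup>2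
           / (\<epsilon>\<^sup>2 - \<epsilon> ^ 3 / 12)) * ln (9 * real d * real kS / \<delta>)"
    and "real k \<ge> 32 * ((sqrt (real d) + sqrt (8 * ln (18 * real kO * real kS / \<delta>)))\<^sup>2
           / (\<epsilon>\<^sup>2 - \<epsilon> ^ 3 / 12)) * ln (9 * real d / \<delta>)"
  shows "(\<eta> = 1 \<longrightarrow>
            oblivious_subspace_embedding M (module_mat TYPE(real) q p) frobenius_inner k \<epsilon> \<delta> d
              (\<lambda>\<omega>. Upsilon_map (G \<omega>) (Om \<omega>) (S \<omega>))) \<and>
         (\<eta> = 2 \<longrightarrow>
            oblivious_subspace_embedding M (module_mat TYPE(complex) q p) frobenius_inner k \<epsilon> \<delta> d
              (\<lambda>\<omega>. Upsilon_map (G \<omega>) (Om \<omega>) (S \<omega>)))"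
proof (intro conjI impI)
  assume \<eta>: "\<eta> = 1"
  have kS: "real kS \<ge> 168 / \<epsilon>\<^sup>2 * (6.9 * real (1::nat) * real d + ln (6 / \<delta>))"
    using assms(16) by (simp only: \<eta> of_nat_1)
  show "oblivious_subspace_embedding M (module_mat TYPE(real) q p) frobenius_inner k \<epsilon> \<delta> d
              (\<lambda>\<omega>. Upsilon_map (G \<omega>) (Om \<omega>) (S \<omega>))"
    by (rule scalar_embedding.upsilon_oblivious_embedding
        [OF real_scalar_embedding assms(1,3-15) _ kS assms(17,18)]) simp
next
  assume \<eta>: "\<eta> = 2"
  have kS: "real kS \<ge> 168 / \<epsilon>\<^sup>2 * (6.9 * real (2::nat) * real d + ln (6 / \<delta>))"
    using assms(16) by (simp only: \<eta> of_nat_numeral)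
  show "oblivious_subspace_embedding M (module_mat TYPE(complex) q p) frobenius_inner k \<epsilon> \<delta> d
              (\<lambda>\<omega>. Upsilon_map (G \<omega>) (Om \<omega>) (S \<omega>))"
    by (rule scalar_embedding.upsilon_oblivious_embedding
        [OF complex_scalar_embedding assms(1,3-15) _ kS assms(17,18)]) simp
qed

end
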